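(* Let $A$ and $B$ be two polytopes in $\mathbb{R}^d$ and let $L$ be a lattice in $\mathbb{R}^d$. Then $A$ and $B$ are equidecomposable with respect to translations by vectors from $L$ if and only if $A$ and $B$ have the same volume and $H_\Phi(A,L)=H_\Phi(B,L)$ for every $r$-flag $\Phi$ with $0\le r\le d-1$.
   Context: A simplex in $\mathbb{R}^d$ is the convex hull of $d+1$ points not all lying in a hyperplane. A polytope in $\mathbb{R}^d$ is a union of finitely many simplices with pairwise disjoint interiors (not necessarily convex or connected). A lattice $L$ in $\mathbb{R}^d$ is the subgroup generated by $d$ linearly independent vectors. Polytopes $A,B$ are equidecomposable with respect to translations by vectors from $L$ if $A=\bigcup_{j=1}^N A_j$ and $B=\bigcup_{j=1}^N B_j$ where $A_1,\dots,A_N$ are polytopes with pairwise disjoint interiors, $B_1,\dots,B_N$ are polytopes with pairwise disjoint interiors, and $B_j=A_j+\lambda_j$ for some $\lambda_j\in L$. For $0\le r\le d-1$, an $r$-flag $\Phi$ is a sequence of affine subspaces $V_r\subset V_{r+1}\subset\cdots\subset V_{d-1}\subset V_d=\mathbb{R}^d$ with $\dim V_j=j$, together with, for each $r\le j\le d-1$, a designation of one of the two half-spaces of $V_{j+1}$ bounded by $V_j$ as positive and the other as negative. Given a polytope $A$, consider chains of faces $F_r\subset\cdots\subset F_{d-1}\subset F_d=A$ where $F_j$ is a $j$-dimensional face of $A$ contained in $V_j$; assign $\varepsilon_j=+1$ if $F_{j+1}$ adjoins $V_j$ from the positive side and $-1$ if from the negative side. Define $\omega_\Phi(A)=\sum \varepsilon_r\cdots\varepsilon_{d-1}\mathrm{Vol}_r(F_r)$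 over all such chains ($0$ if none), with a $0$-dimensional face being a vertex of volume $1$. The Hadwiger functional is $H_\Phi(A,L)=\sum_\Psi\omega_\Psi(A)$, where $\Psi$ runs over all distinct $r$-flags obtainable from $\Phi$ by translating all subspaces together with their positive/negative half-spaces by some $\lambda\in L$ (each counted once). *)

theory Defs
  imports "HOL-Analysis.Analysis" "HOL-Computational_Algebra.Group_Closure"
begin

text \<open>Not necessarily convex or connected, unlike the library's \<^const>\<open>polytope\<close>.\<close>

definition polytope_region :: "'a::euclidean_space set \<Rightarrow> bool" where
  "polytope_region A \<longleftrightarrow>
     (\<exists>\<S>. finite \<S> \<and> (\<forall>S\<in>\<S>. int DIM('a) simplex S) \<and>
          pairwise (\<lambda>S T. interior S \<inter> interior T = {}) \<S> \<and> A = \<Union>\<S>)"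

definition is_lattice :: "'a::euclidean_space set \<Rightarrow> bool" where
  "is_lattice L \<longleftrightarrow> (\<exists>B. independent B \<and> card B = DIM('a) \<and> L = group_closure B)"

definition equidecomposable ::
  "'a::euclidean_space set \<Rightarrow> 'a set \<Rightarrow> 'a set \<Rightarrow> bool" where
  "equidecomposable L A B \<longleftrightarrow>
     (\<exists>(N::nat) P Q l.
        (\<forall>j<N. polytope_region (P j) \<and> polytope_region (Q j)) \<and>
        pairwise (\<lambda>i j. interior (P i) \<inter> interior (P j) = {}) {..<N} \<and>
        pairwise (\<lambda>i j. interior (Q i) \<inter> interior (Q j) = {}) {..<N} \<and>
        A = (\<Union>j<N. P j) \<and> B = (\<Union>j<N. Q j) \<and>
        (\<forall>j<N. l j \<in> L \<and> Q j = (+) (l j) ` P j))"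

text \<open>\<open>flat \<Phi> j\<close> is the affine subspace \<open>V\<^sub>j\<close> for \<open>r \<le> j \<le> d\<close>, and \<open>pos \<Phi> j\<close> is the closed
  half-space of \<open>V\<^sub>j\<^sub>+\<^sub>1\<close> bounded by \<open>V\<^sub>j\<close> that is designated positive, for \<open>r \<le> j < d\<close>.
  Extensionality outside these ranges makes equality of the representations coincide with
  equality of flags.\<close>

datatype 'a flag = Flag (flat: "nat \<Rightarrow> 'a set") (pos: "nat \<Rightarrow> 'a set")

definition halfspace_of :: "'a::euclidean_space set \<Rightarrow> 'a set \<Rightarrow> 'a set \<Rightarrow> bool" where
  "halfspace_of V W Q \<longleftrightarrow>
     (\<exists>a b. W = {x \<in> V. a \<bullet> x = b} \<and> Q = {x \<in> V. a \<bullet> x \<ge> b})"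

definition is_flag :: "nat \<Rightarrow> 'a::euclidean_space flag \<Rightarrow> bool" where
  "is_flag r \<Phi> \<longleftrightarrow>
     flat \<Phi> \<in> extensional {r..DIM('a)} \<and> pos \<Phi> \<in> extensional {r..<DIM('a)} \<and>
     flat \<Phi> DIM('a) = UNIV \<and>
     (\<forall>j\<in>{r..DIM('a)}. affine (flat \<Phi> j) \<and> aff_dim (flat \<Phi> j) = int j) \<and>
     (\<forall>j\<in>{r..<DIM('a)}. flat \<Phi> j \<subseteq> flat \<Phi> (Suc j) \<and>
        halfspace_of (flat \<Phi> (Suc j)) (flat \<Phi> j) (pos \<Phi> j))"

definition neg :: "'a flag \<Rightarrow> nat \<Rightarrow> 'a set" where
  "neg \<Phi> j = (flat \<Phi> (Suc j) - pos \<Phi> j) \<union> flat \<Phi> j"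

definition translate_flag :: "nat \<Rightarrow> 'a::euclidean_space \<Rightarrow> 'a flag \<Rightarrow> 'a flag" where
  "translate_flag r l \<Phi> =
     Flag (restrict (\<lambda>j. (+) l ` flat \<Phi> j) {r..DIM('a)})
          (restrict (\<lambda>j. (+) l ` pos \<Phi> j) {r..<DIM('a)})"

text \<open>The facets of \<open>P\<close> that lie in \<open>W\<close> and that \<open>P\<close> adjoins from the side of \<open>Q\<close>, where \<open>Q\<close> is
  a closed half-space, bounded by \<open>W\<close>, of the affine subspace carrying \<open>P\<close>. The relative interior of
  such a facet consists of points of \<open>W\<close> near which \<open>P\<close> coincides with \<open>Q\<close>; a nonconvex \<open>P\<close> may have
  several facets in the same \<open>W\<close>, on either side.\<close>

definition facets_on :: "'a::euclidean_space set \<Rightarrow> 'a set \<Rightarrow> 'a set \<Rightarrow> 'a set set" where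
  "facets_on P W Q =
     closure ` components {x \<in> W. \<exists>e>0. P \<inter> ball x e = Q \<inter> ball x e}"

text \<open>The lower-dimensional faces of a polytope are its iterated facets, so a chain
  \<open>F\<^sub>r \<subset> \<dots> \<subset> F\<^sub>d = A\<close> consists of facets \<open>F\<^sub>j\<close> of \<open>F\<^sub>j\<^sub>+\<^sub>1\<close>.\<close>

definition face_chains :: "nat \<Rightarrow> 'a::euclidean_space flag \<Rightarrow> 'a set \<Rightarrow> (nat \<Rightarrow> 'a set) set" where
  "face_chains r \<Phi> A =
     {F \<in> extensional {r..DIM('a)}. F DIM('a) = A \<and>
        (\<forall>j\<in>{r..<DIM('a)}.
           F j \<in> facets_on (F (Suc j)) (flat \<Phi> j) (pos \<Phi> j) \<union>
                 facets_on (F (Suc j)) (flat \<Phi> j) (neg \<Phi> j))}"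

definition side_sign :: "'a::euclidean_space flag \<Rightarrow> (nat \<Rightarrow> 'a set) \<Rightarrow> nat \<Rightarrow> real" where
  "side_sign \<Phi> F j =
     (if F j \<in> facets_on (F (Suc j)) (flat \<Phi> j) (pos \<Phi> j) then 1 else - 1)"

text \<open>The \<open>r\<close>-dimensional volume of a subset of an \<open>r\<close>-dimensional affine subspace: the Lebesgue
  measure of its coordinate image with respect to an origin \<open>p\<close> and an orthonormal frame \<open>b\<close> of that
  subspace. By isometry invariance it does not depend on the choice. For \<open>r = 0\<close> the product measure
  is the unit mass on a one-point space, so a point has volume \<open>1\<close>.\<close>

definition frame_coords ::
  "nat \<Rightarrow> 'a::euclidean_space \<Rightarrow> (nat \<Rightarrow> 'a) \<Rightarrow> (nat \<Rightarrow> real) \<Rightarrow> 'a" where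
  "frame_coords r p b x = p + (\<Sum>i<r. x i *\<^sub>R b i)"

definition is_frame ::
  "nat \<Rightarrow> 'a::euclidean_space set \<Rightarrow> 'a \<Rightarrow> (nat \<Rightarrow> 'a) \<Rightarrow> bool" where
  "is_frame r V p b \<longleftrightarrow>
     (\<forall>i<r. \<forall>j<r. b i \<bullet> b j = (if i = j then 1 else 0)) \<and> V = range (frame_coords r p b)"

definition flat_volume :: "nat \<Rightarrow> 'a::euclidean_space set \<Rightarrow> 'a set \<Rightarrow> real" where
  "flat_volume r V F =
     (case (SOME (p, b). is_frame r V p b) of (p, b) \<Rightarrow>
        measure (Pi\<^sub>M {..<r} (\<lambda>_. lborel)) {x \<in> {..<r} \<rightarrow>\<^sub>E UNIV. frame_coords r p b x \<in> F})"

definition flag_weight :: "nat \<Rightarrow> 'a::euclidean_space flag \<Rightarrow> 'a set \<Rightarrow> real" where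
  "flag_weight r \<Phi> A =
     (\<Sum>F \<in> face_chains r \<Phi> A.
        (\<Prod>j\<in>{r..<DIM('a)}. side_sign \<Phi> F j) * flat_volume r (flat \<Phi> r) (F r))"

text \<open>Only finitely many translates \<open>\<Psi>\<close> contribute a nonzero term, since a polytope has finitely
  many faces.\<close>

definition hadwiger :: "nat \<Rightarrow> 'a::euclidean_space flag \<Rightarrow> 'a set \<Rightarrow> 'a set \<Rightarrow> real" where
  "hadwiger r \<Phi> A L = (\<Sum>\<^sub>\<infinity>\<Psi> \<in> (\<lambda>l. translate_flag r l \<Phi>) ` L. flag_weight r \<Psi> A)"

end

theory Submission
  imports Defs
begin

text \<open>
  Let \<open>g = 1\<^sub>A - 1\<^sub>B\<close> and let \<open>F\<close> be its periodization, the locally finite sum of the translates of \<open>g\<close> by \<open>L\<close>.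
  If \<open>F = 0\<close> off finitely many hyperplanes in each ball, then \<open>A\<close> and \<open>B\<close> are equidecomposable by a greedy exchange
  of pieces.

  The weight of a flag \<open>V\<^sub>r \<subset> \<dots> \<subset> V\<^sub>d\<close> is, up to a constant, the integral over \<open>V\<^sub>r\<close> of the function obtained from
  \<open>1\<^sub>A\<close> by taking successively the jumps across \<open>V\<^sub>d\<^sub>-\<^sub>1, \<dots>, V\<^sub>r\<close>: the jump of the indicator of a face is the signed
  sum of the indicators of its facets. This makes the Hadwiger functionals additive and invariant. The iterated jump of
  \<open>F\<close> along the flag is the periodization of the iterated jump of \<open>g\<close>. By induction on \<open>r\<close> it vanishes on \<open>V\<^sub>r\<close>: it has
  no jumps across hyperplanes of \<open>V\<^sub>r\<close>, hence is a constant \<open>c\<close>, and \<open>c = 0\<close> because the Hadwiger functional of \<open>g\<close>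
  is zero or, if the stabilizer of \<open>V\<^sub>r\<close> in \<open>L\<close> has too small a rank, because the function vanishes somewhere. For
  \<open>r = d\<close> this says \<open>F = 0\<close>, the last Hadwiger functional being the volume.
\<close>

section \<open>Piecewise constant functions and jumps\<close>

text \<open>Why \<open>F = 0\<close> suffices: almost every orbit of \<open>L\<close> then meets
  \<open>A\<close> and \<open>B\<close> equally often, so while a piece of \<open>A\<close> is left,
  some lattice vector takes part of it into what is left of \<open>B\<close>. Only vectors no longer
  than the diameter of a ball around both sets can do this, so finitely many exchanges are enough.

  The obstacle is that jumps live on null sets. Facets are closed and overlap in lower faces, pieces
  overlap in their boundaries, so identities between indicators hold only off hyperplanes and must
  still be restricted to hyperplanes again and again. One-sided limits instead of values, and
  equality off hyperplanes, survive this.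

  One finite set \<open>H\<close> of hyperplanes serves a polytope, all its faces and all its
  iterated jumps. A nonzero iterated jump therefore sits on an intersection of members of
  \<open>H\<close>, which makes the Hadwiger sums finite.

  A hyperplane across which the iterated jump of \<open>F\<close> might jump is arbitrary, so the
  induction treats all flags at once: any hyperplane of the lowest flat prolongs the flag by one
  step.\<close>

text \<open>A pair \<open>h = (a, b)\<close> stands for the hyperplane \<open>a \<bullet> x = b\<close>; the degenerate case \<open>a = 0\<close> is allowed.
  A finite set \<open>H\<close> of pairs cuts the space into cells, the classes of points with equal signs.\<close>

definition hplane :: "'a::euclidean_space \<times> real \<Rightarrow> 'a set" where
  "hplane h = {x. fst h \<bullet> x = snd h}"

definition side :: "'a::euclidean_space \<times> real \<Rightarrow> 'a \<Rightarrow> real" where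
  "side h x = sgn (fst h \<bullet> x - snd h)"

definition same_cell :: "('a::euclidean_space \<times> real) set \<Rightarrow> 'a \<Rightarrow> 'a \<Rightarrow> bool" where
  "same_cell H x y \<longleftrightarrow> (\<forall>h\<in>H. side h x = side h y)"

definition pw_const :: "'a::euclidean_space set \<Rightarrow> ('a \<times> real) set \<Rightarrow> ('a \<Rightarrow> 'b) \<Rightarrow> bool" where
  "pw_const K H f \<longleftrightarrow> (\<forall>x\<in>K. \<forall>y\<in>K. same_cell H x y \<longrightarrow> f x = f y)"

text \<open>A periodization involves infinitely many hyperplanes, but finitely many near each ball;
  hence a separate \<open>H\<close> for every radius.\<close>

definition lpw_const :: "'a::euclidean_space set \<Rightarrow> ('a \<Rightarrow> 'b) \<Rightarrow> bool" where
  "lpw_const V f \<longleftrightarrow> (\<forall>R. \<exists>H. finite H \<and> pw_const (V \<inter> ball 0 R) H f)"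

text \<open>The direction subspace of an affine \<open>V\<close>, phrased without a base point so
  that all translates of \<open>V\<close> literally share it.\<close>

definition dirs :: "'a::euclidean_space set \<Rightarrow> 'a set" where
  "dirs V = {v. \<forall>x\<in>V. x + v \<in> V}"

text \<open>Members of \<open>H\<close> that contain all of \<open>V\<close> are tolerated: the
  flats of a flag usually lie in some hyperplanes of \<open>H\<close>, and these do not subdivide
  \<open>V\<close>.\<close>

definition generic :: "'a::euclidean_space set \<Rightarrow> ('a \<times> real) set \<Rightarrow> 'a \<Rightarrow> bool" where
  "generic V H x \<longleftrightarrow> (\<forall>h\<in>H. x \<in> hplane h \<longrightarrow> V \<subseteq> hplane h)"

text \<open>The normal \<open>n\<close> is tangent to \<open>V\<close>, so that rays from
  \<open>W\<close> in the directions \<open>n\<close> and \<open>- n\<close> stay in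
  \<open>V\<close>, where the functions under study are controlled.\<close>

definition hplane_in :: "'a::euclidean_space set \<Rightarrow> 'a set \<Rightarrow> 'a \<Rightarrow> bool" where
  "hplane_in V W n \<longleftrightarrow> affine V \<and> W \<noteq> {} \<and> n \<in> dirs V \<and> n \<noteq> 0 \<and> (\<exists>\<beta>. W = {x\<in>V. n \<bullet> x = \<beta>})"

text \<open>Arbitrary if \<open>f\<close> is not eventually constant along the ray.\<close>

definition ray_limit :: "'a::euclidean_space \<Rightarrow> ('a \<Rightarrow> real) \<Rightarrow> 'a \<Rightarrow> real" where
  "ray_limit n f x = (SOME c. \<forall>\<^sub>F t in at_right 0. f (x + t *\<^sub>R n) = c)"

definition jump :: "'a::euclidean_space \<Rightarrow> ('a \<Rightarrow> real) \<Rightarrow> 'a \<Rightarrow> real" where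
  "jump n f x = ray_limit n f x - ray_limit (- n) f x"

text \<open>Equality off a locally finite union of hyperplanes. Unlike equality almost everywhere
  this notion is inherited by the jumps across any hyperplane of \<open>V\<close>, including those in the exceptional set.\<close>

definition ae_on :: "'a::euclidean_space set \<Rightarrow> ('a \<Rightarrow> real) \<Rightarrow> ('a \<Rightarrow> real) \<Rightarrow> bool" where
  "ae_on V f g \<longleftrightarrow> (\<forall>R. \<exists>H. finite H \<and> (\<forall>h\<in>H. \<not> V \<subseteq> hplane h) \<and>
     (\<forall>x\<in>V. norm x < R \<longrightarrow> (\<forall>h\<in>H. x \<notin> hplane h) \<longrightarrow> f x = g x))"

section \<open>Cells, directions and one-sided limits\<close>

lemma same_cell_refl [simp]: "same_cell H x x"
  by (simp add: same_cell_def)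

lemma same_cell_sym: "same_cell H x y \<Longrightarrow> same_cell H y x"
  by (simp add: same_cell_def)

lemma same_cell_trans: "same_cell H x y \<Longrightarrow> same_cell H y z \<Longrightarrow> same_cell H x z"
  by (simp add: same_cell_def)

lemma same_cell_mono: "same_cell H x y \<Longrightarrow> H' \<subseteq> H \<Longrightarrow> same_cell H' x y"
  by (auto simp: same_cell_def)

lemma side_eq_0: "side h x = 0 \<longleftrightarrow> x \<in> hplane h"
  by (simp add: side_def hplane_def sgn_0_0)

lemma same_cell_hplane: "same_cell H x y \<Longrightarrow> h \<in> H \<Longrightarrow> x \<in> hplane h \<longleftrightarrow> y \<in> hplane h"
  by (simp add: same_cell_def flip: side_eq_0)

lemma pw_const_mono: "pw_const K H f \<Longrightarrow> H \<subseteq> H' \<Longrightarrow> K' \<subseteq> K \<Longrightarrow> pw_const K' H' f"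
  unfolding pw_const_def using same_cell_mono by blast

lemma pcD: "pw_const K H f \<Longrightarrow> x \<in> K \<Longrightarrow> y \<in> K \<Longrightarrow> same_cell H x y \<Longrightarrow> f x = f y"
  unfolding pw_const_def by blast

lemma dirnD: "v \<in> dirs V \<Longrightarrow> x \<in> V \<Longrightarrow> x + v \<in> V"
  by (simp add: dirs_def)

lemma dirs_diff: "affine V \<Longrightarrow> x \<in> V \<Longrightarrow> y \<in> V \<Longrightarrow> x - y \<in> dirs V"
  using mem_affine_3_minus[of V _ x y 1] by (auto simp: dirs_def algebra_simps)

lemma dirs_eq:
  assumes "affine V" "p \<in> V" shows "dirs V = (\<lambda>x. x - p) ` V"
proof
  show "dirs V \<subseteq> (\<lambda>x. x - p) ` V"
    using assms(2) by (force simp: dirs_def image_iff intro!: bexI[of _ "p + _"])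
qed (use assms dirs_diff in auto)

lemma subspace_dirs: "affine V \<Longrightarrow> V \<noteq> {} \<Longrightarrow> subspace (dirs V)"
  by (metis affine_diffs_subspace_subtract dirs_eq ex_in_conv)

lemma dirs_UNIV [simp]: "dirs UNIV = UNIV"
  by (simp add: dirs_def)

lemma dirs_translate [simp]: "dirs ((+) l ` V) = dirs V"
  by (force simp: dirs_def image_iff add.assoc)

lemma dirs_scale: "affine V \<Longrightarrow> V \<noteq> {} \<Longrightarrow> v \<in> dirs V \<Longrightarrow> t *\<^sub>R v \<in> dirs V"
  by (simp add: subspace_dirs subspace_scale)

lemma dirs_neg: "affine V \<Longrightarrow> V \<noteq> {} \<Longrightarrow> v \<in> dirs V \<Longrightarrow> - v \<in> dirs V"
  by (simp add: subspace_dirs subspace_neg)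

lemma eventually_same_side:
  assumes "x \<notin> hplane h"
  shows "\<forall>\<^sub>F \<delta> in nhds 0. side h (x + \<delta>) = side h x"
proof -
  have *: "((\<lambda>\<delta>. fst h \<bullet> (x + \<delta>) - snd h) \<longlongrightarrow> fst h \<bullet> (x + 0) - snd h) (nhds 0)"
    by (intro tendsto_intros filterlim_ident)
  consider "fst h \<bullet> x - snd h > 0" | "fst h \<bullet> x - snd h < 0" using assms by (force simp: hplane_def)
  then show ?thesis
  proof cases
    case 1
    then have "\<forall>\<^sub>F \<delta> in nhds 0. fst h \<bullet> (x + \<delta>) - snd h > 0" using order_tendstoD(1)[OF *, of 0] by simp
    then show ?thesis using 1 by (auto simp: side_def elim: eventually_mono)
  next
    case 2
    then have "\<forall>\<^sub>F \<delta> in nhds 0. fst h \<bullet> (x + \<delta>) - snd h < 0" using order_tendstoD(2)[OF *, of 0] by simp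
    then show ?thesis using 2 by (auto simp: side_def elim: eventually_mono)
  qed
qed

text \<open>The homogeneity behind everything local. A hyperplane through \<open>x\<close> also
  passes through \<open>y\<close>, and then both new signs are the sign of its normal against
  \<open>\<delta>\<close>; all other signs stay unchanged for small \<open>\<delta>\<close>.\<close>

lemma eventually_same_cell:
  assumes "finite H" "same_cell H x y"
  shows "\<forall>\<^sub>F \<delta> in nhds 0. same_cell H (x + \<delta>) (y + \<delta>)"
proof -
  have "\<forall>\<^sub>F \<delta> in nhds 0. side h (x + \<delta>) = side h (y + \<delta>)" if "h \<in> H" for h
  proof (cases "x \<in> hplane h")
    case True
    then have "y \<in> hplane h" using same_cell_hplane[OF assms(2) that] by simp
    then show ?thesis using True by (simp add: side_def hplane_def inner_add_right)
  next
    case False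
    then have "y \<notin> hplane h" using same_cell_hplane[OF assms(2) that] by simp
    from eventually_same_side[OF False] eventually_same_side[OF this] show ?thesis
      by eventually_elim (use assms(2) that in \<open>auto simp: same_cell_def\<close>)
  qed
  then show ?thesis
    unfolding same_cell_def using assms(1) by (simp add: eventually_ball_finite)
qed

lemma eventually_at_right_scale:
  assumes "\<forall>\<^sub>F \<delta> in nhds 0. P \<delta>"
  shows "\<forall>\<^sub>F t in at_right 0. P (t *\<^sub>R (n::'a::real_normed_vector))"
proof -
  have "((\<lambda>t. t *\<^sub>R n) \<longlongrightarrow> 0 *\<^sub>R n) (at_right 0)"
    by (intro tendsto_intros)
  then show ?thesis using assms unfolding filterlim_iff by simp
qed

lemma eventually_not_hplane:
  assumes "x \<notin> hplane h"
  shows "\<forall>\<^sub>F \<delta> in nhds 0. x + \<delta> \<notin> hplane h"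
  using eventually_same_side[OF assms] by eventually_elim (use assms in \<open>auto simp flip: side_eq_0\<close>)

text \<open>Signs freeze along a short ray, so one-sided limits of piecewise constant functions are
  attained values.\<close>

lemma eventually_ray:
  assumes "finite H"
  shows "\<exists>e>0. \<forall>s t. 0 < s \<and> s < e \<and> 0 < t \<and> t < e \<longrightarrow> same_cell H (x + s *\<^sub>R n) (x + t *\<^sub>R n)"
proof -
  have "\<exists>e>0. \<forall>t. 0 < t \<and> t < e \<longrightarrow> side h (x + t *\<^sub>R n) = (if x \<in> hplane h then sgn (fst h \<bullet> n) else side h x)" for h
  proof (cases "x \<in> hplane h")
    case True
    then have "side h (x + t *\<^sub>R n) = sgn (fst h \<bullet> n)" if "t > 0" for t
      using that by (simp add: side_def hplane_def inner_add_right sgn_mult)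
    then show ?thesis using True by (auto intro: exI[of _ 1])
  next
    case False
    from eventually_at_right_scale[OF eventually_same_side[OF this], of n] False
    show ?thesis unfolding eventually_at_right_field by auto
  qed
  then obtain e where e: "\<And>h. e h > 0" "\<And>h t. 0 < t \<Longrightarrow> t < e h \<Longrightarrow> side h (x + t *\<^sub>R n) = (if x \<in> hplane h then sgn (fst h \<bullet> n) else side h x)"
    by metis
  define d where "d = Min (insert 1 (e ` H))"
  have "d > 0" and d: "\<And>h. h \<in> H \<Longrightarrow> d \<le> e h"
    unfolding d_def using assms e(1) by (auto simp: Min_gr_iff)
  show ?thesis
    by (intro exI[of _ d]) (use \<open>d > 0\<close> d e(2) in \<open>auto simp: same_cell_def dest!: d\<close>)
qed

lemma ray_limit_eqI: "\<forall>\<^sub>F t in at_right 0. f (x + t *\<^sub>R n) = c \<Longrightarrow> ray_limit n f x = c"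
proof -
  assume a: "\<forall>\<^sub>F t in at_right 0. f (x + t *\<^sub>R n) = c"
  then have "\<forall>\<^sub>F t in at_right 0. f (x + t *\<^sub>R n) = ray_limit n f x"
    unfolding ray_limit_def by (rule someI)
  with a have "\<forall>\<^sub>F t in at_right (0::real). ray_limit n f x = c"
    by eventually_elim simp
  then show ?thesis by simp
qed

lemma ray_limit_cong:
  assumes "\<forall>\<^sub>F t in at_right 0. f (x + t *\<^sub>R n) = g (y + t *\<^sub>R n)"
  shows "ray_limit n f x = ray_limit n g y"
proof -
  have "(\<forall>\<^sub>F t in at_right 0. f (x + t *\<^sub>R n) = c) \<longleftrightarrow> (\<forall>\<^sub>F t in at_right 0. g (y + t *\<^sub>R n) = c)" for c
    using assms by (auto elim: eventually_elim2)
  then show ?thesis by (simp add: ray_limit_def)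
qed

lemma pw_const_imp_lpw_const: "finite H \<Longrightarrow> pw_const V H f \<Longrightarrow> lpw_const V f"
  unfolding lpw_const_def by (auto intro!: exI[of _ H] intro: pw_const_mono)

lemma eventually_norm_less:
  fixes x :: "'a::real_normed_vector"
  assumes "norm x < R" shows "\<forall>\<^sub>F \<delta> in nhds 0. norm (x + \<delta>) < R"
proof -
  have "((\<lambda>\<delta>. norm (x + \<delta>)) \<longlongrightarrow> norm (x + 0)) (nhds 0)"
    by (intro tendsto_intros filterlim_ident)
  from order_tendstoD(2)[OF this, of R] assms show ?thesis by simp
qed

lemma dirs_line: "affine V \<Longrightarrow> x \<in> V \<Longrightarrow> n \<in> dirs V \<Longrightarrow> x + t *\<^sub>R n \<in> V"
  using dirnD dirs_scale by blast

lemma ray_limit_ex_ball: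
  assumes "finite H" "pw_const (V \<inter> ball 0 R) H f" "affine V" "x \<in> V" "norm x < R" "n \<in> dirs V"
  shows "\<forall>\<^sub>F t in at_right 0. f (x + t *\<^sub>R n) = ray_limit n f x"
proof -
  obtain e where e: "e > 0" "\<forall>s t. 0 < s \<and> s < e \<and> 0 < t \<and> t < e \<longrightarrow> same_cell H (x + s *\<^sub>R n) (x + t *\<^sub>R n)"
    using eventually_ray[OF assms(1)] by blast
  have "\<forall>\<^sub>F t in at_right 0. norm (x + t *\<^sub>R n) < R"
    by (rule eventually_at_right_scale[OF eventually_norm_less[OF assms(5)]])
  then obtain e' where e': "e' > 0" "\<And>t. 0 < t \<Longrightarrow> t < e' \<Longrightarrow> norm (x + t *\<^sub>R n) < R"
    unfolding eventually_at_right_field by auto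
  define d where "d = min e e' / 2"
  have d: "d > 0" "d < e" "d < e'" using e(1) e'(1) by (auto simp: d_def)
  have "f (x + t *\<^sub>R n) = f (x + d *\<^sub>R n)" if "0 < t" "t < d" for t
    by (rule pcD[OF assms(2)]) (use that d e(2) e'(2) dirs_line[OF assms(3,4,6)] in auto)
  then have "\<forall>\<^sub>F t in at_right 0. f (x + t *\<^sub>R n) = f (x + d *\<^sub>R n)"
    unfolding eventually_at_right_field using d(1) by blast
  with ray_limit_eqI[OF this] show ?thesis by simp
qed

lemma ray_limit_ex:
  assumes "lpw_const V f" "affine V" "x \<in> V" "n \<in> dirs V"
  shows "\<forall>\<^sub>F t in at_right 0. f (x + t *\<^sub>R n) = ray_limit n f x"
proof -
  obtain H where H: "finite H" "pw_const (V \<inter> ball 0 (norm x + 1)) H f" using assms by (auto simp: lpw_const_def)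
  show ?thesis by (rule ray_limit_ex_ball[OF H assms(2,3) _ assms(4)]) simp
qed

text \<open>By \<open>eventually_same_cell\<close> the rays from two points of one cell pass through
  common cells. Thus taking a one-sided limit creates no new hyperplanes.\<close>

lemma pw_const_ray_limit_ball:
  assumes "finite H" "pw_const (V \<inter> ball 0 R) H f" "affine V" "n \<in> dirs V"
  shows "pw_const (V \<inter> ball 0 R) H (ray_limit n f)"
  unfolding pw_const_def
proof (intro ballI impI)
  fix x y assume xy: "x \<in> V \<inter> ball 0 R" "y \<in> V \<inter> ball 0 R" "same_cell H x y"
  have V: "z + s *\<^sub>R n \<in> V" if "z \<in> V" for s z
      using assms dirnD dirs_scale that by blast
  show "ray_limit n f x = ray_limit n f y"
  proof (rule ray_limit_cong)
    show "\<forall>\<^sub>F t in at_right 0. f (x + t *\<^sub>R n) = f (y + t *\<^sub>R n)"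
    proof -
      have "norm x < R" "norm y < R" using xy by auto
      with eventually_at_right_scale[OF eventually_same_cell[OF assms(1) xy(3)], of n]
        eventually_at_right_scale[OF eventually_norm_less[of x R], of n]
        eventually_at_right_scale[OF eventually_norm_less[of y R], of n]
      have "\<forall>\<^sub>F t in at_right 0. same_cell H (x + t *\<^sub>R n) (y + t *\<^sub>R n) \<and> norm (x + t *\<^sub>R n) < R \<and> norm (y + t *\<^sub>R n) < R"
        by (simp add: eventually_conj)
      then show ?thesis
        by eventually_elim (rule pcD[OF assms(2)], use V xy in auto)
    qed
  qed
qed

lemma pw_const_ray_limit:
  assumes "finite H" "pw_const V H f" "affine V" "n \<in> dirs V"
  shows "pw_const V H (ray_limit n f)"
  unfolding pw_const_def
proof (intro ballI impI)
  fix x y assume xy: "x \<in> V" "y \<in> V" "same_cell H x y"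
  define R where "R = max (norm x) (norm y) + 1"
  have "pw_const (V \<inter> ball 0 R) H (ray_limit n f)"
    using assms by (intro pw_const_ray_limit_ball) (auto intro: pw_const_mono)
  then show "ray_limit n f x = ray_limit n f y"
    by (rule pcD) (use xy in \<open>auto simp: R_def\<close>)
qed

lemma pw_const_diff: "pw_const K H f \<Longrightarrow> pw_const K H g \<Longrightarrow> pw_const K H (\<lambda>x. f x - (g x :: real))"
  unfolding pw_const_def by metis

lemma pw_const_jump:
  assumes "finite H" "pw_const V H f" "affine V" "n \<in> dirs V"
  shows "pw_const V H (jump n f)"
proof (cases "V = {}")
  case False
  then show ?thesis unfolding jump_def[abs_def] using assms
    by (intro pw_const_diff pw_const_ray_limit dirs_neg) auto
qed (auto simp: pw_const_def)

lemma lpw_const_jump: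
  assumes "lpw_const V f" "affine V" "n \<in> dirs V"
  shows "lpw_const V (jump n f)"
proof (cases "V = {}")
  case True then show ?thesis by (auto simp: pw_const_def lpw_const_def)
next
  case False
  then have "- n \<in> dirs V" using assms dirs_neg by blast
  with assms show ?thesis unfolding lpw_const_def jump_def[abs_def]
    by (metis pw_const_ray_limit_ball pw_const_diff)
qed

lemma lpw_const_mono: "lpw_const V f \<Longrightarrow> W \<subseteq> V \<Longrightarrow> lpw_const W f"
  unfolding lpw_const_def by (meson Int_mono order_refl pw_const_mono)

lemma ray_limit_lin:
  assumes "affine V" "x \<in> V" "n \<in> dirs V" "lpw_const V f" "lpw_const V g"
  shows "ray_limit n (\<lambda>x. f x + g x) x = ray_limit n f x + ray_limit n g x"
    and "ray_limit n (\<lambda>x. c * f x) x = c * ray_limit n f x"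
proof -
  have f: "\<forall>\<^sub>F t in at_right 0. f (x + t *\<^sub>R n) = ray_limit n f x"
   and g: "\<forall>\<^sub>F t in at_right 0. g (x + t *\<^sub>R n) = ray_limit n g x"
    using assms by (auto intro!: ray_limit_ex)
  show "ray_limit n (\<lambda>x. f x + g x) x = ray_limit n f x + ray_limit n g x"
    by (rule ray_limit_eqI) (use f g in eventually_elim, simp)
  show "ray_limit n (\<lambda>x. c * f x) x = c * ray_limit n f x"
    by (rule ray_limit_eqI) (use f in eventually_elim, simp)
qed

lemma jump_lin:
  assumes "affine V" "x \<in> V" "n \<in> dirs V" "lpw_const V f" "lpw_const V g"
  shows "jump n (\<lambda>x. f x + g x) x = jump n f x + jump n g x"
    and "jump n (\<lambda>x. c * f x) x = c * jump n f x"
proof -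
  have "- n \<in> dirs V" using assms dirs_neg by blast
  with assms show "jump n (\<lambda>x. f x + g x) x = jump n f x + jump n g x"
    and "jump n (\<lambda>x. c * f x) x = c * jump n f x"
    by (simp_all add: jump_def ray_limit_lin algebra_simps)
qed

section \<open>Equality off hyperplanes\<close>

lemma ae_on_eq: "(\<And>x. x \<in> V \<Longrightarrow> f x = g x) \<Longrightarrow> ae_on V f g"
  by (auto simp: ae_on_def intro: exI[of _ "{}"])

lemma ae_on_sym: "ae_on V f g \<Longrightarrow> ae_on V g f"
  unfolding ae_on_def by metis

lemma ae_on_combine:
  assumes "ae_on V f f'" "ae_on V g g'"
    and "\<And>x. x \<in> V \<Longrightarrow> f x = f' x \<Longrightarrow> g x = g' x \<Longrightarrow> k x = k' x"
  shows "ae_on V k k'"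
  unfolding ae_on_def
proof
  fix R
  obtain H where H: "finite H" "\<forall>h\<in>H. \<not> V \<subseteq> hplane h" "\<forall>x\<in>V. norm x < R \<longrightarrow> (\<forall>h\<in>H. x \<notin> hplane h) \<longrightarrow> f x = f' x"
    using assms(1) unfolding ae_on_def by metis
  obtain G where G: "finite G" "\<forall>h\<in>G. \<not> V \<subseteq> hplane h" "\<forall>x\<in>V. norm x < R \<longrightarrow> (\<forall>h\<in>G. x \<notin> hplane h) \<longrightarrow> g x = g' x"
    using assms(2) unfolding ae_on_def by metis
  show "\<exists>H. finite H \<and> (\<forall>h\<in>H. \<not> V \<subseteq> hplane h) \<and> (\<forall>x\<in>V. norm x < R \<longrightarrow> (\<forall>h\<in>H. x \<notin> hplane h) \<longrightarrow> k x = k' x)"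
    by (rule exI[of _ "H \<union> G"]) (use H G assms(3) in auto)
qed

lemma ae_on_trans: "ae_on V f g \<Longrightarrow> ae_on V g k \<Longrightarrow> ae_on V f k"
  by (erule ae_on_combine) auto

lemma ae_on_sum:
  assumes "finite I" "\<And>i. i \<in> I \<Longrightarrow> ae_on V (f i) (g i)"
  shows "ae_on V (\<lambda>x. \<Sum>i\<in>I. f i x) (\<lambda>x. \<Sum>i\<in>I. g i x)"
  using assms
proof (induction I)
  case (insert i I)
  have "ae_on V (f i) (g i)" "ae_on V (\<lambda>x. \<Sum>i\<in>I. f i x) (\<lambda>x. \<Sum>i\<in>I. g i x)"
    using insert by auto
  then show ?case by (rule ae_on_combine) (use insert in auto)
qed (auto intro: ae_on_eq)

lemma ae_on_generic:
  assumes "finite H" "\<And>x. x \<in> V \<Longrightarrow> generic V H x \<Longrightarrow> f x = g x"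
  shows "ae_on V f g"
  unfolding ae_on_def
proof (intro allI exI[of _ "{h\<in>H. \<not> V \<subseteq> hplane h}"] conjI ballI impI)
  fix x assume "x \<in> V" "\<forall>h\<in>{h\<in>H. \<not> V \<subseteq> hplane h}. x \<notin> hplane h"
  then show "f x = g x" by (intro assms(2)) (auto simp: generic_def)
qed (use assms(1) in auto)

text \<open>On \<open>V\<close> the affine functional of \<open>h\<close> vanishes on a level set of
  \<open>n\<close>, so it is a multiple of the functional of \<open>n\<close>; the factor is found
  by moving along \<open>n\<close>.\<close>

lemma hplane_in_functional:
  assumes "hplane_in V W n" "x \<in> W" "W \<subseteq> hplane h" "v \<in> V"
  shows "fst h \<bullet> v - snd h = (fst h \<bullet> n) / (n \<bullet> n) * (n \<bullet> (v - x))"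
proof -
  obtain \<beta> where W: "W = {x\<in>V. n \<bullet> x = \<beta>}" "n \<noteq> 0" "n \<in> dirs V" "affine V" using assms by (auto simp: hplane_in_def)
  \<comment> \<open>The amount for which \<open>v - s n\<close> lands on \<open>W\<close>.\<close>
  define s where "s = (n \<bullet> v - \<beta>) / (n \<bullet> n)"
  have "v + (- s) *\<^sub>R n \<in> V" using W assms dirnD dirs_scale by blast
  moreover have "n \<bullet> (v + (- s) *\<^sub>R n) = \<beta>" using W(2) by (simp add: s_def inner_diff_right)
  ultimately have "v + (- s) *\<^sub>R n \<in> hplane h" using W(1) assms(3) by blast
  then have "fst h \<bullet> v - snd h = s * (fst h \<bullet> n)" by (simp add: hplane_def inner_diff_right)
  also have "\<dots> = (fst h \<bullet> n) / (n \<bullet> n) * (n \<bullet> (v - x))" using assms(2) W by (auto simp: s_def inner_diff_right)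
  finally show ?thesis .
qed

lemma hplane_in_side:
  assumes "hplane_in V W n" "x \<in> W" "W \<subseteq> hplane h" "v \<in> V"
  shows "side h v = sgn ((fst h \<bullet> n) / (n \<bullet> n)) * sgn (n \<bullet> (v - x))"
  unfolding side_def hplane_in_functional[OF assms] by (rule sgn_mult)

lemma hplane_in_transversal:
  assumes "hplane_in V W n" "W \<subseteq> hplane h" "\<not> V \<subseteq> hplane h"
  shows "fst h \<bullet> n \<noteq> 0"
proof
  assume 0: "fst h \<bullet> n = 0"
  obtain x where "x \<in> W" using assms(1) by (auto simp: hplane_in_def)
  then have "v \<in> hplane h" if "v \<in> V" for v using hplane_in_functional[OF assms(1) _ assms(2) that] 0 by (simp add: hplane_def)
  then show False using assms(3) by blast
qed

lemma hplane_in_subset: "hplane_in V W n \<Longrightarrow> W \<subseteq> V"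
  by (auto simp: hplane_in_def)

lemma hplane_in_neg:
  assumes "hplane_in V W n" shows "hplane_in V W (- n)"
proof -
  obtain \<beta> where W: "W = {x\<in>V. n \<bullet> x = \<beta>}" using assms by (auto simp: hplane_in_def)
  then have "W = {x\<in>V. (-n) \<bullet> x = - \<beta>}" by auto
  moreover have "- n \<in> dirs V" using assms W by (intro dirs_neg) (auto simp: hplane_in_def)
  ultimately show ?thesis using assms unfolding hplane_in_def by auto
qed

lemma hplane_in_affine: "hplane_in V W n \<Longrightarrow> affine W"
  by (force simp: hplane_in_def Collect_conj_eq intro: affine_Int affine_hyperplane)

text \<open>An exceptional hyperplane that contains \<open>W\<close> does not contain
  \<open>V\<close>, so it is transversal to \<open>n\<close> and the ray leaves it at once. One that
  does not contain \<open>W\<close> becomes an exceptional hyperplane for \<open>W\<close>.\<close>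

lemma ae_on_ray_limit:
  assumes "hplane_in V W n" "ae_on V f g"
  shows "ae_on W (ray_limit n f) (ray_limit n g)"
  unfolding ae_on_def
proof
  fix R
  obtain H where H: "finite H" "\<forall>h\<in>H. \<not> V \<subseteq> hplane h" "\<forall>x\<in>V. norm x < R \<longrightarrow> (\<forall>h\<in>H. x \<notin> hplane h) \<longrightarrow> f x = g x"
    using assms(2) unfolding ae_on_def by metis
  show "\<exists>H. finite H \<and> (\<forall>h\<in>H. \<not> W \<subseteq> hplane h) \<and> (\<forall>x\<in>W. norm x < R \<longrightarrow> (\<forall>h\<in>H. x \<notin> hplane h) \<longrightarrow> ray_limit n f x = ray_limit n g x)"
  proof (intro exI[of _ "{h\<in>H. \<not> W \<subseteq> hplane h}"] conjI ballI impI)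
    fix x assume x: "x \<in> W" "norm x < R" "\<forall>h\<in>{h\<in>H. \<not> W \<subseteq> hplane h}. x \<notin> hplane h"
    have ev: "\<forall>\<^sub>F t in at_right 0. x + t *\<^sub>R n \<notin> hplane h" if h: "h \<in> H" for h
    proof (cases "W \<subseteq> hplane h")
      case True
      then have "fst h \<bullet> n \<noteq> 0" using assms(1) H(2) h hplane_in_transversal by blast
      moreover have "x \<in> hplane h" using True x by auto
      ultimately show ?thesis using eventually_at_right_less[of "0::real"]
        by (auto simp: hplane_def inner_add_right elim!: eventually_mono)
    next
      case False
      then show ?thesis using x h eventually_at_right_scale[OF eventually_not_hplane] by blast
    qed
    have V: "x + s *\<^sub>R n \<in> V" for s
      using assms(1) x(1) hplane_in_subset[OF assms(1)] dirnD dirs_scale unfolding hplane_in_def by (metis (no_types, lifting) empty_iff subsetD)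
    have "\<forall>\<^sub>F t in at_right 0. \<forall>h\<in>H. x + t *\<^sub>R n \<notin> hplane h"
      using ev H(1) by (simp add: eventually_ball_finite)
    moreover have "\<forall>\<^sub>F t in at_right 0. norm (x + t *\<^sub>R n) < R"
      using eventually_at_right_scale[OF eventually_norm_less] x by blast
    ultimately have "\<forall>\<^sub>F t in at_right 0. f (x + t *\<^sub>R n) = g (x + t *\<^sub>R n)"
      by eventually_elim (use H(3) V in auto)
    then show "ray_limit n f x = ray_limit n g x" by (rule ray_limit_cong)
  qed (use H in auto)
qed

lemma ae_on_jump:
  assumes "hplane_in V W n" "ae_on V f g"
  shows "ae_on W (jump n f) (jump n g)"
  by (rule ae_on_combine[OF ae_on_ray_limit[OF assms] ae_on_ray_limit[OF hplane_in_neg[OF assms(1)] assms(2)]])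
    (simp add: jump_def)

lemma hplane_in_eq_Int:
  assumes "hplane_in V W n" "W \<subseteq> hplane h" "\<not> V \<subseteq> hplane h"
  shows "W = V \<inter> hplane h"
proof
  obtain \<beta> x where W: "W = {x\<in>V. n \<bullet> x = \<beta>}" "n \<noteq> 0" "x \<in> W" using assms(1) by (auto simp: hplane_in_def)
  show "V \<inter> hplane h \<subseteq> W"
  proof
    fix v assume v: "v \<in> V \<inter> hplane h"
    then have "n \<bullet> (v - x) = 0"
      using hplane_in_functional[OF assms(1) W(3) assms(2), of v] hplane_in_transversal[OF assms] W(2) by (auto simp: hplane_def)
    then show "v \<in> W" using W v by (simp add: inner_diff_right)
  qed
qed (use assms hplane_in_subset in blast)

section \<open>Facets\<close>

lemma eventually_generic:
  assumes "finite H" "generic V H x"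
  shows "\<forall>\<^sub>F \<delta> in nhds 0. generic V H (x + \<delta>)"
proof -
  have "\<forall>\<^sub>F \<delta> in nhds 0. x + \<delta> \<in> hplane h \<longrightarrow> V \<subseteq> hplane h" if "h \<in> H" for h
  proof (cases "V \<subseteq> hplane h")
    case False
    then have "x \<notin> hplane h" using assms(2) that unfolding generic_def by blast
    from eventually_not_hplane[OF this] show ?thesis by (rule eventually_mono) simp
  qed simp
  then show ?thesis
    unfolding generic_def using assms(1) by (intro eventually_ball_finite) auto
qed

text \<open>A point caught on a new hyperplane is pushed slightly towards a point of
  \<open>V\<close> off that hyperplane; genericity for the earlier hyperplanes is an open condition
  and survives.\<close>

lemma generic_dense:
  assumes "finite H" "affine V" "x \<in> V" "e > 0"
  shows "\<exists>y\<in>V. dist x y < e \<and> generic V H y"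
  using assms(1)
proof (induction H)
  case empty
  then show ?case using assms by (intro bexI[of _ x]) (auto simp: generic_def)
next
  case (insert h H)
  then obtain y where y: "y \<in> V" "dist x y < e" "generic V H y" by blast
  show ?case
  proof (cases "y \<in> hplane h \<longrightarrow> V \<subseteq> hplane h")
    case True
    then show ?thesis using y by (intro bexI[of _ y]) (auto simp: generic_def)
  next
    case False
    then obtain v where v: "v \<in> V" "v \<notin> hplane h" and yh: "y \<in> hplane h" by auto
    have "\<forall>\<^sub>F t in at_right 0. generic V H (y + t *\<^sub>R (v - y))"
      by (rule eventually_at_right_scale[OF eventually_generic[OF insert(1) y(3)]])
    moreover have "\<forall>\<^sub>F t in at_right 0. norm (y - x + t *\<^sub>R (v - y)) < e"
      by (rule eventually_at_right_scale[OF eventually_norm_less]) (use y in \<open>simp add: dist_norm norm_minus_commute\<close>)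
    ultimately have "\<forall>\<^sub>F t::real in at_right 0. t > 0 \<and> generic V H (y + t *\<^sub>R (v - y)) \<and> norm (y - x + t *\<^sub>R (v - y)) < e"
      using eventually_at_right_less[of "0::real"] by eventually_elim auto
    then obtain t :: real where t: "t > 0" "generic V H (y + t *\<^sub>R (v - y))" "norm (y - x + t *\<^sub>R (v - y)) < e"
      using eventually_happens[of _ "at_right (0::real)"] by auto
    have "y + t *\<^sub>R (v - y) \<in> V"
      using dirnD[OF dirs_scale[OF assms(2) _ dirs_diff[OF assms(2) v(1) y(1)]] y(1)] y(1) by blast
    moreover have "y + t *\<^sub>R (v - y) \<notin> hplane h" using yh v t(1)
      by (auto simp: hplane_def inner_add_right inner_diff_right)
    moreover have "dist x (y + t *\<^sub>R (v - y)) < e" using t(3) by (simp add: dist_norm norm_minus_commute algebra_simps)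
    ultimately show ?thesis using t(2) by (intro bexI[of _ "y + t *\<^sub>R (v - y)"]) (auto simp: generic_def)
  qed
qed

lemma nhds_0_ball:
  fixes x :: "'a::real_normed_vector"
  assumes "\<forall>\<^sub>F \<delta> in nhds 0. P (x + \<delta>)"
  shows "\<exists>e>0. \<forall>y\<in>ball x e. P y"
proof -
  obtain e where "e > 0" "\<And>\<delta>. dist \<delta> 0 < e \<Longrightarrow> P (x + \<delta>)"
    using assms unfolding eventually_nhds_metric by auto
  then show ?thesis
    by (intro exI[of _ e]) (auto simp: dist_norm norm_minus_commute dest: spec[of _ "_ - x"], metis add_diff_cancel_left' add.commute diff_add_cancel dist_norm dist_commute norm_minus_commute)
qed

lemma generic_local:
  assumes "finite H" "generic V H x" "x \<in> V"
  shows "\<exists>e>0. \<forall>y\<in>V \<inter> ball x e. same_cell H x y"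
proof -
  have "\<forall>\<^sub>F \<delta> in nhds 0. x + \<delta> \<in> V \<longrightarrow> side h x = side h (x + \<delta>)" if "h \<in> H" for h
  proof (cases "V \<subseteq> hplane h")
    case True
    then show ?thesis using assms(3) by (intro always_eventually) (metis side_eq_0 subsetD)
  next
    case False
    then have "x \<notin> hplane h" using assms(2) that unfolding generic_def by blast
    from eventually_same_side[OF this] show ?thesis by (rule eventually_mono) simp
  qed
  then have "\<forall>\<^sub>F \<delta> in nhds 0. \<forall>h\<in>H. x + \<delta> \<in> V \<longrightarrow> side h x = side h (x + \<delta>)"
    using assms(1) by (intro eventually_ball_finite) auto
  from nhds_0_ball[OF this] show ?thesis by (auto simp: same_cell_def)
qed

lemma ray_limit_generic_ball:
  assumes "finite H" "pw_const (V \<inter> ball 0 R) H f" "affine V" "x \<in> V" "norm x < R" "n \<in> dirs V" "generic V H x"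
  shows "ray_limit n f x = f x"
proof (rule ray_limit_eqI)
  obtain d where d: "d > 0" "\<forall>z\<in>V \<inter> ball x d. same_cell H x z" using generic_local[OF assms(1,7,4)] by blast
  have "\<forall>\<^sub>F t in at_right 0. norm (0 + t *\<^sub>R n) < d"
    by (rule eventually_at_right_scale[OF eventually_norm_less]) (use d in simp)
  moreover have "\<forall>\<^sub>F t in at_right 0. norm (x + t *\<^sub>R n) < R"
    by (rule eventually_at_right_scale[OF eventually_norm_less[OF assms(5)]])
  ultimately show "\<forall>\<^sub>F t in at_right 0. f (x + t *\<^sub>R n) = f x"
  proof eventually_elim
    case (elim t)
    have V: "x + t *\<^sub>R n \<in> V" by (rule dirs_line[OF assms(3,4,6)])
    moreover have "same_cell H x (x + t *\<^sub>R n)" using d(2) elim(1) V by (auto simp: dist_norm)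
    ultimately show ?case by (intro pcD[OF assms(2)]) (use elim assms(4,5) same_cell_sym in auto)
  qed
qed

lemma ray_limit_generic:
  assumes "finite H" "pw_const V H f" "affine V" "x \<in> V" "n \<in> dirs V" "generic V H x"
  shows "ray_limit n f x = f x"
  by (rule ray_limit_generic_ball[OF assms(1) pw_const_mono[OF assms(2)] assms(3,4) _ assms(5,6), where R = "norm x + 1"]) auto

text \<open>A generic point of \<open>W\<close> is then generic in \<open>V\<close>, where both
  one-sided limits equal the value. Read contrapositively: a jump across \<open>W\<close> forces
  some \<open>h\<close> in \<open>H\<close> to cut \<open>V\<close> along \<open>W\<close>.\<close>

lemma jump_ae_zero:
  assumes "hplane_in V W n" "finite H" "pw_const V H f" "\<And>h. h \<in> H \<Longrightarrow> \<not> V \<subseteq> hplane h \<Longrightarrow> \<not> W \<subseteq> hplane h"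
  shows "ae_on W (jump n f) (\<lambda>x. 0)"
proof (rule ae_on_generic[OF assms(2)])
  fix x assume x: "x \<in> W" "generic W H x"
  have "x \<in> V" "generic V H x" using x hplane_in_subset[OF assms(1)] assms(4) unfolding generic_def by blast+
  then have "ray_limit m f x = f x" if "hplane_in V W m" for m
    using that by (intro ray_limit_generic[OF assms(2,3)]) (auto simp: hplane_in_def)
  then show "jump n f x = 0" using assms(1) hplane_in_neg[OF assms(1)] by (simp add: jump_def)
qed

text \<open>Near a generic point of \<open>W\<close> only members of \<open>H\<close> that contain
  \<open>W\<close> can separate points of \<open>V\<close>, and their sides are functions of the
  side of \<open>W\<close>. Locally \<open>V\<close> consists of two open halves and
  \<open>W\<close>.\<close>

lemma generic_local_hplane_in:
  assumes "hplane_in V W n" "finite H" "generic W H x" "x \<in> W"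
  shows "\<exists>e>0. \<forall>y\<in>V \<inter> ball x e. \<forall>z\<in>V \<inter> ball x e. sgn (n \<bullet> (y - x)) = sgn (n \<bullet> (z - x)) \<longrightarrow> same_cell H y z"
proof -
  define H' where "H' = {h\<in>H. \<not> W \<subseteq> hplane h}"
  have "\<forall>\<^sub>F \<delta> in nhds 0. side h (x + \<delta>) = side h x" if "h \<in> H'" for h
    by (rule eventually_same_side) (use that assms in \<open>auto simp: H'_def generic_def\<close>)
  then have "\<forall>\<^sub>F \<delta> in nhds 0. \<forall>h\<in>H'. side h (x + \<delta>) = side h x"
    using assms(2) by (intro eventually_ball_finite) (auto simp: H'_def)
  from nhds_0_ball[OF this] obtain e where e: "e > 0" "\<And>y h. y \<in> ball x e \<Longrightarrow> h \<in> H' \<Longrightarrow> side h y = side h x" by blast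
  show ?thesis
  proof (intro exI[of _ e] conjI ballI impI e(1))
    fix y z assume yz: "y \<in> V \<inter> ball x e" "z \<in> V \<inter> ball x e" "sgn (n \<bullet> (y - x)) = sgn (n \<bullet> (z - x))"
    show "same_cell H y z" unfolding same_cell_def
    proof
      fix h assume "h \<in> H"
      show "side h y = side h z"
      proof (cases "W \<subseteq> hplane h")
        case True
        then show ?thesis using hplane_in_side[OF assms(1,4) True] yz by simp
      next
        case False
        then show ?thesis using e(2)[of y h] e(2)[of z h] yz \<open>h \<in> H\<close> by (auto simp: H'_def)
      qed
    qed
  qed
qed

text \<open>The shape shared by a polytope in the whole space and by its faces in the flats of a
  flag, all with the same \<open>H\<close>.\<close>

definition polyhedral :: "('a::euclidean_space \<times> real) set \<Rightarrow> 'a set \<Rightarrow> 'a set \<Rightarrow> bool" where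
  "polyhedral H V P \<longleftrightarrow> finite H \<and> P \<subseteq> V \<and> closed P \<and> bounded P \<and> pw_const V H (\<lambda>x. x \<in> P)"

lemma pw_const_compose: "pw_const V H f \<Longrightarrow> pw_const V H (\<lambda>x. g (f x))"
  unfolding pw_const_def by metis

lemma polyhedral_pw_const_indicator: "polyhedral H V P \<Longrightarrow> pw_const V H (indicat_real P)"
  unfolding polyhedral_def indicator_def by (rule pw_const_compose) auto

definition locus :: "'a::euclidean_space set \<Rightarrow> 'a set \<Rightarrow> 'a set \<Rightarrow> 'a set" where
  "locus P W Q = {x \<in> W. \<exists>e>0. P \<inter> ball x e = Q \<inter> ball x e}"

lemma facets_on_locus: "facets_on P W Q = closure ` components (locus P W Q)"
  by (simp add: facets_on_def locus_def)

lemma convex_same_cell_class: "convex {y. same_cell H x y}"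
proof -
  have "convex {y. side h x = side h y}" for h
  proof -
    consider "side h x = 1" | "side h x = -1" | "side h x = 0"
      unfolding side_def by (metis sgn_real_def)
    then show ?thesis
    proof cases
      case 1
      then have "{y. side h x = side h y} = {y. fst h \<bullet> y > snd h}" by (auto simp: side_def sgn_if)
      then show ?thesis by (simp add: convex_halfspace_gt)
    next
      case 2
      then have "{y. side h x = side h y} = {y. fst h \<bullet> y < snd h}" by (auto simp: side_def sgn_if)
      then show ?thesis by (simp add: convex_halfspace_lt)
    next
      case 3
      then have "{y. side h x = side h y} = {y. fst h \<bullet> y = snd h}" by (auto simp: side_def sgn_if)
      then show ?thesis by (simp add: convex_hyperplane)
    qed
  qed
  moreover have "{y. same_cell H x y} = (\<Inter>h\<in>H. {y. side h x = side h y})" by (auto simp: same_cell_def)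
  ultimately show ?thesis by (simp add: convex_INT)
qed

lemma locus_open:
  assumes "x \<in> locus P W Q"
  shows "\<exists>e>0. W \<inter> ball x e \<subseteq> locus P W Q"
proof -
  obtain e where e: "e > 0" "P \<inter> ball x e = Q \<inter> ball x e" using assms by (auto simp: locus_def)
  have "y \<in> locus P W Q" if "y \<in> W" "y \<in> ball x (e/2)" for y
  proof -
    have "ball y (e/2) \<subseteq> ball x e" using that(2)
    proof -
      have "dist x z < e" if "dist y z < e/2" for z
        using dist_triangle[of x z y] that \<open>y \<in> ball x (e/2)\<close> by simp
      then show ?thesis by auto
    qed
    then have "P \<inter> ball y (e/2) = Q \<inter> ball y (e/2)" using e(2) by blast
    then show ?thesis using that e(1) by (auto simp: locus_def intro!: exI[of _ "e/2"])
  qed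
  then show ?thesis using e(1) by (intro exI[of _ "e/2"]) auto
qed

text \<open>Shifting by \<open>y - x\<close> carries a neighbourhood of \<open>x\<close> in
  \<open>V\<close> to one of \<open>y\<close>, preserving the cells of \<open>H\<close> and the side
  of \<open>W\<close>; so the coincidence of \<open>P\<close> with \<open>Q\<close> is transported
  along the cell.\<close>

lemma locus_pw_const:
  assumes "hplane_in V W n" "polyhedral H V P" "Q = {x\<in>V. n \<bullet> x \<ge> \<beta>}" "W = {x\<in>V. n \<bullet> x = \<beta>}"
  shows "pw_const W H (\<lambda>x. x \<in> locus P W Q)"
proof -
  have *: "y \<in> locus P W Q" if x: "x \<in> locus P W Q" and y: "y \<in> W" and eq: "same_cell H x y" for x y
  proof -
    have xW: "x \<in> W" using x by (auto simp: locus_def)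
    obtain e where e: "e > 0" "P \<inter> ball x e = Q \<inter> ball x e" using x by (auto simp: locus_def)
    have "finite H" using assms(2) by (simp add: polyhedral_def)
    from eventually_same_cell[OF this eq] obtain e' where e': "e' > 0" "\<And>\<delta>. dist \<delta> 0 < e' \<Longrightarrow> same_cell H (x + \<delta>) (y + \<delta>)"
      unfolding eventually_nhds_metric by auto
    have aff: "affine V" using assms(1) by (simp add: hplane_in_def)
    have "z \<in> P \<longleftrightarrow> z \<in> Q" if z: "z \<in> ball y (min e e')" for z
    proof (cases "z \<in> V")
      case True
      define \<delta> where "\<delta> = z - y"
      have \<delta>: "\<delta> \<in> dirs V" using True y assms(4) dirs_diff[OF aff] by (auto simp: \<delta>_def)
      then have xV: "x + \<delta> \<in> V" using xW assms(4) dirnD by blast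
      have "norm \<delta> < min e e'" using z by (simp add: \<delta>_def dist_norm norm_minus_commute)
      then have "same_cell H (x + \<delta>) z" "x + \<delta> \<in> ball x e" using e'(2)[of \<delta>] by (auto simp: \<delta>_def dist_norm norm_minus_commute)
      then have "z \<in> P \<longleftrightarrow> x + \<delta> \<in> P" using assms(2) True xV unfolding polyhedral_def pw_const_def by blast
      also have "\<dots> \<longleftrightarrow> x + \<delta> \<in> Q" using e(2) \<open>x + \<delta> \<in> ball x e\<close> by blast
      also have "\<dots> \<longleftrightarrow> z \<in> Q" using True xV xW y assms(3,4) by (auto simp: \<delta>_def inner_add_right inner_diff_right)
      finally show ?thesis .
    next
      case False
      then show ?thesis using assms(2,3) by (auto simp: polyhedral_def)
    qed
    then have "P \<inter> ball y (min e e') = Q \<inter> ball y (min e e')" by blast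
    then show ?thesis using y e(1) e'(1) by (auto simp: locus_def intro!: exI[of _ "min e e'"])
  qed
  show ?thesis unfolding pw_const_def using * same_cell_sym by blast
qed

text \<open>Each set is recovered from the sign vector on \<open>H\<close> of any one of its points,
  and there are finitely many sign vectors.\<close>

lemma finite_disjoint_pw_const:
  assumes "finite H" "\<And>C. C \<in> \<C> \<Longrightarrow> C \<noteq> {} \<and> C \<subseteq> W \<and> pw_const W H (\<lambda>x. x \<in> C)"
    "\<And>C D. C \<in> \<C> \<Longrightarrow> D \<in> \<C> \<Longrightarrow> C \<inter> D \<noteq> {} \<Longrightarrow> C = D"
  shows "finite \<C>"
proof -
  obtain p where p: "\<And>C. C \<in> \<C> \<Longrightarrow> p C \<in> C" using assms(2) by (metis ex_in_conv)
  define g where "g C = restrict (\<lambda>h. side h (p C)) H" for C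
  have "g ` \<C> \<subseteq> PiE H (\<lambda>_. {-1, 0, 1})"
    by (simp add: g_def side_def sgn_real_def image_subset_iff PiE_iff)
  then have "finite (g ` \<C>)" using assms(1) by (meson finite.emptyI finite.insertI finite_PiE finite_subset)
  moreover have "inj_on g \<C>"
  proof (rule inj_onI)
    fix C D assume CD: "C \<in> \<C>" "D \<in> \<C>" "g C = g D"
    then have "same_cell H (p C) (p D)" unfolding same_cell_def g_def by (metis restrict_apply')
    moreover have "p C \<in> W" "p D \<in> W" using p CD assms(2) by blast+
    ultimately have "p D \<in> C" using assms(2)[OF CD(1)] p[OF CD(1)] unfolding pw_const_def by blast
    then show "C = D" using assms(3)[OF CD(1,2)] p[OF CD(2)] by blast
  qed
  ultimately show ?thesis by (rule finite_imageD)
qed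

lemma component_open:
  fixes W :: "'a::euclidean_space set"
  assumes "affine W" "\<And>x. x \<in> U \<Longrightarrow> \<exists>e>0. W \<inter> ball x e \<subseteq> U" "U \<subseteq> W" "C \<in> components U" "x \<in> C"
  shows "\<exists>e>0. W \<inter> ball x e \<subseteq> C"
proof -
  have "x \<in> U" using assms in_components_subset by blast
  then obtain e where e: "e > 0" "W \<inter> ball x e \<subseteq> U" using assms by blast
  have "connected (W \<inter> ball x e)"
    using assms(1) by (simp add: convex_connected convex_Int affine_imp_convex)
  moreover have "C \<inter> (W \<inter> ball x e) \<noteq> {}" using assms e \<open>x \<in> U\<close> by auto
  ultimately have "W \<inter> ball x e \<subseteq> C" using components_maximal[OF assms(4)] e(2) by blast
  then show ?thesis using e(1) by blast
qed

text \<open>The part of a cell in \<open>W\<close> is convex, hence connected; if it lies in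
  \<open>U\<close> and meets a component, the component swallows it.\<close>

lemma component_pw_const:
  assumes "affine W" "U \<subseteq> W" "pw_const W H (\<lambda>x. x \<in> U)" "C \<in> components U"
  shows "pw_const W H (\<lambda>x. x \<in> C)"
proof -
  have "y \<in> C" if "x \<in> C" "y \<in> W" "same_cell H x y" for x y
  proof -
    define E where "E = W \<inter> {y. same_cell H x y}"
    have "x \<in> U" using that assms in_components_subset by blast
    then have "E \<subseteq> U" using assms(2,3) unfolding E_def pw_const_def by blast
    moreover have "connected E" unfolding E_def
      using assms(1) by (simp add: convex_connected convex_Int affine_imp_convex convex_same_cell_class)
    moreover have "C \<inter> E \<noteq> {}" using that \<open>x \<in> U\<close> assms by (auto simp: E_def)
    ultimately have "E \<subseteq> C" using components_maximal[OF assms(4)] by blast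
    then show ?thesis using that by (auto simp: E_def)
  qed
  then show ?thesis unfolding pw_const_def using same_cell_sym by blast
qed

lemma pw_const_closure:
  assumes "affine W" "finite H" "C \<subseteq> W" "pw_const W H (\<lambda>x. x \<in> C)"
  shows "pw_const W H (\<lambda>x. x \<in> closure C)"
proof -
  have "y \<in> closure C" if "x \<in> closure C" "x \<in> W" "y \<in> W" "same_cell H x y" for x y
    unfolding closure_approachable
  proof (intro allI impI)
    fix e :: real assume "e > 0"
    from eventually_same_cell[OF assms(2) that(4)] obtain e' where e': "e' > 0" "\<And>\<delta>. dist \<delta> 0 < e' \<Longrightarrow> same_cell H (x + \<delta>) (y + \<delta>)"
      unfolding eventually_nhds_metric by auto
    have "min e e' > 0" using \<open>e > 0\<close> e'(1) by simp
    with \<open>x \<in> closure C\<close> obtain z where z: "z \<in> C" "dist z x < min e e'" unfolding closure_approachable by blast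
    define \<delta> where "\<delta> = z - x"
    have "\<delta> \<in> dirs W" using z that assms dirs_diff by (auto simp: \<delta>_def)
    then have "y + \<delta> \<in> W" using that dirnD by blast
    moreover have "same_cell H z (y + \<delta>)" using e'(2)[of \<delta>] z(2) by (auto simp: \<delta>_def dist_norm)
    ultimately have "y + \<delta> \<in> C" using assms(3,4) z(1) unfolding pw_const_def by blast
    moreover have "dist (y + \<delta>) y < e" using z(2) by (simp add: \<delta>_def dist_norm)
    ultimately show "\<exists>y'\<in>C. dist y' y < e" by blast
  qed
  then show ?thesis unfolding pw_const_def using same_cell_sym by blast
qed

lemma generic_closure:
  assumes "finite H" "C \<subseteq> W" "pw_const W H (\<lambda>x. x \<in> C)" "x \<in> W" "generic W H x"
  shows "x \<in> closure C \<longleftrightarrow> x \<in> C"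
proof
  assume x: "x \<in> closure C"
  obtain e where e: "e > 0" "\<forall>y\<in>W \<inter> ball x e. same_cell H x y" using generic_local[OF assms(1,5,4)] by blast
  then obtain y where "y \<in> C" "dist y x < e" using x unfolding closure_approachable by blast
  then show "x \<in> C" using assms e unfolding pw_const_def by (metis IntI dist_commute mem_ball subsetD)
qed (use closure_subset in auto)

text \<open>The locus is relatively open and a union of cells of \<open>W\<close>, hence so are its
  components. They are finitely many, and passing to closures adds only points that are not generic;
  so at generic points the closed facets add up to the indicator of the locus.\<close>

lemma facets:
  assumes hp: "hplane_in V W n" and P: "polyhedral H V P" and Q: "Q = {x\<in>V. n \<bullet> x \<ge> \<beta>}" and W: "W = {x\<in>V. n \<bullet> x = \<beta>}"
  shows "finite (facets_on P W Q)"
    and "\<And>F. F \<in> facets_on P W Q \<Longrightarrow> polyhedral H W F"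
    and "\<And>F. F \<in> facets_on P W Q \<Longrightarrow> \<exists>x\<in>F. \<exists>e>0. W \<inter> ball x e \<subseteq> F \<and> W \<inter> ball x e \<subseteq> locus P W Q"
    and "\<And>x. x \<in> W \<Longrightarrow> generic W H x \<Longrightarrow> (\<Sum>F\<in>facets_on P W Q. indicat_real F x) = indicat_real (locus P W Q) x"
proof -
  define U where "U = locus P W Q"
  have aff: "affine W" using hp hplane_in_affine by blast
  have UW: "U \<subseteq> W" by (auto simp: U_def locus_def)
  have op: "\<And>x. x \<in> U \<Longrightarrow> \<exists>e>0. W \<inter> ball x e \<subseteq> U" using locus_open by (auto simp: U_def)
  have pcU: "pw_const W H (\<lambda>x. x \<in> U)" using locus_pw_const[OF assms] by (simp add: U_def)
  have H: "finite H" and clP: "closed P" and bP: "bounded P" using P by (auto simp: polyhedral_def)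
  have UP: "U \<subseteq> P"
    using W Q by (force simp: U_def locus_def)
  have C: "C \<noteq> {} \<and> C \<subseteq> W \<and> pw_const W H (\<lambda>x. x \<in> C)" if "C \<in> components U" for C
    using that component_pw_const[OF aff UW pcU that] UW in_components_nonempty in_components_subset by blast
  have dis: "C = D" if "C \<in> components U" "D \<in> components U" "C \<inter> D \<noteq> {}" for C D
    using that components_nonoverlap by blast
  have fin: "finite (components U)" by (rule finite_disjoint_pw_const[OF H C dis])
  then show "finite (facets_on P W Q)" by (simp add: facets_on_locus U_def)
  have clW: "closed W" using aff affine_closed by blast
  show "polyhedral H W F" if "F \<in> facets_on P W Q" for F
  proof -
    obtain c where c: "c \<in> components U" "F = closure c" using \<open>F \<in> facets_on P W Q\<close> by (auto simp: facets_on_locus U_def)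
    have "c \<subseteq> P" using c UP in_components_subset by blast
    then have "closure c \<subseteq> P" using clP closure_minimal by blast
    moreover have "closure c \<subseteq> W" using C[OF c(1)] clW closure_minimal by blast
    ultimately show ?thesis using c C[OF c(1)] H bP pw_const_closure[OF aff H] bounded_subset unfolding polyhedral_def by blast
  qed
  show "\<exists>x\<in>F. \<exists>e>0. W \<inter> ball x e \<subseteq> F \<and> W \<inter> ball x e \<subseteq> locus P W Q" if "F \<in> facets_on P W Q" for F
  proof -
    obtain c where c: "c \<in> components U" "F = closure c" using \<open>F \<in> facets_on P W Q\<close> by (auto simp: facets_on_locus U_def)
    obtain x where x: "x \<in> c" using C[OF c(1)] by blast
    obtain e where "e > 0" "W \<inter> ball x e \<subseteq> c" using component_open[OF aff op UW c(1) x] by blast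
    then show ?thesis using c x closure_subset in_components_subset[OF c(1)] unfolding U_def by blast
  qed
  \<comment> \<open>Relatively open components with equal closures meet, so they coincide; the sum
    over facets is a sum over components.\<close>
  have inj: "inj_on closure (components U)"
  proof (rule inj_onI)
    fix C' D assume CD: "C' \<in> components U" "D \<in> components U" "closure C' = closure D"
    obtain x where x: "x \<in> C'" using C[OF CD(1)] by blast
    obtain e where e: "e > 0" "W \<inter> ball x e \<subseteq> C'" using component_open[OF aff op UW CD(1) x] by blast
    have "x \<in> closure D" using x CD(3) closure_subset by blast
    then obtain y where "y \<in> D" "dist y x < e" using e(1) unfolding closure_approachable by blast
    then have "y \<in> C'" using e(2) C[OF CD(2)] by (auto simp: dist_commute)
    then show "C' = D" using dis CD \<open>y \<in> D\<close> by blast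
  qed
  show "(\<Sum>F\<in>facets_on P W Q. indicat_real F x) = indicat_real (locus P W Q) x" if x: "x \<in> W" "generic W H x" for x
  proof -
    have "(\<Sum>F\<in>facets_on P W Q. indicat_real F x) = (\<Sum>c\<in>components U. indicat_real (closure c) x)"
      unfolding facets_on_locus U_def[symmetric] by (subst sum.reindex[OF inj]) simp
    also have "\<dots> = (\<Sum>c\<in>components U. indicat_real c x)"
      using generic_closure[OF H _ _ x] C by (intro sum.cong refl) (auto simp: indicator_def)
    also have "\<dots> = indicat_real (\<Union>(components U)) x"
    proof -
      have "disjoint_family_on (\<lambda>c. c) (components U)" unfolding disjoint_family_on_def using dis by blast
      then have "indicat_real (\<Union>c\<in>components U. c) x = (\<Sum>c\<in>components U. indicat_real c x)"
        by (rule indicator_UN_disjoint[OF fin])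
      then show ?thesis by simp
    qed
    also have "\<dots> = indicat_real U x" by (simp add: Union_components)
    finally show ?thesis by (simp add: U_def)
  qed
qed

text \<open>Near a generic point each of the two open halves of \<open>V\<close> lies entirely
  inside or entirely outside \<open>P\<close>. The one-sided limits tell which, and closedness of
  \<open>P\<close> decides the points of \<open>W\<close> itself.\<close>

lemma locus_iff:
  assumes hp: "hplane_in V W n" and P: "polyhedral H V P" and Q: "Q = {x\<in>V. n \<bullet> x \<ge> \<beta>}" and W: "W = {x\<in>V. n \<bullet> x = \<beta>}"
    and x: "x \<in> W" "generic W H x"
  shows "x \<in> locus P W Q \<longleftrightarrow> ray_limit n (indicat_real P) x = 1 \<and> ray_limit (- n) (indicat_real P) x = 0"
proof -
  have aff: "affine V" and n0: "n \<noteq> 0" and nd: "n \<in> dirs V" using hp by (auto simp: hplane_in_def)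
  have H: "finite H" and clP: "closed P" and PV: "P \<subseteq> V" using P by (auto simp: polyhedral_def)
  have xV: "x \<in> V" using x W by auto
  have V: "z + s *\<^sub>R n \<in> V" if "z \<in> V" for s z
      using aff nd dirnD dirs_scale that by blast
  obtain e where e: "e > 0" "\<forall>y\<in>V \<inter> ball x e. \<forall>z\<in>V \<inter> ball x e. sgn (n \<bullet> (y - x)) = sgn (n \<bullet> (z - x)) \<longrightarrow> same_cell H y z"
    using generic_local_hplane_in[OF hp H x(2,1)] by blast
  have same: "y \<in> P \<longleftrightarrow> z \<in> P" if "y \<in> V" "y \<in> ball x e" "z \<in> V" "z \<in> ball x e" "sgn (n \<bullet> (y - x)) = sgn (n \<bullet> (z - x))" for y z
    using that e(2) P unfolding polyhedral_def pw_const_def by blast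
  define s where "s = e / (2 * norm n)"
  have s: "s > 0" "s * norm n < e" using e(1) n0 by (auto simp: s_def)
  have nn: "n \<bullet> n > 0" using n0 by simp
  have inb: "x + t *\<^sub>R n \<in> ball x e" if "\<bar>t\<bar> \<le> s" for t
  proof -
    have "\<bar>t\<bar> * norm n \<le> s * norm n" using that by (intro mult_right_mono) auto
    then show ?thesis using s(2) by (simp add: dist_norm)
  qed
  have dp: "ray_limit n (indicat_real P) x = indicat_real P (x + s *\<^sub>R n)"
  proof (rule ray_limit_eqI)
    have "indicat_real P (x + t *\<^sub>R n) = indicat_real P (x + s *\<^sub>R n)" if "0 < t" "t < s" for t
      using same[of "x + t *\<^sub>R n" "x + s *\<^sub>R n"] V[OF xV] inb[of t] inb[of s] that s(1) nn
      by (auto simp: indicator_def)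
    then show "\<forall>\<^sub>F t in at_right 0. indicat_real P (x + t *\<^sub>R n) = indicat_real P (x + s *\<^sub>R n)"
      unfolding eventually_at_right_field using s(1) by blast
  qed
  have dm: "ray_limit (- n) (indicat_real P) x = indicat_real P (x + (- s) *\<^sub>R n)"
  proof (rule ray_limit_eqI)
    have "indicat_real P (x + t *\<^sub>R (- n)) = indicat_real P (x + (- s) *\<^sub>R n)" if "0 < t" "t < s" for t
      using same[of "x + (- t) *\<^sub>R n" "x + (- s) *\<^sub>R n"] V[OF xV, of "-t"] V[OF xV, of "-s"] inb[of "-t"] inb[of "-s"] that s(1) nn
      by (auto simp: indicator_def)
    then show "\<forall>\<^sub>F t in at_right 0. indicat_real P (x + t *\<^sub>R (- n)) = indicat_real P (x + (- s) *\<^sub>R n)"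
      unfolding eventually_at_right_field using s(1) by blast
  qed
  have "x \<in> locus P W Q \<longleftrightarrow> x + s *\<^sub>R n \<in> P \<and> x + (- s) *\<^sub>R n \<notin> P"
  proof
    assume "x \<in> locus P W Q"
    then obtain e' where e': "e' > 0" "P \<inter> ball x e' = Q \<inter> ball x e'" by (auto simp: locus_def)
    define t where "t = min s (e' / (2 * norm n))"
    have t: "t > 0" "t \<le> s" using s e' n0 by (auto simp: t_def)
    have "t * norm n \<le> e' / (2 * norm n) * norm n" by (intro mult_right_mono) (auto simp: t_def)
    then have "t * norm n < e'" using n0 e'(1) by simp
    then have b: "x + t *\<^sub>R n \<in> ball x e'" "x + (-t) *\<^sub>R n \<in> ball x e'" using t by (auto simp: dist_norm)
    have "x + t *\<^sub>R n \<in> Q" "x + (-t) *\<^sub>R n \<notin> Q" using Q x W V[OF xV, of t] V[OF xV, of "-t"] mult_pos_pos[OF t(1) nn] t(1)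
      by (auto simp: inner_add_right inner_diff_right)
    then have "x + t *\<^sub>R n \<in> P" "x + (-t) *\<^sub>R n \<notin> P" using b e'(2) by blast+
    then show "x + s *\<^sub>R n \<in> P \<and> x + (- s) *\<^sub>R n \<notin> P"
      using same[of "x + t *\<^sub>R n" "x + s *\<^sub>R n"] same[of "x + (- t) *\<^sub>R n" "x + (- s) *\<^sub>R n"]
         V[OF xV, of t] V[OF xV, of s] V[OF xV, of "-t"] V[OF xV, of "-s"]
         inb[of t] inb[of s] inb[of "-t"] inb[of "-s"] t s nn by simp
  next
    assume ps: "x + s *\<^sub>R n \<in> P \<and> x + (- s) *\<^sub>R n \<notin> P"
    have pos: "y \<in> P" if "y \<in> V" "y \<in> ball x e" "n \<bullet> (y - x) > 0" for y
      using same[of y "x + s *\<^sub>R n"] that ps V[OF xV, of s] inb[of s] s nn by simp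
    have neg: "y \<notin> P" if "y \<in> V" "y \<in> ball x e" "n \<bullet> (y - x) < 0" for y
      using same[of y "x + (-s) *\<^sub>R n"] that ps V[OF xV, of "-s"] inb[of "-s"] s nn by simp
    \<comment> \<open>Points of \<open>W\<close> near \<open>x\<close> are limits of points from the
      positive half, which lie in the closed set \<open>P\<close>.\<close>
    have zero: "y \<in> P" if "y \<in> V" "y \<in> ball x e" "n \<bullet> (y - x) = 0" for y
    proof -
      have "\<forall>\<^sub>F t in at_right 0. norm ((y - x) + t *\<^sub>R n) < e"
        by (rule eventually_at_right_scale[OF eventually_norm_less]) (use that in \<open>simp add: dist_norm norm_minus_commute\<close>)
      then have "\<forall>\<^sub>F t in at_right 0. y + t *\<^sub>R n \<in> P"
        using eventually_at_right_less[of "0::real"]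
      proof eventually_elim
        case (elim t)
        have "n \<bullet> (y + t *\<^sub>R n - x) = n \<bullet> (y - x) + t * (n \<bullet> n)" by (simp add: algebra_simps inner_add_right inner_diff_right)
        then show ?case
          by (intro pos) (use elim that V[of y t] nn in \<open>auto simp: dist_norm norm_minus_commute algebra_simps\<close>)
      qed
      moreover have "((\<lambda>t. y + t *\<^sub>R n) \<longlongrightarrow> y + 0 *\<^sub>R n) (at_right 0)" by (intro tendsto_intros)
      ultimately show ?thesis using Lim_in_closed_set[OF clP] by force
    qed
    have "y \<in> P \<longleftrightarrow> y \<in> Q" if "y \<in> ball x e" for y
    proof (cases "y \<in> V")
      case True
      have nx: "n \<bullet> x = \<beta>" using x W by auto
      show ?thesis using pos[OF True that] neg[OF True that] zero[OF True that] Q True nx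
        by (auto simp: inner_diff_right) linarith+
    qed (use PV Q in auto)
    then have "P \<inter> ball x e = Q \<inter> ball x e" by blast
    then show "x \<in> locus P W Q" using x e(1) by (auto simp: locus_def)
  qed
  then show ?thesis using dp dm by (auto simp: indicator_def)
qed

text \<open>The one-sided limits of an indicator are 0 or 1. The jump is 1 exactly on the locus of
  \<open>Q\<close> and -1 exactly on that of \<open>Q'\<close>; the second case is the first one for
  \<open>- n\<close>.\<close>

lemma jump_facets:
  assumes hp: "hplane_in V W n" and P: "polyhedral H V P" and W: "W = {x\<in>V. n \<bullet> x = \<beta>}"
    and Q: "Q = {x\<in>V. n \<bullet> x \<ge> \<beta>}" and Q': "Q' = {x\<in>V. n \<bullet> x \<le> \<beta>}"
  shows "ae_on W (jump n (indicat_real P)) (\<lambda>x. (\<Sum>F\<in>facets_on P W Q. indicat_real F x) - (\<Sum>F\<in>facets_on P W Q'. indicat_real F x))"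
    and "finite (facets_on P W Q)" "finite (facets_on P W Q')" "facets_on P W Q \<inter> facets_on P W Q' = {}"
    and "F \<in> facets_on P W Q \<union> facets_on P W Q' \<Longrightarrow> polyhedral H W F"
    and "facets_on P W Q \<union> facets_on P W Q' \<noteq> {} \<Longrightarrow> \<exists>h\<in>H. W \<subseteq> hplane h \<and> \<not> V \<subseteq> hplane h"
proof -
  have hp': "hplane_in V W (- n)" using hp hplane_in_neg by blast
  have Q2: "Q' = {x\<in>V. (- n) \<bullet> x \<ge> - \<beta>}" "W = {x\<in>V. (- n) \<bullet> x = - \<beta>}" using Q' W by auto
  have H: "finite H" using P by (simp add: polyhedral_def)
  note 1 = facets[OF hp P Q W] and 2 = facets[OF hp' P Q2]
  show fin: "finite (facets_on P W Q)" "finite (facets_on P W Q')" using 1(1) 2(1) by auto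
  show "F \<in> facets_on P W Q \<union> facets_on P W Q' \<Longrightarrow> polyhedral H W F" using 1(2) 2(2) by auto
  have disj: "generic W H x \<Longrightarrow> \<not> (x \<in> locus P W Q \<and> x \<in> locus P W Q')" if "x \<in> W" for x
    using locus_iff[OF hp P Q W that] locus_iff[OF hp' P Q2 that] by auto
  \<comment> \<open>A common facet would contain a relative ball of \<open>W\<close>, hence a
    generic point at which \<open>P\<close> adjoins from exactly one side and from exactly the
    other.\<close>
  show "facets_on P W Q \<inter> facets_on P W Q' = {}"
  proof (rule ccontr)
    assume "facets_on P W Q \<inter> facets_on P W Q' \<noteq> {}"
    then obtain F where F: "F \<in> facets_on P W Q" "F \<in> facets_on P W Q'" by blast
    obtain x e where xe: "x \<in> F" "e > 0" "W \<inter> ball x e \<subseteq> F" using 1(3)[OF F(1)] by blast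
    have xW: "x \<in> W" using xe 1(2)[OF F(1)] by (auto simp: polyhedral_def)
    obtain y where y: "y \<in> W" "dist x y < e" "generic W H y"
      using generic_dense[OF H hplane_in_affine[OF hp] xW xe(2)] by blast
    then have yF: "y \<in> F" using xe by auto
    have "(\<Sum>F\<in>facets_on P W Q. indicat_real F y) \<ge> indicat_real F y"
      by (rule member_le_sum) (use F fin in auto)
    moreover have "(\<Sum>F\<in>facets_on P W Q'. indicat_real F y) \<ge> indicat_real F y"
      by (rule member_le_sum) (use F fin in auto)
    ultimately have "y \<in> locus P W Q" "y \<in> locus P W Q'"
      using yF 1(4)[OF y(1,3)] 2(4)[OF y(1,3)] by (auto simp: indicator_def of_bool_def split: if_splits)
    then show False using disj y by blast
  qed
  show "ae_on W (jump n (indicat_real P)) (\<lambda>x. (\<Sum>F\<in>facets_on P W Q. indicat_real F x) - (\<Sum>F\<in>facets_on P W Q'. indicat_real F x))"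
  proof (rule ae_on_generic[OF H])
    fix x assume x: "x \<in> W" "generic W H x"
    have l: "lpw_const V (indicat_real P)" using P H pw_const_imp_lpw_const polyhedral_pw_const_indicator by blast
    have aff: "affine V" and nd: "n \<in> dirs V" "-n \<in> dirs V" using hp hp' by (auto simp: hplane_in_def)
    have "x \<in> V" using x W by auto
    have v01: "ray_limit m (indicat_real P) x \<in> {0,1}" if "m \<in> dirs V" for m
    proof -
      obtain t where "indicat_real P (x + t *\<^sub>R m) = ray_limit m (indicat_real P) x"
        using eventually_happens[OF ray_limit_ex[OF l aff \<open>x \<in> V\<close> \<open>m \<in> dirs V\<close>]] by auto
      then show ?thesis by (metis indicator_simps insertCI)
    qed
    show "jump n (indicat_real P) x = (\<Sum>F\<in>facets_on P W Q. indicat_real F x) - (\<Sum>F\<in>facets_on P W Q'. indicat_real F x)"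
      using v01[OF nd(1)] v01[OF nd(2)] unfolding 1(4)[OF x] 2(4)[OF x] jump_def
        indicator_def[of "locus P W Q"] indicator_def[of "locus P W Q'"]
        locus_iff[OF hp P Q W x] locus_iff[OF hp' P Q2 x] by auto
  qed
  show "\<exists>h\<in>H. W \<subseteq> hplane h \<and> \<not> V \<subseteq> hplane h" if ne: "facets_on P W Q \<union> facets_on P W Q' \<noteq> {}"
  proof (rule ccontr)
    assume neg: "\<not> ?thesis"
    obtain F where F: "F \<in> facets_on P W Q \<or> F \<in> facets_on P W Q'" using ne by blast
    obtain x e where xe: "x \<in> F" "e > 0" "W \<inter> ball x e \<subseteq> locus P W Q \<or> W \<inter> ball x e \<subseteq> locus P W Q'" "x \<in> W"
      using F 1(2,3) 2(2,3) unfolding polyhedral_def by (metis subsetD)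
    obtain y where y: "y \<in> W" "dist x y < e" "generic W H y"
      using generic_dense[OF H hplane_in_affine[OF hp] xe(4,2)] by blast
    then have "y \<in> locus P W Q \<or> y \<in> locus P W Q'" using xe(3) by auto
    then have dd: "ray_limit n (indicat_real P) y \<noteq> ray_limit (- n) (indicat_real P) y"
      unfolding locus_iff[OF hp P Q W y(1,3)] locus_iff[OF hp' P Q2 y(1,3)] by auto
    have yV: "y \<in> V" using y W by auto
    have "generic V H y" using y neg unfolding generic_def by blast
    then have "ray_limit m (indicat_real P) y = indicat_real P y" if "m \<in> dirs V" for m
      using that hp yV by (intro ray_limit_generic[OF H polyhedral_pw_const_indicator[OF P]]) (auto simp: hplane_in_def)
    then show False using dd hp hp' by (auto simp: hplane_in_def)
  qed
qed

section \<open>Flags\<close>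

text \<open>\<open>jumps \<nu> r m\<close> takes the jump in direction \<open>\<nu> (r + m - 1)\<close> first and that in direction \<open>\<nu> r\<close> last.\<close>

fun jumps :: "(nat \<Rightarrow> 'a::euclidean_space) \<Rightarrow> nat \<Rightarrow> nat \<Rightarrow> ('a \<Rightarrow> real) \<Rightarrow> 'a \<Rightarrow> real" where
  "jumps \<nu> r 0 f = f"
| "jumps \<nu> r (Suc m) f = jump (\<nu> r) (jumps \<nu> (Suc r) m f)"

text \<open>The recursion of \<open>jumps\<close> splits off the lowest flat, while a chain of faces
  starts at the top; this mediates between the two.\<close>

lemma jumps_top: "jumps \<nu> r (Suc m) f = jumps \<nu> r m (jump (\<nu> (r + m)) f)"
proof (induction m arbitrary: r)
  case (Suc m)
  then show ?case by (metis add_Suc_shift jumps.simps(2))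
qed simp

text \<open>The part of a flag that iterated jumps depend on. The top flat may be proper, as the
  induction along a flag starts from intermediate flats.\<close>

definition tower :: "(nat \<Rightarrow> 'a::euclidean_space) \<Rightarrow> (nat \<Rightarrow> 'a set) \<Rightarrow> nat \<Rightarrow> nat \<Rightarrow> bool" where
  "tower \<nu> V r m \<longleftrightarrow> affine (V (r + m)) \<and> V (r + m) \<noteq> {} \<and> (\<forall>j\<in>{r..<r+m}. hplane_in (V (Suc j)) (V j) (\<nu> j))"

lemma tower_Suc: "tower \<nu> V r (Suc m) \<longleftrightarrow> hplane_in (V (Suc r)) (V r) (\<nu> r) \<and> tower \<nu> V (Suc r) m"
proof -
  have "{r..<r + Suc m} = insert r {Suc r..<Suc r+m}" by auto
  then show ?thesis by (auto simp: tower_def)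
qed

lemma tower_affine: "tower \<nu> V r m \<Longrightarrow> affine (V r)" "tower \<nu> V r m \<Longrightarrow> V r \<noteq> {}"
proof -
  assume t: "tower \<nu> V r m"
  show "affine (V r)"
    using t by (cases m) (auto simp: tower_Suc hplane_in_affine, simp add: tower_def)
  show "V r \<noteq> {}"
    using t by (cases m) (auto simp: tower_Suc, auto simp: tower_def hplane_in_def)
qed

lemma pw_const_jumps:
  assumes "tower \<nu> V r m" "finite H" "pw_const (V (r + m)) H f"
  shows "pw_const (V r) H (jumps \<nu> r m f)"
  using assms
proof (induction m arbitrary: r)
  case (Suc m)
  then have hp: "hplane_in (V (Suc r)) (V r) (\<nu> r)" and "tower \<nu> V (Suc r) m" by (auto simp: tower_Suc)
  then have "pw_const (V (Suc r)) H (jumps \<nu> (Suc r) m f)" using Suc by simp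
  then have "pw_const (V (Suc r)) H (jump (\<nu> r) (jumps \<nu> (Suc r) m f))"
    using hp Suc.prems(2) by (intro pw_const_jump) (auto simp: hplane_in_def)
  then show ?case using pw_const_mono[OF _ _ hplane_in_subset[OF hp]] by auto
qed simp

lemma lpw_const_jumps:
  assumes "tower \<nu> V r m" "lpw_const (V (r + m)) f"
  shows "lpw_const (V r) (jumps \<nu> r m f)"
  using assms
proof (induction m arbitrary: r)
  case (Suc m)
  then have hp: "hplane_in (V (Suc r)) (V r) (\<nu> r)" and "tower \<nu> V (Suc r) m" by (auto simp: tower_Suc)
  then have "lpw_const (V (Suc r)) (jumps \<nu> (Suc r) m f)" using Suc by simp
  then have "lpw_const (V (Suc r)) (jump (\<nu> r) (jumps \<nu> (Suc r) m f))"
    using hp by (intro lpw_const_jump) (auto simp: hplane_in_def)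
  then show ?case using lpw_const_mono[OF _ hplane_in_subset[OF hp]] by auto
qed simp

lemma ae_on_jumps:
  assumes "tower \<nu> V r m" "ae_on (V (r + m)) f g"
  shows "ae_on (V r) (jumps \<nu> r m f) (jumps \<nu> r m g)"
  using assms
proof (induction m arbitrary: r)
  case (Suc m)
  then show ?case by (auto simp: tower_Suc intro: ae_on_jump)
qed simp

lemma jump_cong_on:
  assumes "affine V" "x \<in> V" "n \<in> dirs V" "\<And>y. y \<in> V \<Longrightarrow> f y = g y"
  shows "jump n f x = jump n g x"
proof -
  have "x + t *\<^sub>R m \<in> V" if "m \<in> dirs V" for t m using assms that dirnD dirs_scale by blast
  then have "ray_limit m f x = ray_limit m g x" if "m \<in> dirs V" for m
    using that assms(4) by (intro ray_limit_cong always_eventually) auto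
  moreover have "- n \<in> dirs V" using assms dirs_neg by blast
  ultimately show ?thesis using assms(3) by (simp add: jump_def)
qed

lemma jumps_lin:
  assumes "tower \<nu> V r m" "lpw_const (V (r + m)) f" "lpw_const (V (r + m)) g" "x \<in> V r"
  shows "jumps \<nu> r m (\<lambda>x. f x + g x) x = jumps \<nu> r m f x + jumps \<nu> r m g x"
    and "jumps \<nu> r m (\<lambda>x. c * f x) x = c * jumps \<nu> r m f x"
proof -
  have "(\<forall>x\<in>V r. jumps \<nu> r m (\<lambda>x. f x + g x) x = jumps \<nu> r m f x + jumps \<nu> r m g x)
     \<and> (\<forall>x\<in>V r. jumps \<nu> r m (\<lambda>x. c * f x) x = c * jumps \<nu> r m f x)"
    using assms(1-3)
  proof (induction m arbitrary: r)
    case (Suc m)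
    then have hp: "hplane_in (V (Suc r)) (V r) (\<nu> r)" and t: "tower \<nu> V (Suc r) m" by (auto simp: tower_Suc)
    have V: "affine (V (Suc r))" "\<nu> r \<in> dirs (V (Suc r))" "V r \<subseteq> V (Suc r)" using hp hplane_in_subset[OF hp] by (auto simp: hplane_in_def)
    have l: "lpw_const (V (Suc r)) (jumps \<nu> (Suc r) m f)" "lpw_const (V (Suc r)) (jumps \<nu> (Suc r) m g)"
      using Suc.prems by (auto intro!: lpw_const_jumps t)
    have IH: "(\<forall>x\<in>V (Suc r). jumps \<nu> (Suc r) m (\<lambda>x. f x + g x) x = jumps \<nu> (Suc r) m f x + jumps \<nu> (Suc r) m g x)
     \<and> (\<forall>x\<in>V (Suc r). jumps \<nu> (Suc r) m (\<lambda>x. c * f x) x = c * jumps \<nu> (Suc r) m f x)"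
      using Suc.IH[OF t] Suc.prems by simp
    have "jumps \<nu> r (Suc m) (\<lambda>x. f x + g x) x = jumps \<nu> r (Suc m) f x + jumps \<nu> r (Suc m) g x" if "x \<in> V r" for x
    proof -
      have x: "x \<in> V (Suc r)" using that V by auto
      have "jumps \<nu> r (Suc m) (\<lambda>x. f x + g x) x = jump (\<nu> r) (\<lambda>x. jumps \<nu> (Suc r) m f x + jumps \<nu> (Suc r) m g x) x"
        unfolding jumps.simps by (rule jump_cong_on[OF V(1) x V(2)]) (use IH in auto)
      then show ?thesis using jump_lin(1)[OF V(1) x V(2) l] by simp
    qed
    moreover have "jumps \<nu> r (Suc m) (\<lambda>x. c * f x) x = c * jumps \<nu> r (Suc m) f x" if "x \<in> V r" for x
    proof -
      have x: "x \<in> V (Suc r)" using that V by auto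
      have "jumps \<nu> r (Suc m) (\<lambda>x. c * f x) x = jump (\<nu> r) (\<lambda>x. c * jumps \<nu> (Suc r) m f x) x"
        unfolding jumps.simps by (rule jump_cong_on[OF V(1) x V(2)]) (use IH in auto)
      then show ?thesis using jump_lin(2)[OF V(1) x V(2) l] by simp
    qed
    ultimately show ?case by blast
  qed simp
  then show "jumps \<nu> r m (\<lambda>x. f x + g x) x = jumps \<nu> r m f x + jumps \<nu> r m g x"
    and "jumps \<nu> r m (\<lambda>x. c * f x) x = c * jumps \<nu> r m f x" using assms(4) by auto
qed

lemma lpw_const_const [simp]: "lpw_const V (\<lambda>x. c)"
  by (auto simp: lpw_const_def pw_const_def)

lemma lpw_const_binop:
  assumes "lpw_const V f" "lpw_const V g" shows "lpw_const V (\<lambda>x. k (f x) (g x))"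
  unfolding lpw_const_def
proof
  fix R
  obtain H G where "finite H" "pw_const (V \<inter> ball 0 R) H f" "finite G" "pw_const (V \<inter> ball 0 R) G g"
    using assms unfolding lpw_const_def by metis
  then have "finite (H \<union> G)" "pw_const (V \<inter> ball 0 R) (H \<union> G) f" "pw_const (V \<inter> ball 0 R) (H \<union> G) g"
    by (auto intro: pw_const_mono)
  then show "\<exists>H. finite H \<and> pw_const (V \<inter> ball 0 R) H (\<lambda>x. k (f x) (g x))"
    unfolding pw_const_def by (intro exI[of _ "H \<union> G"]) metis
qed

lemma lpw_const_sum: "finite I \<Longrightarrow> (\<And>i. i \<in> I \<Longrightarrow> lpw_const V (f i)) \<Longrightarrow> lpw_const V (\<lambda>x. \<Sum>i\<in>I. (f i x :: real))"
  by (induction I rule: finite_induct) (auto intro: lpw_const_binop[where k = "(+)"])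

lemma jumps_sum:
  assumes "tower \<nu> V r m" "finite I" "\<And>i. i \<in> I \<Longrightarrow> lpw_const (V (r + m)) (f i)" "x \<in> V r"
  shows "jumps \<nu> r m (\<lambda>x. \<Sum>i\<in>I. c i * f i x) x = (\<Sum>i\<in>I. c i * jumps \<nu> r m (f i) x)"
  using assms(2,3)
proof (induction I)
  case empty
  show ?case using jumps_lin(2)[OF assms(1) lpw_const_const lpw_const_const assms(4), of 0 0] by simp
next
  case (insert i I)
  have 1: "lpw_const (V (r + m)) (\<lambda>x. c i * f i x)" "lpw_const (V (r + m)) (\<lambda>x. \<Sum>i\<in>I. c i * f i x)"
    using insert by (auto intro!: lpw_const_sum lpw_const_binop[where k = "(*)"])
  show ?case using insert jumps_lin(1)[OF assms(1) 1 assms(4)] jumps_lin(2)[OF assms(1) _ lpw_const_const assms(4)]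
    by simp
qed

text \<open>Chooses normals pointing to the positive sides, so that the sign of a facet agrees with
  the sign of the jump. The same normals serve all translates of the flag.\<close>

definition normals :: "nat \<Rightarrow> 'a::euclidean_space flag \<Rightarrow> (nat \<Rightarrow> 'a) \<Rightarrow> bool" where
  "normals r \<Phi> \<nu> \<longleftrightarrow> r \<le> DIM('a) \<and> flat \<Phi> DIM('a) = UNIV \<and>
     (\<forall>j\<in>{r..<DIM('a)}. hplane_in (flat \<Phi> (Suc j)) (flat \<Phi> j) (\<nu> j) \<and>
       (\<exists>\<beta>. flat \<Phi> j = {x\<in>flat \<Phi> (Suc j). \<nu> j \<bullet> x = \<beta>} \<and> pos \<Phi> j = {x\<in>flat \<Phi> (Suc j). \<nu> j \<bullet> x \<ge> \<beta>}
          \<and> neg \<Phi> j = {x\<in>flat \<Phi> (Suc j). \<nu> j \<bullet> x \<le> \<beta>}))"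

lemma normals_tower: "normals r (\<Phi>::'a::euclidean_space flag) \<nu> \<Longrightarrow> tower \<nu> (flat \<Phi>) r (DIM('a) - r)"
  by (auto simp: normals_def tower_def)

text \<open>The vector defining the half-space need not be tangent to \<open>V\<close>. Its
  component orthogonal to \<open>dirs V\<close> is constant on \<open>V\<close> and is absorbed in
  the bound; the tangential component is nonzero because \<open>W\<close> is a proper nonempty part
  of \<open>V\<close>.\<close>

lemma halfspace_normal:
  assumes "affine V" "halfspace_of V W Q" "W \<noteq> {}" "W \<noteq> V"
  shows "\<exists>n \<beta>. hplane_in V W n \<and> W = {x\<in>V. n \<bullet> x = \<beta>} \<and> Q = {x\<in>V. n \<bullet> x \<ge> \<beta>}"
proof -
  obtain a b where ab: "W = {x \<in> V. a \<bullet> x = b}" "Q = {x \<in> V. a \<bullet> x \<ge> b}"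
    using assms(2) by (auto simp: halfspace_of_def)
  then obtain p where p: "p \<in> V" using assms(3) by auto
  have sub: "subspace (dirs V)" using assms(1) p subspace_dirs by blast
  obtain n z where nz: "n \<in> span (dirs V)" "\<And>w. w \<in> span (dirs V) \<Longrightarrow> orthogonal z w" "a = n + z"
    using orthogonal_subspace_decomp_exists[of "dirs V" a] by metis
  have n: "n \<in> dirs V" using nz(1) sub by (metis span_eq_iff)
  have ax: "a \<bullet> x = n \<bullet> x + (a \<bullet> p - n \<bullet> p)" if "x \<in> V" for x
  proof -
    have "x - p \<in> dirs V" using assms(1) p that dirs_diff by blast
    then have "z \<bullet> (x - p) = 0" using nz(2) span_base unfolding orthogonal_def by blast
    then show ?thesis by (simp add: nz(3) inner_diff_right inner_add_left)
  qed
  define \<beta> where "\<beta> = b - (a \<bullet> p - n \<bullet> p)"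
  have W: "W = {x\<in>V. n \<bullet> x = \<beta>}" "Q = {x\<in>V. n \<bullet> x \<ge> \<beta>}"
    unfolding ab \<beta>_def using ax by force+
  have "n \<noteq> 0" using W assms(3,4) by auto
  then show ?thesis using W n assms unfolding hplane_in_def by blast
qed

lemma flag_normals:
  fixes \<Phi> :: "'a::euclidean_space flag"
  assumes "is_flag r \<Phi>" "r \<le> DIM('a)"
  shows "\<exists>\<nu>. normals r \<Phi> \<nu>"
proof -
  define S where "S j n \<longleftrightarrow> hplane_in (flat \<Phi> (Suc j)) (flat \<Phi> j) n \<and> (\<exists>\<beta>. flat \<Phi> j = {x\<in>flat \<Phi> (Suc j). n \<bullet> x = \<beta>}
          \<and> pos \<Phi> j = {x\<in>flat \<Phi> (Suc j). n \<bullet> x \<ge> \<beta>}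
          \<and> neg \<Phi> j = {x\<in>flat \<Phi> (Suc j). n \<bullet> x \<le> \<beta>})" for j n
  have "\<exists>n. S j n" if j: "j \<in> {r..<DIM('a)}" for j
  proof -
    have jj: "j \<in> {r..DIM('a)}" "Suc j \<in> {r..DIM('a)}" using j by auto
    have d: "aff_dim (flat \<Phi> j) = int j" "aff_dim (flat \<Phi> (Suc j)) = int (Suc j)" "affine (flat \<Phi> (Suc j))"
      using assms jj unfolding is_flag_def by blast+
    have h: "halfspace_of (flat \<Phi> (Suc j)) (flat \<Phi> j) (pos \<Phi> j)" using assms j unfolding is_flag_def by blast
    have "flat \<Phi> j \<noteq> {}" "flat \<Phi> j \<noteq> flat \<Phi> (Suc j)" using d by auto
    then obtain n \<beta> where n: "hplane_in (flat \<Phi> (Suc j)) (flat \<Phi> j) n" "flat \<Phi> j = {x\<in>flat \<Phi> (Suc j). n \<bullet> x = \<beta>}"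
        "pos \<Phi> j = {x\<in>flat \<Phi> (Suc j). n \<bullet> x \<ge> \<beta>}"
      using halfspace_normal[OF d(3) h] by blast
    have "neg \<Phi> j = {x\<in>flat \<Phi> (Suc j). n \<bullet> x \<le> \<beta>}"
    proof -
      have "(flat \<Phi> (Suc j) - {x\<in>flat \<Phi> (Suc j). n \<bullet> x \<ge> \<beta>}) \<union> {x\<in>flat \<Phi> (Suc j). n \<bullet> x = \<beta>} = {x\<in>flat \<Phi> (Suc j). n \<bullet> x \<le> \<beta>}"
        by auto
      then show ?thesis unfolding neg_def n(3)[symmetric] n(2)[symmetric] .
    qed
    with n show ?thesis unfolding S_def by blast
  qed
  then obtain \<nu> where "\<And>j. j \<in> {r..<DIM('a)} \<Longrightarrow> S j (\<nu> j)" by metis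
  then show ?thesis using assms unfolding normals_def is_flag_def S_def by blast
qed

lemma translate_halfspace:
  "(+) l ` {x\<in>V. P (n \<bullet> x)} = {x\<in>(+) l ` V. P (n \<bullet> x - n \<bullet> (l::'a::euclidean_space))}"
  by (auto simp: image_iff inner_add_right)

lemma hplane_in_translate:
  assumes "hplane_in V W n" shows "hplane_in ((+) l ` V) ((+) l ` W) n"
proof -
  obtain \<beta> where W: "W = {x\<in>V. n \<bullet> x = \<beta>}" using assms by (auto simp: hplane_in_def)
  have "(+) l ` W = {x\<in>(+) l ` V. n \<bullet> x = \<beta> + n \<bullet> l}"
    unfolding W translate_halfspace by (auto simp: algebra_simps)
  moreover have "affine ((+) l ` V)" using assms affine_translation[of V l] by (simp add: hplane_in_def)
  ultimately show ?thesis using assms unfolding hplane_in_def by auto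
qed

lemma flat_translate: "j \<in> {r..DIM('a)} \<Longrightarrow> flat (translate_flag r l (\<Phi>::'a::euclidean_space flag)) j = (+) l ` flat \<Phi> j"
  and pos_translate: "j \<in> {r..<DIM('a)} \<Longrightarrow> pos (translate_flag r l (\<Phi>::'a::euclidean_space flag)) j = (+) l ` pos \<Phi> j"
  by (auto simp: translate_flag_def)

lemma neg_translate: "j \<in> {r..<DIM('a)} \<Longrightarrow> neg (translate_flag r l (\<Phi>::'a::euclidean_space flag)) j = (+) l ` neg \<Phi> j"
  by (simp add: neg_def flat_translate pos_translate image_Un image_set_diff)

lemma normals_translate:
  fixes \<Phi> :: "'a::euclidean_space flag"
  assumes "normals r \<Phi> \<nu>"
  shows "normals r (translate_flag r l \<Phi>) \<nu>"
  unfolding normals_def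
proof (intro conjI ballI)
  show "r \<le> DIM('a)" using assms by (simp add: normals_def)
  then show "flat (translate_flag r l \<Phi>) DIM('a) = UNIV" using assms by (simp add: normals_def flat_translate)
  fix j assume j: "j \<in> {r..<DIM('a)}"
  note f = flat_translate[of j r l \<Phi>] flat_translate[of "Suc j" r l \<Phi>] pos_translate[OF j, of l \<Phi>] neg_translate[OF j, of l \<Phi>]
  have a: "hplane_in (flat \<Phi> (Suc j)) (flat \<Phi> j) (\<nu> j)" using assms j by (auto simp: normals_def)
  then show "hplane_in (flat (translate_flag r l \<Phi>) (Suc j)) (flat (translate_flag r l \<Phi>) j) (\<nu> j)"
    using f j hplane_in_translate by auto
  obtain \<beta> where b: "flat \<Phi> j = {x\<in>flat \<Phi> (Suc j). \<nu> j \<bullet> x = \<beta>}" "pos \<Phi> j = {x\<in>flat \<Phi> (Suc j). \<nu> j \<bullet> x \<ge> \<beta>}"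
          "neg \<Phi> j = {x\<in>flat \<Phi> (Suc j). \<nu> j \<bullet> x \<le> \<beta>}"
    using assms j unfolding normals_def by blast
  have "(+) l ` flat \<Phi> j = {x\<in>(+) l ` flat \<Phi> (Suc j). \<nu> j \<bullet> x = \<beta> + \<nu> j \<bullet> l}"
    by (subst b(1), subst translate_halfspace) (auto simp: algebra_simps)
  moreover have "(+) l ` pos \<Phi> j = {x\<in>(+) l ` flat \<Phi> (Suc j). \<nu> j \<bullet> x \<ge> \<beta> + \<nu> j \<bullet> l}"
    by (subst b(2), subst translate_halfspace) (auto simp: algebra_simps)
  moreover have "(+) l ` neg \<Phi> j = {x\<in>(+) l ` flat \<Phi> (Suc j). \<nu> j \<bullet> x \<le> \<beta> + \<nu> j \<bullet> l}"
    by (subst b(3), subst translate_halfspace) (auto simp: algebra_simps)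
  ultimately show "\<exists>\<beta>. flat (translate_flag r l \<Phi>) j = {x\<in>flat (translate_flag r l \<Phi>) (Suc j). \<nu> j \<bullet> x = \<beta>}
          \<and> pos (translate_flag r l \<Phi>) j = {x\<in>flat (translate_flag r l \<Phi>) (Suc j). \<nu> j \<bullet> x \<ge> \<beta>}
          \<and> neg (translate_flag r l \<Phi>) j = {x\<in>flat (translate_flag r l \<Phi>) (Suc j). \<nu> j \<bullet> x \<le> \<beta>}"
    using f j by (intro exI[of _ "\<beta> + \<nu> j \<bullet> l"]) auto
qed

section \<open>Chains of faces\<close>

definition facets_at :: "'a::euclidean_space flag \<Rightarrow> nat \<Rightarrow> 'a set \<Rightarrow> 'a set set" where
  "facets_at \<Phi> j P = facets_on P (flat \<Phi> j) (pos \<Phi> j) \<union> facets_on P (flat \<Phi> j) (neg \<Phi> j)"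

definition flag_chains :: "'a::euclidean_space flag \<Rightarrow> nat \<Rightarrow> nat \<Rightarrow> 'a set \<Rightarrow> (nat \<Rightarrow> 'a set) set" where
  "flag_chains \<Phi> r m P = {F \<in> extensional {r..r+m}. F (r + m) = P \<and> (\<forall>j\<in>{r..<r+m}. F j \<in> facets_at \<Phi> j (F (Suc j)))}"

definition facet_sign :: "'a::euclidean_space flag \<Rightarrow> nat \<Rightarrow> 'a set \<Rightarrow> 'a set \<Rightarrow> real" where
  "facet_sign \<Phi> j P G = (if G \<in> facets_on P (flat \<Phi> j) (pos \<Phi> j) then 1 else - 1)"

fun chain_sum :: "'a::euclidean_space flag \<Rightarrow> nat \<Rightarrow> nat \<Rightarrow> 'a set \<Rightarrow> real" where
  "chain_sum \<Phi> r 0 P = flat_volume r (flat \<Phi> r) P"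
| "chain_sum \<Phi> r (Suc m) P = (\<Sum>G\<in>facets_at \<Phi> (r + m) P. facet_sign \<Phi> (r + m) P G * chain_sum \<Phi> r m G)"

lemma chains_0: "flag_chains \<Phi> r 0 P = {\<lambda>j. if j = r then P else undefined}"
  by (auto simp: flag_chains_def extensional_def fun_eq_iff)

lemma chains_Suc:
  "flag_chains \<Phi> r (Suc m) P = (\<Union>G\<in>facets_at \<Phi> (r + m) P. (\<lambda>F. F(r + Suc m := P)) ` flag_chains \<Phi> r m G)"
proof (intro equalityI subsetI)
  fix F assume F: "F \<in> flag_chains \<Phi> r (Suc m) P"
  define F' where "F' = F(r + Suc m := undefined)"
  have "F' \<in> flag_chains \<Phi> r m (F (r + m))" "F (r + m) \<in> facets_at \<Phi> (r + m) P" "F = F'(r + Suc m := P)"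
    using F by (auto simp: flag_chains_def F'_def extensional_def fun_eq_iff)
  then show "F \<in> (\<Union>G\<in>facets_at \<Phi> (r + m) P. (\<lambda>F. F(r + Suc m := P)) ` flag_chains \<Phi> r m G)" by blast
next
  fix F assume "F \<in> (\<Union>G\<in>facets_at \<Phi> (r + m) P. (\<lambda>F. F(r + Suc m := P)) ` flag_chains \<Phi> r m G)"
  then obtain G F' where G: "G \<in> facets_at \<Phi> (r + m) P" "F' \<in> flag_chains \<Phi> r m G" "F = F'(r + Suc m := P)" by blast
  then show "F \<in> flag_chains \<Phi> r (Suc m) P"
    by (auto simp: flag_chains_def extensional_def less_Suc_eq)
qed

text \<open>A chain is its top entry \<open>P\<close> followed by a chain below some facet
  \<open>G\<close> of \<open>P\<close>. Only the top sign depends on \<open>P\<close>, so it factors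
  out of the sum over the chains below \<open>G\<close>.\<close>

lemma chains_sum:
  fixes \<Phi> :: "'a::euclidean_space flag"
  assumes "normals r \<Phi> \<nu>" "r + m \<le> DIM('a)" "polyhedral H (flat \<Phi> (r + m)) P"
  shows "finite (flag_chains \<Phi> r m P) \<and> (\<Sum>F\<in>flag_chains \<Phi> r m P. (\<Prod>j\<in>{r..<r+m}. side_sign \<Phi> F j) * flat_volume r (flat \<Phi> r) (F r)) = chain_sum \<Phi> r m P"
  using assms(2,3)
proof (induction m arbitrary: P)
  case 0
  then show ?case by (simp add: chains_0)
next
  case (Suc m)
  define j where "j = r + m"
  have jr: "j \<in> {r..<DIM('a)}" using Suc by (auto simp: j_def)
  obtain \<beta> where hp: "hplane_in (flat \<Phi> (Suc j)) (flat \<Phi> j) (\<nu> j)" "flat \<Phi> j = {x\<in>flat \<Phi> (Suc j). \<nu> j \<bullet> x = \<beta>}"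
    "pos \<Phi> j = {x\<in>flat \<Phi> (Suc j). \<nu> j \<bullet> x \<ge> \<beta>}"
          "neg \<Phi> j = {x\<in>flat \<Phi> (Suc j). \<nu> j \<bullet> x \<le> \<beta>}" using assms(1) jr unfolding normals_def by blast
  have P: "polyhedral H (flat \<Phi> (Suc j)) P" using Suc.prems by (simp add: j_def)
  note jf = jump_facets[OF hp(1) P hp(2,3,4)]
  have fin: "finite (facets_at \<Phi> j P)" using jf(2,3) by (simp add: facets_at_def)
  have pG: "polyhedral H (flat \<Phi> j) G" if "G \<in> facets_at \<Phi> j P" for G using jf(5) that by (auto simp: facets_at_def)
  have IH: "finite (flag_chains \<Phi> r m G)" "(\<Sum>F\<in>flag_chains \<Phi> r m G. (\<Prod>j\<in>{r..<r+m}. side_sign \<Phi> F j) * flat_volume r (flat \<Phi> r) (F r)) = chain_sum \<Phi> r m G" if "G \<in> facets_at \<Phi> j P" for G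
    using Suc.IH[of G] Suc.prems(1) pG[OF that] by (auto simp: j_def)
  let ?u = "\<lambda>F. F(r + Suc m := P)"
  have cG: "F (r + m) = G" "F (r + Suc m) = undefined" if "F \<in> flag_chains \<Phi> r m G" for F G
    using that by (auto simp: flag_chains_def extensional_def)
  have inj: "inj_on ?u (flag_chains \<Phi> r m G)" for G
    by (rule inj_onI) (metis cG(2) fun_upd_triv fun_upd_upd)
  \<comment> \<open>The facet \<open>G\<close> is itself the entry \<open>r + m\<close> of the
    chain, so chains through different facets differ.\<close>
  have dis: "G = G'" if "?u ` flag_chains \<Phi> r m G \<inter> ?u ` flag_chains \<Phi> r m G' \<noteq> {}" for G G'
  proof -
    from that obtain F F' where "F \<in> flag_chains \<Phi> r m G" "F' \<in> flag_chains \<Phi> r m G'" "?u F = ?u F'" by blast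
    then show ?thesis using cG(1) by (metis add_left_cancel fun_upd_apply n_not_Suc_n)
  qed
  have "(\<Sum>F\<in>flag_chains \<Phi> r (Suc m) P. (\<Prod>j\<in>{r..<r+Suc m}. side_sign \<Phi> F j) * flat_volume r (flat \<Phi> r) (F r))
    = (\<Sum>G\<in>facets_at \<Phi> j P. \<Sum>F\<in>?u ` flag_chains \<Phi> r m G. (\<Prod>j\<in>{r..<r+Suc m}. side_sign \<Phi> F j) * flat_volume r (flat \<Phi> r) (F r))"
    unfolding chains_Suc j_def[symmetric]
  proof (rule sum.UNION_disjoint)
    show "\<forall>G\<in>facets_at \<Phi> j P. \<forall>G'\<in>facets_at \<Phi> j P. G \<noteq> G' \<longrightarrow> ?u ` flag_chains \<Phi> r m G \<inter> ?u ` flag_chains \<Phi> r m G' = {}"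
      using dis by blast
  qed (use fin IH(1) in auto)
  also have "\<dots> = (\<Sum>G\<in>facets_at \<Phi> j P. facet_sign \<Phi> j P G * chain_sum \<Phi> r m G)"
  proof (rule sum.cong[OF refl])
    fix G assume G: "G \<in> facets_at \<Phi> j P"
    have "(\<Sum>F\<in>?u ` flag_chains \<Phi> r m G. (\<Prod>j\<in>{r..<r+Suc m}. side_sign \<Phi> F j) * flat_volume r (flat \<Phi> r) (F r))
      = (\<Sum>F\<in>flag_chains \<Phi> r m G. (\<Prod>j\<in>{r..<r+Suc m}. side_sign \<Phi> (?u F) j) * flat_volume r (flat \<Phi> r) (?u F r))"
      by (subst sum.reindex[OF inj]) simp
    also have "\<dots> = (\<Sum>F\<in>flag_chains \<Phi> r m G. facet_sign \<Phi> j P G * ((\<Prod>j\<in>{r..<r+m}. side_sign \<Phi> F j) * flat_volume r (flat \<Phi> r) (F r)))"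
    proof (rule sum.cong[OF refl])
      fix F assume F: "F \<in> flag_chains \<Phi> r m G"
      have "(\<Prod>j\<in>{r..<r+Suc m}. side_sign \<Phi> (?u F) j) = (\<Prod>j\<in>{r..<r+m}. side_sign \<Phi> (?u F) j) * side_sign \<Phi> (?u F) (r + m)"
        by simp
      also have "(\<Prod>j\<in>{r..<r+m}. side_sign \<Phi> (?u F) j) = (\<Prod>j\<in>{r..<r+m}. side_sign \<Phi> F j)"
        by (rule prod.cong) (auto simp: side_sign_def)
      also have "side_sign \<Phi> (?u F) (r + m) = facet_sign \<Phi> j P G" using cG(1)[OF F] by (simp add: side_sign_def facet_sign_def j_def)
      finally have e: "(\<Prod>j\<in>{r..<r+Suc m}. side_sign \<Phi> (?u F) j) = (\<Prod>j\<in>{r..<r+m}. side_sign \<Phi> F j) * facet_sign \<Phi> j P G" .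
      show "(\<Prod>j\<in>{r..<r+Suc m}. side_sign \<Phi> (?u F) j) * flat_volume r (flat \<Phi> r) (?u F r) =
        facet_sign \<Phi> j P G * ((\<Prod>j\<in>{r..<r+m}. side_sign \<Phi> F j) * flat_volume r (flat \<Phi> r) (F r))"
        unfolding e by simp
    qed
    also have "\<dots> = facet_sign \<Phi> j P G * chain_sum \<Phi> r m G" using IH(2)[OF G] by (simp flip: sum_distrib_left)
    finally show "(\<Sum>F\<in>?u ` flag_chains \<Phi> r m G. (\<Prod>j\<in>{r..<r+Suc m}. side_sign \<Phi> F j) * flat_volume r (flat \<Phi> r) (F r))
      = facet_sign \<Phi> j P G * chain_sum \<Phi> r m G" .
  qed
  also have "\<dots> = chain_sum \<Phi> r (Suc m) P" by (simp add: j_def)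
  finally have "(\<Sum>F\<in>flag_chains \<Phi> r (Suc m) P. (\<Prod>j\<in>{r..<r+Suc m}. side_sign \<Phi> F j) * flat_volume r (flat \<Phi> r) (F r)) = chain_sum \<Phi> r (Suc m) P" .
  moreover have "finite (flag_chains \<Phi> r (Suc m) P)" unfolding chains_Suc using fin IH(1) by (auto simp: j_def)
  ultimately show ?case by simp
qed

lemma flag_weight_chain_sum:
  fixes \<Phi> :: "'a::euclidean_space flag"
  assumes "normals r \<Phi> \<nu>" "polyhedral H UNIV P"
  shows "flag_weight r \<Phi> P = chain_sum \<Phi> r (DIM('a) - r) P"
proof -
  have r: "r + (DIM('a) - r) = DIM('a)" "flat \<Phi> DIM('a) = UNIV" using assms by (auto simp: normals_def)
  have "face_chains r \<Phi> P = flag_chains \<Phi> r (DIM('a) - r) P"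
    unfolding face_chains_def flag_chains_def facets_at_def r(1) ..
  then show ?thesis using chains_sum[OF assms(1), of "DIM('a) - r" H P] assms(2) r
    by (simp add: flag_weight_def)
qed

section \<open>Volume on flats\<close>

text \<open>Fubini for \<open>\<integral>\<integral> 1\<^sub>A(x) 1\<^sub>B(x + y)\<close>, after shifting \<open>y\<close> by \<open>-x\<close> on one side and \<open>x\<close> by \<open>-y\<close> on the other.\<close>

lemma translation_invariant_proportional:
  fixes M :: "'a::euclidean_space measure"
  assumes [measurable_cong]: "sets M = sets borel" and "sigma_finite_measure M"
    and inv: "\<And>c. distr M borel ((+) c) = M"
    and A[measurable]: "A \<in> sets borel" and B[measurable]: "B \<in> sets borel"
  shows "emeasure M A * emeasure lborel B = emeasure lborel A * emeasure M B"
proof -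
  interpret M: sigma_finite_measure M by fact
  interpret pair_sigma_finite M lborel by unfold_locales
  have shiftM: "(\<integral>\<^sup>+x. f x \<partial>M) = (\<integral>\<^sup>+x. f (c + x) \<partial>M)" if [measurable]: "f \<in> borel_measurable borel" for f :: "'a \<Rightarrow> ennreal" and c
    using nn_integral_distr[of "(+) c" M borel f] unfolding inv by simp
  have shiftL: "(\<integral>\<^sup>+x. f x \<partial>lborel) = (\<integral>\<^sup>+x. f (c + x) \<partial>lborel)" if [measurable]: "f \<in> borel_measurable borel" for f :: "'a \<Rightarrow> ennreal" and c
    using nn_integral_distr[of "(+) c" lborel borel f] unfolding lborel_distr_plus by simp
  have refl: "(\<integral>\<^sup>+x. f x \<partial>lborel) = (\<integral>\<^sup>+x. f (c - x) \<partial>lborel)" if [measurable]: "f \<in> borel_measurable borel" for f :: "'a \<Rightarrow> ennreal" and c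
  proof -
    have "lborel = distr lborel borel (\<lambda>x::'a. c + (-1) *\<^sub>R x)"
      using lborel_affine[of "-1" c] by (simp add: density_1)
    then have "(\<integral>\<^sup>+x. f x \<partial>lborel) = (\<integral>\<^sup>+x. f x \<partial>distr lborel borel (\<lambda>x::'a. c + (-1) *\<^sub>R x))" by simp
    also have "\<dots> = (\<integral>\<^sup>+x. f (c - x) \<partial>lborel)" by (subst nn_integral_distr) auto
    finally show ?thesis .
  qed
  have "emeasure M A * emeasure lborel B = (\<integral>\<^sup>+x. indicator A x * (\<integral>\<^sup>+y. indicator B y \<partial>lborel) \<partial>M)"
    by (simp add: nn_integral_multc)
  also have "\<dots> = (\<integral>\<^sup>+x. (\<integral>\<^sup>+y. indicator A x * indicator B (x + y) \<partial>lborel) \<partial>M)"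
  proof (intro nn_integral_cong)
    fix x
    show "indicator A x * (\<integral>\<^sup>+y. indicator B y \<partial>lborel) = (\<integral>\<^sup>+y. indicator A x * indicator B (x + y) \<partial>lborel)"
      by (subst shiftL[of _ x]) (auto simp: nn_integral_cmult)
  qed
  also have "\<dots> = (\<integral>\<^sup>+y. (\<integral>\<^sup>+x. indicator A x * indicator B (x + y) \<partial>M) \<partial>lborel)"
    by (rule Fubini'[symmetric]) measurable
  also have "\<dots> = (\<integral>\<^sup>+y. (\<integral>\<^sup>+x. indicator A (x - y) * indicator B x \<partial>M) \<partial>lborel)"
  proof (rule nn_integral_cong)
    fix y :: 'a
    have "(\<integral>\<^sup>+x. indicator A (x - y) * indicator B x \<partial>M) = (\<integral>\<^sup>+x. indicator A (y + x - y) * indicator B (y + x) \<partial>M)"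
      by (rule shiftM) measurable
    then show "(\<integral>\<^sup>+x. indicator A x * indicator B (x + y) \<partial>M) = (\<integral>\<^sup>+x. indicator A (x - y) * indicator B x \<partial>M)"
      by (simp add: add.commute)
  qed
  also have "\<dots> = (\<integral>\<^sup>+x. (\<integral>\<^sup>+y. indicator A (x - y) * indicator B x \<partial>lborel) \<partial>M)"
    by (rule Fubini') measurable
  also have "\<dots> = (\<integral>\<^sup>+x. emeasure lborel A * indicator B x \<partial>M)"
  proof (intro nn_integral_cong)
    fix x
    show "(\<integral>\<^sup>+y. indicator A (x - y) * indicator B x \<partial>lborel) = emeasure lborel A * indicator B x"
      using refl[of "indicator A" x] by (simp add: nn_integral_multc)
  qed
  also have "\<dots> = emeasure lborel A * emeasure M B" by (simp add: nn_integral_cmult)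
  finally show ?thesis .
qed

interpretation lborel_product: product_sigma_finite "\<lambda>_::nat. lborel :: real measure"
  by standard

section \<open>Orthonormal frames\<close>

definition orthonormal :: "nat \<Rightarrow> (nat \<Rightarrow> 'a::euclidean_space) \<Rightarrow> bool" where
  "orthonormal r b \<longleftrightarrow> (\<forall>i<r. \<forall>j<r. b i \<bullet> b j = (if i = j then 1 else 0))"

lemma frame_coords_measurable [measurable]:
  "frame_coords r p b \<in> PiM {..<r} (\<lambda>_. lborel) \<rightarrow>\<^sub>M borel"
  unfolding frame_coords_def[abs_def] by measurable

lemma PiM_lborel_translate:
  "distr (PiM {..<r::nat} (\<lambda>_. lborel)) (PiM {..<r} (\<lambda>_. lborel)) (\<lambda>z. \<lambda>i\<in>{..<r}. s i + z i) = PiM {..<r} (\<lambda>_. lborel :: real measure)"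
proof (rule lborel_product.PiM_eqI)
  fix A assume A: "\<And>i. i \<in> {..<r} \<Longrightarrow> A i \<in> sets (lborel :: real measure)"
  have m[measurable]: "(\<lambda>z. \<lambda>i\<in>{..<r}. s i + z i) \<in> PiM {..<r} (\<lambda>_. lborel) \<rightarrow>\<^sub>M PiM {..<r} (\<lambda>_. lborel :: real measure)"
    by measurable
  have A': "(+) (s i) -` A i \<in> sets lborel" if "i < r" for i
    using measurable_sets[of "(+) (s i)" lborel lborel "A i"] A that by (simp add: space_lborel)
  have "(\<lambda>z. \<lambda>i\<in>{..<r}. s i + z i) -` PiE {..<r} A \<inter> space (PiM {..<r} (\<lambda>_. lborel)) = PiE {..<r} (\<lambda>i. (+) (s i) -` A i)"
    by (auto simp: space_PiM PiE_iff)
  then have "emeasure (distr (PiM {..<r} (\<lambda>_. lborel)) (PiM {..<r} (\<lambda>_. lborel)) (\<lambda>z. \<lambda>i\<in>{..<r}. s i + z i)) (PiE {..<r} A) =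
     (\<Prod>i<r. emeasure lborel ((+) (s i) -` A i))"
    using A A' by (subst emeasure_distr) (auto intro!: lborel_product.emeasure_PiM sets_PiM_I_finite)
  also have "\<dots> = (\<Prod>i<r. emeasure lborel (A i))"
  proof (rule prod.cong[OF refl])
    fix i assume "i \<in> {..<r}"
    then have "A i \<in> sets borel" using A by simp
    then have "emeasure (distr lborel borel ((+) (s i))) (A i) = emeasure lborel ((+) (s i) -` A i)"
      by (subst emeasure_distr) auto
    then show "emeasure lborel ((+) (s i) -` A i) = emeasure lborel (A i)" by (simp add: lborel_distr_plus)
  qed
  finally show "emeasure (distr (PiM {..<r} (\<lambda>_. lborel)) (PiM {..<r} (\<lambda>_. lborel)) (\<lambda>z. \<lambda>i\<in>{..<r}. s i + z i)) (PiE {..<r} A) =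
     (\<Prod>i<r. emeasure lborel (A i))" .
qed auto

lemma orthonormal_inner:
  assumes "orthonormal d c" "finite I" "I \<subseteq> {..<d}" "i < d"
  shows "c i \<bullet> (\<Sum>j\<in>I. x j *\<^sub>R c j) = (if i \<in> I then x i else 0)"
proof -
  have "c i \<bullet> (\<Sum>j\<in>I. x j *\<^sub>R c j) = (\<Sum>j\<in>I. if i = j then x j else 0)"
    unfolding inner_sum_right using assms by (intro sum.cong refl) (auto simp: orthonormal_def subset_iff)
  then show ?thesis using assms(2) by (simp add: sum.delta)
qed

lemma orthonormal_norm:
  assumes "orthonormal d c" "finite I" "I \<subseteq> {..<d}"
  shows "(norm (\<Sum>j\<in>I. x j *\<^sub>R c j))\<^sup>2 = (\<Sum>j\<in>I. (x j)\<^sup>2)"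
proof -
  have "(norm (\<Sum>j\<in>I. x j *\<^sub>R c j))\<^sup>2 = (\<Sum>i\<in>I. x i * (c i \<bullet> (\<Sum>j\<in>I. x j *\<^sub>R c j)))"
    by (simp add: power2_norm_eq_inner inner_sum_left)
  also have "\<dots> = (\<Sum>j\<in>I. (x j)\<^sup>2)"
    by (intro sum.cong refl) (use assms orthonormal_inner[OF assms] in \<open>auto simp: power2_eq_square\<close>)
  finally show ?thesis .
qed

lemma orthonormal_independent:
  assumes "orthonormal r b"
  shows "inj_on b {..<r}" "independent (b ` {..<r})" "pairwise orthogonal (b ` {..<r})" "\<And>v. v \<in> b ` {..<r} \<Longrightarrow> norm v = 1"
proof -
  show "inj_on b {..<r}" using assms by (auto simp: inj_on_def orthonormal_def) (metis zero_neq_one)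
  show o: "pairwise orthogonal (b ` {..<r})" using assms by (auto simp: pairwise_def orthogonal_def orthonormal_def)
  show n: "\<And>v. v \<in> b ` {..<r} \<Longrightarrow> norm v = 1" using assms by (auto simp: orthonormal_def norm_eq_1)
  show "independent (b ` {..<r})" using o n by (intro pairwise_orthogonal_independent) force+
qed

lemma orthonormal_expand:
  assumes "orthonormal r b" "x \<in> span (b ` {..<r})"
  shows "x = (\<Sum>i<r. (x \<bullet> b i) *\<^sub>R b i)"
proof -
  have "(\<Sum>v\<in>b ` {..<r}. (x \<bullet> v) *\<^sub>R v) = x"
    using orthonormal_independent(3,4)[OF assms(1)] assms(2) by (intro orthonormal_basis_expand) auto
  then show ?thesis using sum.reindex[OF orthonormal_independent(1)[OF assms(1)], of "\<lambda>v. (x \<bullet> v) *\<^sub>R v"] by simp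
qed

lemma orthonormal_full_expand:
  assumes "orthonormal DIM('a) (b :: nat \<Rightarrow> 'a::euclidean_space)"
  shows "x = (\<Sum>i<DIM('a). (x \<bullet> b i) *\<^sub>R b i)"
proof (rule orthonormal_expand[OF assms])
  note o = orthonormal_independent[OF assms]
  have "card (b ` {..<DIM('a)}) = DIM('a)" using o(1) by (simp add: card_image)
  then have "span (b ` {..<DIM('a)}) = UNIV"
    using o(2) card_ge_dim_independent[of "b ` {..<DIM('a)}" UNIV] by (auto simp: dim_UNIV)
  then show "x \<in> span (b ` {..<DIM('a)})" by simp
qed

text \<open>The unit ball in the coordinates \<open>J\<close>. For empty \<open>J\<close> it is the
  one-point space of measure 1, which covers flats of full dimension.\<close>

definition sq_ball :: "nat set \<Rightarrow> (nat \<Rightarrow> real) set" where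
  "sq_ball J = {x \<in> J \<rightarrow>\<^sub>E UNIV. (\<Sum>i\<in>J. (x i)\<^sup>2) \<le> 1}"

lemma sq_ball_sets [measurable]: "finite J \<Longrightarrow> sq_ball J \<in> sets (PiM J (\<lambda>_. lborel))"
proof -
  assume [simp]: "finite J"
  have "{x \<in> space (PiM J (\<lambda>_. lborel :: real measure)). (\<Sum>i\<in>J. (x i)\<^sup>2) \<le> 1} \<in> sets (PiM J (\<lambda>_. lborel))"
    by measurable
  then show ?thesis by (simp add: sq_ball_def space_PiM)
qed

lemma sq_ball_measure:
  assumes "finite J"
  shows "emeasure (PiM J (\<lambda>_. lborel)) (sq_ball J) < \<infinity>" "emeasure (PiM J (\<lambda>_. lborel)) (sq_ball J) > 0"
proof -
  have "sq_ball J \<subseteq> PiE J (\<lambda>_. {-1..1})"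
  proof
    fix x assume x: "x \<in> sq_ball J"
    have "x i \<in> {-1..1}" if "i \<in> J" for i
    proof -
      have "(x i)\<^sup>2 \<le> (\<Sum>i\<in>J. (x i)\<^sup>2)" using assms that by (intro member_le_sum) auto
      then have "(x i)\<^sup>2 \<le> 1" using x by (simp add: sq_ball_def)
      then show ?thesis by (simp add: abs_square_le_1 abs_le_iff)
    qed
    then show "x \<in> PiE J (\<lambda>_. {-1..1})" using x by (auto simp: sq_ball_def PiE_iff)
  qed
  then have "emeasure (PiM J (\<lambda>_. lborel)) (sq_ball J) \<le> emeasure (PiM J (\<lambda>_. lborel)) (PiE J (\<lambda>_. {-1..1::real}))"
    by (rule emeasure_mono) (use assms in \<open>auto intro!: sets_PiM_I_finite\<close>)
  also have "\<dots> = (\<Prod>i\<in>J. emeasure lborel {-1..1::real})"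
    using assms by (intro lborel_product.emeasure_PiM) auto
  also have "\<dots> < \<infinity>" by (simp add: power_eq_top_ennreal less_top[symmetric])
  finally show "emeasure (PiM J (\<lambda>_. lborel)) (sq_ball J) < \<infinity>" .
  \<comment> \<open>Small enough that a cube of this side fits into the ball, by \<open>card J *
    \<epsilon>\<^sup>2 \<le> card J * \<epsilon> \<le> 1\<close>; the summand 1 covers empty
    \<open>J\<close>.\<close>
  define \<epsilon> :: real where "\<epsilon> = 1 / (real (card J) + 1)"
  have e: "\<epsilon> > 0" "\<epsilon> \<le> 1" by (auto simp: \<epsilon>_def)
  have "PiE J (\<lambda>_. {0..\<epsilon>}) \<subseteq> sq_ball J"
  proof
    fix x assume x: "x \<in> PiE J (\<lambda>_. {0..\<epsilon>})"
    have "(\<Sum>i\<in>J. (x i)\<^sup>2) \<le> (\<Sum>i\<in>J. \<epsilon>\<^sup>2)"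
      using x by (intro sum_mono power_mono) (auto simp: PiE_iff)
    also have "\<dots> = real (card J) * \<epsilon>\<^sup>2" by simp
    also have "\<dots> \<le> real (card J) * \<epsilon>" using e by (intro mult_left_mono) (auto simp: power2_eq_square intro: mult_left_le)
    also have "\<dots> \<le> 1" by (simp add: \<epsilon>_def)
    finally show "x \<in> sq_ball J" using x by (auto simp: sq_ball_def PiE_iff)
  qed
  then have "emeasure (PiM J (\<lambda>_. lborel)) (PiE J (\<lambda>_. {0..\<epsilon>})) \<le> emeasure (PiM J (\<lambda>_. lborel)) (sq_ball J)"
    using assms by (intro emeasure_mono) auto
  moreover have "emeasure (PiM J (\<lambda>_. lborel)) (PiE J (\<lambda>_. {0..\<epsilon>})) = (\<Prod>i\<in>J. emeasure lborel {0..\<epsilon>})"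
    using assms by (intro lborel_product.emeasure_PiM) auto
  moreover have "(\<Prod>i\<in>J. emeasure lborel {0..\<epsilon>}) > 0" using e assms by (simp add: ennreal_power prod_constant)
  ultimately show "emeasure (PiM J (\<lambda>_. lborel)) (sq_ball J) > 0" by simp
qed

text \<open>The image of the product measure under an orthonormal frame is invariant under
  translations, hence proportional to Lebesgue measure. The factor is read off from the unit ball
  and is kept as a quotient of two ball volumes.\<close>

lemma orthonormal_distr_proportional:
  fixes p :: "'a::euclidean_space"
  assumes o: "orthonormal DIM('a) c" and [measurable]: "E \<in> sets borel"
  shows "emeasure (distr (PiM {..<DIM('a)} (\<lambda>_. lborel)) borel (frame_coords DIM('a) p c)) E * emeasure lborel (cball (0::'a) 1)
    = emeasure lborel E * emeasure (PiM {..<DIM('a)} (\<lambda>_. lborel)) (sq_ball {..<DIM('a)})"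
proof -
  let ?P = "PiM {..<DIM('a)} (\<lambda>_. lborel :: real measure)" and ?T = "frame_coords DIM('a) p c"
  define M where "M = distr ?P borel ?T"
  have sM: "sets M = sets borel" by (simp add: M_def)
  have nT: "(norm (?T x - p))\<^sup>2 = (\<Sum>j<DIM('a). (x j)\<^sup>2)" for x
    using orthonormal_norm[OF o, of "{..<DIM('a)}" x] by (simp add: frame_coords_def)
  have xi: "\<bar>x i\<bar> \<le> norm (?T x - p)" if "i < DIM('a)" for x i
  proof -
    have "(x i)\<^sup>2 \<le> (\<Sum>j<DIM('a). (x j)\<^sup>2)" using that by (intro member_le_sum) auto
    then have "\<bar>x i\<bar>\<^sup>2 \<le> (norm (?T x - p))\<^sup>2" by (simp add: nT)
    then show ?thesis by (simp add: abs_le_square_iff[symmetric])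
  qed
  have inv: "distr M borel ((+) v) = M" for v
  proof -
    define s where "s i = v \<bullet> c i" for i
    have "distr M borel ((+) v) = distr ?P borel ((+) v \<circ> ?T)"
      unfolding M_def by (subst distr_distr) auto
    also have "\<dots> = distr ?P borel (?T \<circ> (\<lambda>z. \<lambda>i\<in>{..<DIM('a)}. s i + z i))"
    proof (rule distr_cong[OF refl refl])
      fix x
      have "v = (\<Sum>i<DIM('a). s i *\<^sub>R c i)" using orthonormal_full_expand[OF o, of v] by (simp add: s_def)
      then show "((+) v \<circ> ?T) x = (?T \<circ> (\<lambda>z. \<lambda>i\<in>{..<DIM('a)}. s i + z i)) x"
        by (simp add: frame_coords_def scaleR_add_left sum.distrib)
    qed
    also have "\<dots> = distr (distr ?P ?P (\<lambda>z. \<lambda>i\<in>{..<DIM('a)}. s i + z i)) borel ?T"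
      by (subst distr_distr) auto
    also have "\<dots> = M" by (simp add: PiM_lborel_translate M_def)
    finally show ?thesis .
  qed
  have sf: "sigma_finite_measure M"
  proof (standard, intro exI conjI ballI)
    show "countable (range (\<lambda>n::nat. cball p (real n)))" by simp
    show "range (\<lambda>n::nat. cball p (real n)) \<subseteq> sets M" unfolding sM by (auto intro!: borel_closed)
    have "x \<in> cball p (real (nat \<lceil>dist p x\<rceil>))" for x by (simp add: real_nat_ceiling_ge)
    then show "\<Union> (range (\<lambda>n::nat. cball p (real n))) = space M" unfolding M_def by fastforce
    fix a assume "a \<in> range (\<lambda>n::nat. cball p (real n))"
    then obtain n :: nat where a: "a = cball p (real n)" by auto
    have "emeasure M a = emeasure ?P (?T -` a \<inter> space ?P)" unfolding M_def a by (subst emeasure_distr) auto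
    also have "\<dots> \<le> emeasure ?P (PiE {..<DIM('a)} (\<lambda>_. {- real n..real n}))"
    proof (rule emeasure_mono)
      show "?T -` a \<inter> space ?P \<subseteq> PiE {..<DIM('a)} (\<lambda>_. {- real n..real n})"
      proof
        fix x assume x: "x \<in> ?T -` a \<inter> space ?P"
        then have "norm (?T x - p) \<le> real n" by (simp add: a dist_norm norm_minus_commute)
        then have "x i \<in> {- real n..real n}" if "i < DIM('a)" for i using xi[OF that, of x] by (auto simp: abs_le_iff)
        then show "x \<in> PiE {..<DIM('a)} (\<lambda>_. {- real n..real n})" using x by (auto simp: space_PiM PiE_iff)
      qed
    qed (auto intro!: sets_PiM_I_finite)
    also have "\<dots> = (\<Prod>i<DIM('a). emeasure lborel {- real n..real n})"
      by (intro lborel_product.emeasure_PiM) auto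
    also have "\<dots> < \<infinity>" by (simp add: power_eq_top_ennreal less_top[symmetric])
    finally show "emeasure M a \<noteq> \<infinity>" by simp
  qed
  have ball: "emeasure M (cball p 1) = emeasure ?P (sq_ball {..<DIM('a)})"
  proof -
    have "?T -` cball p 1 \<inter> space ?P = sq_ball {..<DIM('a)}"
    proof -
      have "?T x \<in> cball p 1 \<longleftrightarrow> (\<Sum>j<DIM('a). (x j)\<^sup>2) \<le> 1" for x
        unfolding nT[symmetric] by (simp add: dist_norm norm_minus_commute abs_square_le_1)
      then show ?thesis by (auto simp: sq_ball_def space_PiM)
    qed
    then show ?thesis unfolding M_def by (subst emeasure_distr) auto
  qed
  have "emeasure lborel (cball p 1) = emeasure lborel (cball (0::'a) 1)"
  proof -
    have "emeasure (distr lborel borel ((+) p)) (cball p 1) = emeasure lborel ((+) p -` cball p 1)"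
      by (subst emeasure_distr) auto
    moreover have "(+) p -` cball p 1 = cball (0::'a) 1" by (auto simp: dist_norm)
    ultimately show ?thesis by (simp add: lborel_distr_plus)
  qed
  then show ?thesis
    using translation_invariant_proportional[OF sM sf inv, of E "cball p 1"] ball by (simp add: M_def)
qed

lemma dim_dirs:
  fixes V :: "'a::euclidean_space set"
  assumes "affine V" "aff_dim V = int r"
  shows "dim (dirs V) = r" "V \<noteq> {}"
proof -
  show "V \<noteq> {}" using assms(2) by auto
  then obtain p where p: "p \<in> V" by blast
  have "aff_dim V = int (dim ((\<lambda>x. x - p) ` V))" using p by (intro aff_dim_eq_dim_subtract hull_inc)
  then show "dim (dirs V) = r" using dirs_eq[OF assms(1) p] assms(2) by simp
qed

text \<open>Stated for any index set, as it also supplies the vectors numbered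
  \<open>{r..<DIM('a)}\<close> that complete a frame.\<close>

lemma orthonormal_enum:
  fixes S :: "'a::euclidean_space set"
  assumes "subspace S" "finite I" "card I = dim S"
  obtains b :: "'i \<Rightarrow> 'a" where "\<forall>i\<in>I. \<forall>j\<in>I. b i \<bullet> b j = (if i = j then 1 else 0)" "span (b ` I) = S" "b ` I \<subseteq> S"
proof -
  obtain B where B: "B \<subseteq> S" "pairwise orthogonal B" "\<And>x. x \<in> B \<Longrightarrow> norm x = 1" "independent B" "card B = dim S" "span B = S"
    using orthonormal_basis_subspace[OF assms(1)] by metis
  have "finite B" using B(4) independent_imp_finite by blast
  then obtain b where b: "bij_betw b I B" using assms B(5) by (metis finite_same_card_bij)
  show thesis
  proof (rule that[of b])
    show "\<forall>i\<in>I. \<forall>j\<in>I. b i \<bullet> b j = (if i = j then 1 else 0)"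
    proof (intro ballI)
      fix i j assume ij: "i \<in> I" "j \<in> I"
      then have m: "b i \<in> B" "b j \<in> B" and "b i = b j \<longleftrightarrow> i = j" using b by (auto simp: bij_betw_def inj_on_def)
      then show "b i \<bullet> b j = (if i = j then 1 else 0)"
        using B(2) B(3)[OF m(1)] by (auto simp: norm_eq_1 pairwise_def orthogonal_def)
    qed
  qed (use b B in \<open>auto simp: bij_betw_def\<close>)
qed

lemma frame_range:
  assumes "affine V" "p \<in> V" "orthonormal r b" "span (b ` {..<r}) = dirs V"
  shows "V = range (frame_coords r p b)"
proof (intro equalityI subsetI)
  fix x assume "x \<in> V"
  then have "x - p \<in> span (b ` {..<r})" using assms dirs_diff by auto
  from orthonormal_expand[OF assms(3) this]
  have "x = frame_coords r p b (\<lambda>i. (x - p) \<bullet> b i)" by (simp add: frame_coords_def algebra_simps)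
  then show "x \<in> range (frame_coords r p b)" by blast
next
  fix x assume "x \<in> range (frame_coords r p b)"
  then obtain z where x: "x = p + (\<Sum>i<r. z i *\<^sub>R b i)" by (auto simp: frame_coords_def)
  have "(\<Sum>i<r. z i *\<^sub>R b i) \<in> span (b ` {..<r})" by (intro span_sum span_scale span_base) auto
  then show "x \<in> V" using assms dirnD x by blast
qed

lemma frame_exists:
  assumes "affine V" "aff_dim V = int r"
  shows "\<exists>p b. is_frame r V p b"
proof -
  obtain p where p: "p \<in> V" using dim_dirs[OF assms] by blast
  have "subspace (dirs V)" using assms(1) p subspace_dirs by blast
  then obtain b where b: "\<forall>i\<in>{..<r}. \<forall>j\<in>{..<r}. b i \<bullet> b j = (if i = j then 1 else 0)" "span (b ` {..<r}) = dirs V"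
    using dim_dirs[OF assms] by (metis orthonormal_enum card_lessThan finite_lessThan)
  then have o: "orthonormal r b" by (auto simp: orthonormal_def)
  show ?thesis using frame_range[OF assms(1) p o b(2)] o unfolding is_frame_def orthonormal_def by blast
qed

lemma frame_dirs:
  assumes "is_frame r V p b" "affine V"
  shows "orthonormal r b" "p \<in> V" "dirs V = span (b ` {..<r})"
proof -
  show "orthonormal r b" using assms by (simp add: is_frame_def orthonormal_def)
  have V: "V = range (frame_coords r p b)" using assms by (simp add: is_frame_def)
  have "p = frame_coords r p b (\<lambda>_. 0)" by (simp add: frame_coords_def)
  then show p: "p \<in> V" using V by blast
  show "dirs V = span (b ` {..<r})"
  proof
    show "dirs V \<subseteq> span (b ` {..<r})"
    proof
      fix v assume "v \<in> dirs V"
      then have "p + v \<in> V" using p dirnD by blast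
      then obtain x where "p + v = p + (\<Sum>i<r. x i *\<^sub>R b i)" using V by (auto simp: frame_coords_def)
      then have "v = (\<Sum>i<r. x i *\<^sub>R b i)" by simp
      moreover have "(\<Sum>i<r. x i *\<^sub>R b i) \<in> span (b ` {..<r})" by (intro span_sum span_scale span_base) auto
      ultimately show "v \<in> span (b ` {..<r})" by simp
    qed
    have "b i \<in> dirs V" if "i < r" for i
    proof -
      have "frame_coords r p b (\<lambda>j. if i = j then 1 else 0) = p + b i"
        using that by (simp add: frame_coords_def if_distrib[of "\<lambda>c. c *\<^sub>R _"] sum.delta cong: if_cong)
      then have "p + b i \<in> V" using V by (metis rangeI)
      then show ?thesis using dirs_diff[OF assms(2) _ p] by force
    qed
    then have "b ` {..<r} \<subseteq> dirs V" by auto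
    then show "span (b ` {..<r}) \<subseteq> dirs V" using subspace_dirs[OF assms(2)] p span_minimal by blast
  qed
qed

lemma orthonormal_extend:
  fixes b :: "nat \<Rightarrow> 'a::euclidean_space"
  assumes "orthonormal r b"
  shows "r \<le> DIM('a) \<and> (\<exists>c. orthonormal DIM('a) c \<and> (\<forall>i<r. c i = b i))"
proof -
  define S where "S = span (b ` {..<r})"
  define C where "C = {y. \<forall>x\<in>S. orthogonal x y}"
  have dS: "dim S = r" unfolding S_def using orthonormal_independent[OF assms]
    by (simp add: dim_eq_card_independent card_image)
  have "dim {y \<in> UNIV. \<forall>x\<in>S. orthogonal x y} + dim S = dim (UNIV :: 'a set)"
    by (rule dim_subspace_orthogonal_to_vectors) (auto simp: S_def)
  then have dC: "dim C + r = DIM('a)" by (simp add: C_def dS)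
  have "subspace C" unfolding C_def by (auto simp: subspace_def orthogonal_clauses)
  then obtain e where e: "\<forall>i\<in>{r..<DIM('a)}. \<forall>j\<in>{r..<DIM('a)}. e i \<bullet> e j = (if i = j then 1 else 0)" "e ` {r..<DIM('a)} \<subseteq> C"
    using dC by (metis orthonormal_enum[of C "{r..<DIM('a)}"] card_atLeastLessThan finite_atLeastLessThan diff_add_inverse2)
  define c where "c i = (if i < r then b i else e i)" for i
  have be: "b i \<bullet> e j = 0" "e j \<bullet> b i = 0" if "i < r" "j \<in> {r..<DIM('a)}" for i j
  proof -
    have "b i \<in> S" using that by (auto simp: S_def intro: span_base)
    then show "b i \<bullet> e j = 0" using e(2) that unfolding C_def orthogonal_def by blast
    then show "e j \<bullet> b i = 0" by (simp add: inner_commute)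
  qed
  have "orthonormal DIM('a) c" unfolding orthonormal_def
  proof (intro allI impI)
    fix i j assume "i < DIM('a)" "j < DIM('a)"
    then show "c i \<bullet> c j = (if i = j then 1 else 0)"
      using e(1) be assms by (auto simp: c_def orthonormal_def)
  qed
  then show ?thesis using dC by (auto simp: c_def)
qed

section \<open>Orthogonal projection and tubes\<close>

definition prj :: "'a::euclidean_space set \<Rightarrow> 'a \<Rightarrow> 'a" where
  "prj V x = (THE y. y \<in> V \<and> (\<forall>v\<in>dirs V. v \<bullet> (x - y) = 0))"

lemma prj_eqI:
  assumes "affine V" "y \<in> V" "\<And>v. v \<in> dirs V \<Longrightarrow> v \<bullet> (x - y) = 0"
  shows "prj V x = y"
  unfolding prj_def
proof (rule the_equality)
  fix z assume z: "z \<in> V \<and> (\<forall>v\<in>dirs V. v \<bullet> (x - z) = 0)"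
  then have "z - y \<in> dirs V" using assms dirs_diff by blast
  then have "(z - y) \<bullet> (x - z) = 0" "(z - y) \<bullet> (x - y) = 0" using z assms(3) by blast+
  then have "(z - y) \<bullet> (z - y) = 0" by (simp add: inner_diff_right)
  then show "z = y" by simp
qed (use assms in auto)

lemma prj:
  assumes "affine V" "V \<noteq> {}"
  shows "prj V x \<in> V" "\<And>v. v \<in> dirs V \<Longrightarrow> v \<bullet> (x - prj V x) = 0"
proof -
  obtain p where p: "p \<in> V" using assms by blast
  have s: "subspace (dirs V)" using assms subspace_dirs by blast
  obtain n z where nz: "n \<in> span (dirs V)" "\<And>w. w \<in> span (dirs V) \<Longrightarrow> orthogonal z w" "x - p = n + z"
    using orthogonal_subspace_decomp_exists[of "dirs V" "x - p"] by metis
  have n: "n \<in> dirs V" using nz(1) s by (metis span_eq_iff)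
  have "x - (p + n) = z" using nz(3) by (simp add: algebra_simps)
  then have o: "v \<bullet> (x - (p + n)) = 0" if "v \<in> dirs V" for v
    using nz(2)[of v] span_base[OF that] by (simp add: orthogonal_def inner_commute)
  have "prj V x = p + n" by (rule prj_eqI[OF assms(1) dirnD[OF n p] o])
  then show "prj V x \<in> V" "\<And>v. v \<in> dirs V \<Longrightarrow> v \<bullet> (x - prj V x) = 0" using dirnD[OF n p] o by auto
qed

lemma prj_UNIV [simp]: "prj UNIV x = x"
  by (rule prj_eqI) auto

lemma prj_id: "affine V \<Longrightarrow> x \<in> V \<Longrightarrow> prj V x = x"
  by (rule prj_eqI) auto

lemma prj_translate:
  assumes "affine V" "V \<noteq> {}"
  shows "prj ((+) l ` V) (l + x) = l + prj V x"
  by (rule prj_eqI) (use assms prj(1)[OF assms, of x] prj(2)[OF assms, where x = x] affine_translation[of V l] in auto)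

lemma prj_measurable:
  fixes V :: "'a::euclidean_space set"
  assumes "affine V" "V \<noteq> {}"
  shows "prj V \<in> borel_measurable borel"
proof -
  have "aff_dim V = int (nat (aff_dim V))"
  proof -
    obtain p where "p \<in> V" using assms(2) by blast
    then have "aff_dim {p} \<le> aff_dim V" by (intro aff_dim_subset) auto
    then show ?thesis by simp
  qed
  then obtain p b where f: "is_frame (nat (aff_dim V)) V p b" using frame_exists[OF assms(1)] by blast
  note fd = frame_dirs[OF f assms(1)]
  let ?r = "nat (aff_dim V)"
  have "prj V x = p + (\<Sum>i<?r. ((x - p) \<bullet> b i) *\<^sub>R b i)" for x
  proof (rule prj_eqI[OF assms(1)])
    have "frame_coords ?r p b (\<lambda>i. (x - p) \<bullet> b i) \<in> V" using f by (auto simp: is_frame_def)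
    then show "p + (\<Sum>i<?r. ((x - p) \<bullet> b i) *\<^sub>R b i) \<in> V" by (simp add: frame_coords_def)
    fix v assume "v \<in> dirs V"
    then have v: "v = (\<Sum>i<?r. (v \<bullet> b i) *\<^sub>R b i)" using orthonormal_expand[OF fd(1)] fd(3) by blast
    have "b i \<bullet> (x - (p + (\<Sum>i<?r. ((x - p) \<bullet> b i) *\<^sub>R b i))) = 0" if "i < ?r" for i
      using orthonormal_inner[OF fd(1), of "{..<?r}" i "\<lambda>i. (x - p) \<bullet> b i"] that
      by (simp add: inner_diff_right inner_diff_left inner_add_right inner_commute)
    then show "v \<bullet> (x - (p + (\<Sum>i<?r. ((x - p) \<bullet> b i) *\<^sub>R b i))) = 0"
      by (subst v) (simp add: inner_sum_left)
  qed
  then have "prj V = (\<lambda>x. p + (\<Sum>i<?r. ((x - p) \<bullet> b i) *\<^sub>R b i))" by blast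
  then show ?thesis by simp
qed

definition tube :: "'a::euclidean_space set \<Rightarrow> 'a set" where
  "tube V = {x. norm (x - prj V x) \<le> 1}"

text \<open>Integration over a flat is realised as integration over the tube of radius \<open>1\<close> around it, so that it
  needs no frame and inherits translation invariance from Lebesgue measure. It differs from the volume in a frame
  by a factor depending only on the dimension.\<close>

definition flat_int :: "'a::euclidean_space set \<Rightarrow> ('a \<Rightarrow> real) \<Rightarrow> real" where
  "flat_int V f = (LINT x|lborel. f (prj V x) * indicator (tube V) x)"

lemma tube_sets:
  assumes "affine V" "V \<noteq> {}" shows "tube V \<in> sets borel"
proof -
  note [measurable] = prj_measurable[OF assms]
  show ?thesis unfolding tube_def by measurable
qed

text \<open>The quotient of frame volume and tube integral. The tube contributes the ball in the
  complementary coordinates; the other two factors compare the product measure in a full frame with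
  Lebesgue measure.\<close>

definition vol_const :: "'a::euclidean_space itself \<Rightarrow> nat \<Rightarrow> real" where
  "vol_const _ r = measure (PiM {..<DIM('a)} (\<lambda>_. lborel)) (sq_ball {..<DIM('a)}) /
     (measure (PiM {r..<DIM('a)} (\<lambda>_. lborel)) (sq_ball {r..<DIM('a)}) * measure lborel (cball (0::'a) 1))"

text \<open>A frame of \<open>V\<close> is completed to an orthonormal basis. In these coordinates
  the part of the tube that projects into \<open>F\<close> is the product of the coordinate image of
  \<open>F\<close> with a unit ball, and product measures multiply.\<close>

lemma flat_volume_flat_int:
  fixes V :: "'a::euclidean_space set"
  assumes V: "affine V" "aff_dim V = int r" and F: "F \<subseteq> V" "closed F"
  shows "flat_volume r V F = vol_const TYPE('a) r * flat_int V (indicator F)"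
proof -
  obtain p b where pb: "(SOME (p, b). is_frame r V p b) = (p, b)" by (cases "SOME (p, b). is_frame r V p b")
  have f: "is_frame r V p b"
    using frame_exists[OF V] pb by (metis (mono_tags, lifting) case_prod_conv someI_ex)
  note fd = frame_dirs[OF f V(1)]
  obtain c where c: "orthonormal DIM('a) c" "\<forall>i<r. c i = b i" and rd: "r \<le> DIM('a)"
    using orthonormal_extend[OF fd(1)] by blast
  have ne: "V \<noteq> {}" using dim_dirs[OF V] by blast
  note [measurable] = prj_measurable[OF V(1) ne] tube_sets[OF V(1) ne]
  have [measurable]: "F \<in> sets borel" using F by auto
  let ?d = "DIM('a)" and ?T = "frame_coords DIM('a) p c"
  let ?P = "\<lambda>J. PiM J (\<lambda>_. lborel :: real measure)"
  define E where "E = {x. prj V x \<in> F \<and> x \<in> tube V}"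
  have [measurable]: "E \<in> sets borel" unfolding E_def by measurable
  define X where "X = {x \<in> {..<r} \<rightarrow>\<^sub>E UNIV. frame_coords r p b x \<in> F}"
  have "{x \<in> space (?P {..<r}). frame_coords r p b x \<in> F} \<in> sets (?P {..<r})" by measurable
  then have X[measurable]: "X \<in> sets (?P {..<r})" by (simp add: X_def space_PiM)
  have split: "?T x = frame_coords r p b x + (\<Sum>i\<in>{r..<?d}. x i *\<^sub>R c i)" for x
  proof -
    have "{..<?d} = {..<r} \<union> {r..<?d}" using rd by auto
    then have "(\<Sum>i<?d. x i *\<^sub>R c i) = (\<Sum>i<r. x i *\<^sub>R c i) + (\<Sum>i\<in>{r..<?d}. x i *\<^sub>R c i)"
      using sum.union_disjoint[of "{..<r}" "{r..<?d}" "\<lambda>i. x i *\<^sub>R c i"] by (simp add: ivl_disj_int)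
    then show ?thesis using c(2) by (simp add: frame_coords_def)
  qed
  have prjT: "prj V (?T x) = frame_coords r p b x" for x
  proof (rule prj_eqI[OF V(1)])
    show "frame_coords r p b x \<in> V" using f by (auto simp: is_frame_def)
    fix v assume "v \<in> dirs V"
    then have v: "v = (\<Sum>i<r. (v \<bullet> b i) *\<^sub>R b i)" using orthonormal_expand[OF fd(1)] fd(3) by blast
    have "b i \<bullet> (\<Sum>i\<in>{r..<?d}. x i *\<^sub>R c i) = 0" if "i < r" for i
      using orthonormal_inner[OF c(1), of "{r..<?d}" i x] that c(2) rd by (auto simp: subset_iff)
    then show "v \<bullet> (?T x - frame_coords r p b x) = 0"
      unfolding split by (subst v) (simp add: inner_sum_left)
  qed
  have nT: "norm (?T x - prj V (?T x)) \<le> 1 \<longleftrightarrow> (\<Sum>i\<in>{r..<?d}. (x i)\<^sup>2) \<le> 1" for x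
  proof -
    have "(norm (?T x - prj V (?T x)))\<^sup>2 = (\<Sum>i\<in>{r..<?d}. (x i)\<^sup>2)"
    proof -
      have "?T x - prj V (?T x) = (\<Sum>i\<in>{r..<?d}. x i *\<^sub>R c i)" unfolding prjT by (simp add: split)
      moreover have "{r..<?d} \<subseteq> {..<?d}" by auto
      ultimately show ?thesis using orthonormal_norm[OF c(1), of "{r..<?d}" x] by simp
    qed
    then show ?thesis by (metis abs_norm_cancel abs_square_le_1)
  qed
  have "emeasure (distr (?P {..<?d}) borel ?T) E = emeasure (?P {..<?d}) (?T -` E \<inter> space (?P {..<?d}))"
    by (subst emeasure_distr) auto
  also have "\<dots> = emeasure (distr (?P {..<r} \<Otimes>\<^sub>M ?P {r..<?d}) (?P ({..<r} \<union> {r..<?d})) (merge {..<r} {r..<?d})) (?T -` E \<inter> space (?P {..<?d}))"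
  proof -
    have "{..<r} \<union> {r..<?d} = {..<?d}" using rd by auto
    moreover have "distr (?P {..<r} \<Otimes>\<^sub>M ?P {r..<?d}) (?P ({..<r} \<union> {r..<?d})) (merge {..<r} {r..<?d}) = ?P ({..<r} \<union> {r..<?d})"
      by (rule lborel_product.distr_merge) auto
    ultimately show ?thesis by simp
  qed
  also have "\<dots> = emeasure (?P {..<r} \<Otimes>\<^sub>M ?P {r..<?d}) (merge {..<r} {r..<?d} -` (?T -` E \<inter> space (?P {..<?d})) \<inter> space (?P {..<r} \<Otimes>\<^sub>M ?P {r..<?d}))"
  proof (rule emeasure_distr)
    have "{..<r} \<union> {r..<?d} = {..<?d}" using rd by auto
    moreover have "?T -` E \<inter> space (?P {..<?d}) \<in> sets (?P {..<?d})" by measurable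
    ultimately show "?T -` E \<inter> space (?P {..<?d}) \<in> sets (?P ({..<r} \<union> {r..<?d}))" by simp
  qed measurable
  also have "merge {..<r} {r..<?d} -` (?T -` E \<inter> space (?P {..<?d})) \<inter> space (?P {..<r} \<Otimes>\<^sub>M ?P {r..<?d}) = X \<times> sq_ball {r..<?d}"
  proof -
    have mi: "merge {..<r} {r..<?d} (x, y) \<in> ?T -` E \<inter> space (?P {..<?d}) \<longleftrightarrow> x \<in> X \<and> y \<in> sq_ball {r..<?d}"
      if "x \<in> {..<r} \<rightarrow>\<^sub>E UNIV" "y \<in> {r..<?d} \<rightarrow>\<^sub>E UNIV" for x y
    proof -
      let ?z = "merge {..<r} {r..<?d} (x, y)"
      have "?z \<in> space (?P {..<?d})" using rd by (auto simp: space_PiM PiE_iff merge_def extensional_def)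
      moreover have "frame_coords r p b ?z = frame_coords r p b x" by (simp add: frame_coords_def merge_def)
      moreover have "(\<Sum>i\<in>{r..<?d}. (?z i)\<^sup>2) = (\<Sum>i\<in>{r..<?d}. (y i)\<^sup>2)" by (intro sum.cong) (auto simp: merge_def)
      ultimately show ?thesis using that nT[of ?z] prjT[of ?z] by (auto simp: E_def tube_def X_def sq_ball_def)
    qed
    show ?thesis
    proof (intro set_eqI iffI)
      fix z assume z: "z \<in> merge {..<r} {r..<?d} -` (?T -` E \<inter> space (?P {..<?d})) \<inter> space (?P {..<r} \<Otimes>\<^sub>M ?P {r..<?d})"
      then obtain x y where "z = (x, y)" "x \<in> {..<r} \<rightarrow>\<^sub>E UNIV" "y \<in> {r..<?d} \<rightarrow>\<^sub>E UNIV"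
        by (auto simp: space_pair_measure space_PiM)
      then show "z \<in> X \<times> sq_ball {r..<?d}" using mi z by auto
    next
      fix z assume z: "z \<in> X \<times> sq_ball {r..<?d}"
      then obtain x y where "z = (x, y)" "x \<in> {..<r} \<rightarrow>\<^sub>E UNIV" "y \<in> {r..<?d} \<rightarrow>\<^sub>E UNIV"
        by (auto simp: X_def sq_ball_def)
      then show "z \<in> merge {..<r} {r..<?d} -` (?T -` E \<inter> space (?P {..<?d})) \<inter> space (?P {..<r} \<Otimes>\<^sub>M ?P {r..<?d})"
        using mi z by (auto simp: space_pair_measure space_PiM)
    qed
  qed
  also have "emeasure (?P {..<r} \<Otimes>\<^sub>M ?P {r..<?d}) (X \<times> sq_ball {r..<?d}) = emeasure (?P {..<r}) X * emeasure (?P {r..<?d}) (sq_ball {r..<?d})"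
  proof -
    interpret J: finite_product_sigma_finite "\<lambda>_::nat. lborel :: real measure" "{r..<?d}" by standard auto
    show ?thesis by (rule J.emeasure_pair_measure_Times) auto
  qed
  finally have "emeasure (?P {..<r}) X * emeasure (?P {r..<?d}) (sq_ball {r..<?d}) * emeasure lborel (cball (0::'a) 1)
     = emeasure lborel E * emeasure (?P {..<?d}) (sq_ball {..<?d})"
    using orthonormal_distr_proportional[OF c(1), of E p] by simp
  then have "measure (?P {..<r}) X * measure (?P {r..<?d}) (sq_ball {r..<?d}) * measure lborel (cball (0::'a) 1)
     = measure lborel E * measure (?P {..<?d}) (sq_ball {..<?d})"
    unfolding measure_def by (metis enn2real_mult)
  moreover have "measure (?P {r..<?d}) (sq_ball {r..<?d}) > 0"
    unfolding measure_def using sq_ball_measure[of "{r..<?d}"] by (simp add: enn2real_positive_iff)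
  moreover have "measure lborel (cball (0::'a) 1) > 0" by (simp add: content_cball_pos)
  ultimately have "measure (?P {..<r}) X = vol_const TYPE('a) r * measure lborel E"
    by (simp add: vol_const_def field_simps)
  moreover have "flat_volume r V F = measure (?P {..<r}) X" unfolding flat_volume_def pb X_def by simp
  moreover have "flat_int V (indicator F) = measure lborel E"
  proof -
    have "indicat_real F (prj V x) * indicat_real (tube V) x = indicat_real E x" for x
      by (simp add: E_def indicator_def)
    then show ?thesis unfolding flat_int_def by simp
  qed
  ultimately show ?thesis by simp
qed

lemma vol_const_pos: "vol_const TYPE('a::euclidean_space) r > 0"
  unfolding vol_const_def measure_def
  using sq_ball_measure[of "{r..<DIM('a)}"] sq_ball_measure[of "{..<DIM('a)}"] content_cball_pos[of 1 "0::'a"]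
  by (auto simp: enn2real_positive_iff measure_def intro!: divide_pos_pos mult_pos_pos)

section \<open>Flag weights as integrals of iterated jumps\<close>

lemma pw_const_factor:
  assumes "finite H" "pw_const V H f"
  obtains g where "\<And>x. x \<in> V \<Longrightarrow> f x = g (restrict (\<lambda>h. side h x) H)" "finite ((\<lambda>x. restrict (\<lambda>h. side h x) H) ` V)"
proof -
  define sig where "sig x = restrict (\<lambda>h. side h x) H" for x :: 'a
  define g where "g \<sigma> = f (SOME x. x \<in> V \<and> sig x = \<sigma>)" for \<sigma>
  have "f x = g (sig x)" if "x \<in> V" for x
  proof -
    have s: "(SOME y. y \<in> V \<and> sig y = sig x) \<in> V \<and> sig (SOME y. y \<in> V \<and> sig y = sig x) = sig x"
      by (rule someI[of _ x]) (use that in auto)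
    have "same_cell H x y" if "sig y = sig x" for y
      using fun_cong[OF that] unfolding same_cell_def sig_def by (metis restrict_apply')
    then show ?thesis unfolding g_def using s that pcD[OF assms(2)] by blast
  qed
  moreover have "sig ` V \<subseteq> PiE H (\<lambda>_. {-1, 0, 1})"
    by (simp add: sig_def side_def sgn_real_def image_subset_iff PiE_iff)
  then have "finite (sig ` V)" using assms(1) by (meson finite.emptyI finite.insertI finite_PiE finite_subset)
  ultimately show thesis using that unfolding sig_def by blast
qed

lemma pw_const_finite_range:
  assumes "finite H" "pw_const V H f" shows "finite (f ` V)"
proof -
  obtain g where g: "\<And>x. x \<in> V \<Longrightarrow> f x = g (restrict (\<lambda>h. side h x) H)" "finite ((\<lambda>x. restrict (\<lambda>h. side h x) H) ` V)"
    using pw_const_factor[OF assms] by metis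
  have "f ` V = g ` (\<lambda>x. restrict (\<lambda>h. side h x) H) ` V" using g(1) by (auto simp: image_image)
  then show ?thesis using g(2) by simp
qed

lemma side_measurable [measurable]: "side h \<in> borel_measurable borel"
  unfolding side_def[abs_def] by measurable

lemma pw_const_measurable:
  fixes f :: "'a::euclidean_space \<Rightarrow> real"
  assumes "finite H" "pw_const UNIV H f"
  shows "f \<in> borel_measurable borel"
proof -
  define sig where "sig x = restrict (\<lambda>h. side h x) H" for x :: 'a
  obtain g where g: "\<And>x. f x = g (sig x)" "finite (range sig)"
    using pw_const_factor[OF assms] unfolding sig_def by (metis UNIV_I)
  have "f x = (\<Sum>\<sigma>\<in>range sig. g \<sigma> * indicator {x. \<forall>h\<in>H. side h x = \<sigma> h} x)" for x
  proof -
    have "(\<Sum>\<sigma>\<in>range sig. g \<sigma> * indicator {x. \<forall>h\<in>H. side h x = \<sigma> h} x) = (\<Sum>\<sigma>\<in>range sig. if sig x = \<sigma> then g \<sigma> else 0)"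
    proof (rule sum.cong[OF refl])
      fix \<sigma> assume "\<sigma> \<in> range sig"
      then have "(\<forall>h\<in>H. side h x = \<sigma> h) \<longleftrightarrow> sig x = \<sigma>"
        unfolding sig_def by (auto simp: fun_eq_iff restrict_def)
      then show "g \<sigma> * indicator {x. \<forall>h\<in>H. side h x = \<sigma> h} x = (if sig x = \<sigma> then g \<sigma> else 0)"
        by (simp add: indicator_def)
    qed
    also have "\<dots> = f x" using g by (simp add: sum.delta)
    finally show ?thesis by simp
  qed
  then have "f = (\<lambda>x. \<Sum>\<sigma>\<in>range sig. g \<sigma> * indicator {x. \<forall>h\<in>H. side h x = \<sigma> h} x)" by blast
  moreover have "{x. \<forall>h\<in>H. side h x = \<sigma> h} \<in> sets borel" for \<sigma>
  proof -
    have "{x \<in> space borel. \<forall>h\<in>H. side h x = \<sigma> h} \<in> sets borel"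
      using assms(1) by (intro sets.sets_Collect_finite_All) measurable
    then show ?thesis by simp
  qed
  ultimately show ?thesis by simp
qed

text \<open>The projection is affine, so it pulls hyperplanes back to hyperplanes: the component of
  the normal orthogonal to \<open>V\<close> contributes a constant.\<close>

lemma prj_side:
  fixes V :: "'a::euclidean_space set"
  assumes "affine V" "V \<noteq> {}"
  shows "\<exists>h'. \<forall>x. fst h \<bullet> prj V x - snd h = fst h' \<bullet> x - snd h'"
proof -
  obtain p where p: "p \<in> V" using assms by blast
  have s: "subspace (dirs V)" using assms subspace_dirs by blast
  obtain n z where nz: "n \<in> span (dirs V)" "\<And>w. w \<in> span (dirs V) \<Longrightarrow> orthogonal z w" "fst h = n + z"
    using orthogonal_subspace_decomp_exists[of "dirs V" "fst h"] by metis
  have n: "n \<in> dirs V" using nz(1) s by (metis span_eq_iff)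
  have "fst h \<bullet> prj V x - snd h = n \<bullet> x - (snd h - fst h \<bullet> p + n \<bullet> p)" for x
  proof -
    have "prj V x - p \<in> dirs V" using prj(1)[OF assms] p assms(1) dirs_diff by blast
    then have "z \<bullet> (prj V x - p) = 0" using nz(2) span_base unfolding orthogonal_def by blast
    moreover have "n \<bullet> (x - prj V x) = 0" using prj(2)[OF assms n] .
    ultimately show ?thesis by (simp add: nz(3) inner_diff_right inner_add_left)
  qed
  then show ?thesis by (intro exI[of _ "(n, snd h - fst h \<bullet> p + n \<bullet> p)"]) simp
qed

lemma pw_const_prj:
  assumes "affine V" "V \<noteq> {}" "finite H" "pw_const V H f"
  shows "\<exists>H'. finite H' \<and> pw_const UNIV H' (\<lambda>x. f (prj V x))"
proof -
  obtain k where k: "\<And>h x. fst h \<bullet> prj V x - snd h = fst (k h) \<bullet> x - snd (k h)"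
    using prj_side[OF assms(1,2)] by metis
  have "pw_const UNIV (k ` H) (\<lambda>x. f (prj V x))"
    unfolding pw_const_def
  proof (intro ballI impI)
    fix x y assume "same_cell (k ` H) x y"
    then have "same_cell H (prj V x) (prj V y)" by (auto simp: same_cell_def side_def k)
    then show "f (prj V x) = f (prj V y)" using pcD[OF assms(4)] prj(1)[OF assms(1,2)] by blast
  qed
  then show ?thesis using assms(3) by blast
qed

text \<open>The class of functions that can be integrated over \<open>V\<close>; it is closed under
  linear combinations, shifts and jumps.\<close>

definition bpw_const :: "'a::euclidean_space set \<Rightarrow> ('a \<Rightarrow> real) \<Rightarrow> bool" where
  "bpw_const V f \<longleftrightarrow> (\<exists>H. finite H \<and> pw_const V H f) \<and> (\<exists>R. \<forall>x\<in>V. norm x > R \<longrightarrow> f x = 0)"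

lemma bpw_const_lpw_const: "bpw_const V f \<Longrightarrow> lpw_const V f"
  by (auto simp: bpw_const_def pw_const_imp_lpw_const)

lemma bpw_const_measurable:
  assumes "affine V" "V \<noteq> {}" "bpw_const V f"
  shows "(\<lambda>x. f (prj V x)) \<in> borel_measurable borel"
  using assms pw_const_prj pw_const_measurable unfolding bpw_const_def by metis

lemma bpw_const_integrable:
  fixes V :: "'a::euclidean_space set"
  assumes "affine V" "V \<noteq> {}" "bpw_const V f"
  shows "integrable lborel (\<lambda>x. f (prj V x) * indicator (tube V) x)"
proof -
  obtain H R where H: "finite H" "pw_const V H f" and R: "\<And>x. x \<in> V \<Longrightarrow> norm x > R \<Longrightarrow> f x = 0" using assms by (auto simp: bpw_const_def)
  note [measurable] = bpw_const_measurable[OF assms] tube_sets[OF assms(1,2)]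
  obtain B where B: "\<And>x. x \<in> V \<Longrightarrow> \<bar>f x\<bar> \<le> B"
  proof -
    have "bounded (f ` V)" using pw_const_finite_range[OF H] finite_imp_bounded by blast
    then show thesis using that unfolding bounded_iff by (auto simp: )
  qed
  show ?thesis
  proof (rule integrableI_bounded_set[where A = "cball 0 (R + 1)" and B = "B"])
    \<comment> \<open>The tube has radius 1, so a function supported in radius \<open>R\<close> on
      \<open>V\<close> gives an integrand supported in radius \<open>R + 1\<close>.\<close>
    show "emeasure lborel (cball (0::'a) (R + 1)) < \<infinity>" using emeasure_bounded_finite[OF bounded_cball] by simp
    have "B \<ge> 0" using B assms(2) by (metis abs_ge_zero ex_in_conv order_trans)
    then show "AE x in lborel. x \<in> cball 0 (R + 1) \<longrightarrow> norm (f (prj V x) * indicator (tube V) x) \<le> B"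
      using B prj(1)[OF assms(1,2)] by (auto simp: indicator_def)
    show "AE x in lborel. x \<notin> cball 0 (R + 1) \<longrightarrow> f (prj V x) * indicator (tube V) x = 0"
    proof (intro AE_I2 impI)
      fix x :: 'a assume x: "x \<notin> cball 0 (R + 1)"
      show "f (prj V x) * indicator (tube V) x = 0"
      proof (cases "x \<in> tube V")
        case True
        then have "norm (x - prj V x) \<le> 1" by (simp add: tube_def)
        moreover have "norm x \<le> norm (prj V x) + norm (x - prj V x)" by (metis norm_triangle_sub)
        ultimately have "norm (prj V x) > R" using x by simp
        then show ?thesis using R prj(1)[OF assms(1,2)] by simp
      qed simp
    qed
  qed measurable
qed

lemma bpw_const_binop:
  assumes "bpw_const V f" "bpw_const V g" "k 0 0 = (0::real)"
  shows "bpw_const V (\<lambda>x. k (f x) (g x))"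
proof -
  obtain H G R S where H: "finite H" "pw_const V H f" "\<And>x. x \<in> V \<Longrightarrow> norm x > R \<Longrightarrow> f x = 0"
     and G: "finite G" "pw_const V G g" "\<And>x. x \<in> V \<Longrightarrow> norm x > S \<Longrightarrow> g x = 0"
    using assms(1,2) unfolding bpw_const_def by blast
  have "pw_const V (H \<union> G) (\<lambda>x. k (f x) (g x))" using pw_const_mono[OF H(2), of "H \<union> G" V] pw_const_mono[OF G(2), of "H \<union> G" V]
    unfolding pw_const_def by (metis Un_upper1 Un_upper2 order_refl)
  moreover have "\<forall>x\<in>V. norm x > max R S \<longrightarrow> k (f x) (g x) = 0" using H(3) G(3) assms(3) by simp
  ultimately show ?thesis using H(1) G(1) unfolding bpw_const_def by (meson finite_UnI)
qed

lemma bpw_const_zero [simp]: "bpw_const V (\<lambda>x. 0)"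
  by (auto simp: bpw_const_def pw_const_def)

lemma bpw_const_sum: "finite I \<Longrightarrow> (\<And>i. i \<in> I \<Longrightarrow> bpw_const V (f i)) \<Longrightarrow> bpw_const V (\<lambda>x. \<Sum>i\<in>I. c i * f i x)"
proof (induction I rule: finite_induct)
  case (insert i I)
  then show ?case using bpw_const_binop[of V "f i" "\<lambda>x. \<Sum>i\<in>I. c i * f i x" "\<lambda>u v. c i * u + v"] by simp
qed simp

lemma bpw_const_indicator:
  assumes "polyhedral H V P" shows "bpw_const V (indicat_real P)"
proof -
  obtain R where "\<forall>x\<in>P. norm x \<le> R" using assms by (auto simp: polyhedral_def bounded_iff)
  then have "\<forall>x\<in>V. norm x > R \<longrightarrow> indicat_real P x = 0" by (auto simp: indicator_def)
  then show ?thesis using polyhedral_pw_const_indicator[OF assms] assms unfolding bpw_const_def polyhedral_def by blast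
qed

lemma ray_limit_vanish:
  assumes "\<And>y. y \<in> V \<Longrightarrow> norm y > R \<Longrightarrow> f y = 0" "affine V" "x \<in> V" "n \<in> dirs V" "norm x > R"
  shows "ray_limit n f x = 0"
proof (rule ray_limit_eqI)
  have "((\<lambda>t. norm (x + t *\<^sub>R n)) \<longlongrightarrow> norm (x + 0 *\<^sub>R n)) (at_right 0)" by (intro tendsto_intros)
  then have "\<forall>\<^sub>F t in at_right 0. norm (x + t *\<^sub>R n) > R" using order_tendstoD(1)[of _ "norm x"] assms(5) by fastforce
  moreover have "x + t *\<^sub>R n \<in> V" for t using assms dirnD dirs_scale by blast
  ultimately show "\<forall>\<^sub>F t in at_right 0. f (x + t *\<^sub>R n) = 0" using assms(1) by (auto elim: eventually_mono)
qed

lemma bpw_const_jump: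
  assumes "hplane_in V W n" "bpw_const V f" shows "bpw_const W (jump n f)"
proof -
  obtain H R where H: "finite H" "pw_const V H f" and R: "\<And>x. x \<in> V \<Longrightarrow> norm x > R \<Longrightarrow> f x = 0" using assms by (auto simp: bpw_const_def)
  have V: "affine V" "n \<in> dirs V" "-n \<in> dirs V" "W \<subseteq> V" using assms(1) hplane_in_neg[OF assms(1)] hplane_in_subset by (auto simp: hplane_in_def)
  have "pw_const W H (jump n f)" using pw_const_jump[OF H V(1,2)] pw_const_mono V(4) by blast
  moreover have "\<forall>x\<in>W. norm x > R \<longrightarrow> jump n f x = 0"
    using ray_limit_vanish[OF R V(1) _ V(2)] ray_limit_vanish[OF R V(1) _ V(3)] V(4) by (auto simp: jump_def subset_iff)
  ultimately show ?thesis using H(1) unfolding bpw_const_def by blast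
qed

lemma bpw_const_jumps: "tower \<nu> V r m \<Longrightarrow> bpw_const (V (r + m)) f \<Longrightarrow> bpw_const (V r) (jumps \<nu> r m f)"
proof (induction m arbitrary: r)
  case (Suc m)
  then show ?case by (auto simp: tower_Suc intro: bpw_const_jump)
qed simp

section \<open>Properties of the integral over a flat\<close>

lemma flat_int_sum:
  assumes "affine V" "V \<noteq> {}" "finite I" "\<And>i. i \<in> I \<Longrightarrow> bpw_const V (f i)"
  shows "flat_int V (\<lambda>x. \<Sum>i\<in>I. c i * f i x) = (\<Sum>i\<in>I. c i * flat_int V (f i))"
proof -
  have "flat_int V (\<lambda>x. \<Sum>i\<in>I. c i * f i x) = (LINT x|lborel. (\<Sum>i\<in>I. c i * (f i (prj V x) * indicator (tube V) x)))"
    unfolding flat_int_def by (simp add: sum_distrib_right mult.assoc)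
  also have "\<dots> = (\<Sum>i\<in>I. (LINT x|lborel. c i * (f i (prj V x) * indicator (tube V) x)))"
    by (rule Bochner_Integration.integral_sum) (use bpw_const_integrable[OF assms(1,2)] assms(4) in auto)
  finally show ?thesis by (simp add: flat_int_def)
qed

text \<open>The preimage is the zero set of an affine functional that is not identically zero,
  because the projection fixes the points of \<open>V\<close> and some of these lie off the
  hyperplane.\<close>

lemma prj_hplane_null:
  fixes V :: "'a::euclidean_space set"
  assumes "affine V" "V \<noteq> {}" "\<not> V \<subseteq> hplane h"
  shows "AE x in lborel. prj V x \<notin> hplane h"
proof -
  obtain h' where h': "\<And>x. fst h \<bullet> prj V x - snd h = fst h' \<bullet> x - snd h'" using prj_side[OF assms(1,2)] by metis
  have iff: "prj V x \<in> hplane h \<longleftrightarrow> fst h' \<bullet> x = snd h'" for x using h'[of x] by (auto simp: hplane_def)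
  have "fst h' \<noteq> 0 \<or> snd h' \<noteq> 0"
  proof (rule ccontr)
    assume "\<not> ?thesis"
    then have "x \<in> hplane h" if "x \<in> V" for x using iff[of x] prj_id[OF assms(1) that] by simp
    then show False using assms(3) by blast
  qed
  then have "negligible {x. fst h' \<bullet> x = snd h'}" by (rule negligible_hyperplane)
  then have "{x. fst h' \<bullet> x = snd h'} \<in> null_sets lebesgue" by (simp add: negligible_iff_null_sets)
  moreover have "{x. fst h' \<bullet> x = snd h'} \<in> sets lborel" using closed_hyperplane by auto
  ultimately have "{x. fst h' \<bullet> x = snd h'} \<in> null_sets lborel" by (simp add: null_sets_completion_iff)
  then show ?thesis using AE_not_in iff by fastforce
qed

lemma ae_on_AE:
  fixes V :: "'a::euclidean_space set"
  assumes "affine V" "V \<noteq> {}" "ae_on V f g"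
  shows "AE x in lborel. f (prj V x) = g (prj V x)"
proof -
  obtain H where H: "\<And>R. finite (H R)" "\<And>R h. h \<in> H R \<Longrightarrow> \<not> V \<subseteq> hplane h"
     "\<And>R x. x \<in> V \<Longrightarrow> norm x < R \<Longrightarrow> (\<forall>h\<in>H R. x \<notin> hplane h) \<Longrightarrow> f x = g x"
    using assms(3) unfolding ae_on_def by metis
  have "AE x in lborel. \<forall>h\<in>H (real n). prj V x \<notin> hplane h" for n :: nat
    using H(1,2) by (subst AE_finite_all) (auto intro!: prj_hplane_null assms)
  then have "AE x in lborel. \<forall>n::nat. \<forall>h\<in>H (real n). prj V x \<notin> hplane h" by (subst AE_all_countable) auto
  then show ?thesis
  proof (rule AE_mp, intro AE_I2 impI)
    fix x assume x: "\<forall>n::nat. \<forall>h\<in>H (real n). prj V x \<notin> hplane h"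
    obtain n :: nat where "norm (prj V x) < real n" using reals_Archimedean2 by blast
    then show "f (prj V x) = g (prj V x)" using H(3) x prj(1)[OF assms(1,2)] by blast
  qed
qed

lemma flat_int_cong:
  assumes "affine V" "V \<noteq> {}" "bpw_const V f" "bpw_const V g" "ae_on V f g"
  shows "flat_int V f = flat_int V g"
proof -
  note [measurable] = bpw_const_measurable[OF assms(1,2,3)] bpw_const_measurable[OF assms(1,2,4)] tube_sets[OF assms(1,2)]
  show ?thesis unfolding flat_int_def
    by (rule integral_cong_AE) (use ae_on_AE[OF assms(1,2,5)] in auto)
qed

lemma tube_translate:
  assumes "affine V" "V \<noteq> {}"
  shows "l + x \<in> tube ((+) l ` V) \<longleftrightarrow> x \<in> tube V"
  using prj_translate[OF assms, of l x] by (simp add: tube_def)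

lemma bpw_const_translate:
  fixes V :: "'a::euclidean_space set"
  assumes "bpw_const ((+) l ` V) f" shows "bpw_const V (\<lambda>x. f (l + x))"
proof -
  obtain H R where H: "finite H" "pw_const ((+) l ` V) H f" and R: "\<And>x. x \<in> (+) l ` V \<Longrightarrow> norm x > R \<Longrightarrow> f x = 0" using assms by (auto simp: bpw_const_def)
  let ?k = "\<lambda>h::'a \<times> real. (fst h, snd h - fst h \<bullet> l)"
  have "side (?k h) x = side h (l + x)" for h x by (simp add: side_def inner_add_right algebra_simps)
  then have "same_cell H (l + x) (l + y)" if "same_cell (?k ` H) x y" for x y using that by (simp add: same_cell_def)
  then have "pw_const V (?k ` H) (\<lambda>x. f (l + x))" using H(2) unfolding pw_const_def by blast
  moreover have "f (l + x) = 0" if "x \<in> V" "norm x > R + norm l" for x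
  proof (rule R)
    have "norm x \<le> norm (l + x) + norm l" by (metis add.commute norm_triangle_sub add_diff_cancel_right' norm_minus_commute)
    then show "norm (l + x) > R" using that by simp
  qed (use that in auto)
  ultimately show ?thesis using H(1) unfolding bpw_const_def by blast
qed

lemma flat_int_translate:
  fixes V :: "'a::euclidean_space set"
  assumes "affine V" "V \<noteq> {}" "bpw_const ((+) l ` V) f"
  shows "flat_int ((+) l ` V) f = flat_int V (\<lambda>x. f (l + x))"
proof -
  have V': "affine ((+) l ` V)" "(+) l ` V \<noteq> {}" using assms affine_translation[of V l] by auto
  note [measurable] = bpw_const_measurable[OF V' assms(3)] tube_sets[OF V']
  have "flat_int ((+) l ` V) f = (LINT x|distr lborel borel ((+) l). f (prj ((+) l ` V) x) * indicator (tube ((+) l ` V)) x)"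
    unfolding flat_int_def lborel_distr_plus ..
  also have "\<dots> = (LINT x|lborel. f (prj ((+) l ` V) (l + x)) * indicator (tube ((+) l ` V)) (l + x))"
    by (rule integral_distr) measurable
  also have "\<dots> = flat_int V (\<lambda>x. f (l + x))"
    unfolding flat_int_def using prj_translate[OF assms(1,2)] tube_translate[OF assms(1,2)]
    by (simp add: indicator_def)
  finally show ?thesis .
qed

text \<open>Induction from the top flat. The first jump of the indicator equals the signed sum of
  the facets only up to \<open>ae_on\<close>; this survives the remaining jumps and is invisible to
  the integral, so linearity finishes the step.\<close>

lemma chain_sum_flat_int:
  fixes \<Phi> :: "'a::euclidean_space flag"
  assumes nm: "normals r \<Phi> \<nu>" and aff: "affine (flat \<Phi> r)" "aff_dim (flat \<Phi> r) = int r"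
    and "r + m \<le> DIM('a)" "polyhedral H (flat \<Phi> (r + m)) P"
  shows "chain_sum \<Phi> r m P = vol_const TYPE('a) r * flat_int (flat \<Phi> r) (jumps \<nu> r m (indicat_real P))"
  using assms(4,5)
proof (induction m arbitrary: P)
  case 0
  then show ?case using flat_volume_flat_int[OF aff, of P] by (simp add: polyhedral_def)
next
  case (Suc m)
  define j where "j = r + m"
  have jr: "j \<in> {r..<DIM('a)}" using Suc by (auto simp: j_def)
  obtain \<beta> where hp: "hplane_in (flat \<Phi> (Suc j)) (flat \<Phi> j) (\<nu> j)" "flat \<Phi> j = {x\<in>flat \<Phi> (Suc j). \<nu> j \<bullet> x = \<beta>}"
    "pos \<Phi> j = {x\<in>flat \<Phi> (Suc j). \<nu> j \<bullet> x \<ge> \<beta>}"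
          "neg \<Phi> j = {x\<in>flat \<Phi> (Suc j). \<nu> j \<bullet> x \<le> \<beta>}" using nm jr unfolding normals_def by blast
  have P: "polyhedral H (flat \<Phi> (Suc j)) P" using Suc.prems by (simp add: j_def)
  note jf = jump_facets[OF hp(1) P hp(2,3,4)]
  have fin: "finite (facets_at \<Phi> j P)" using jf(2,3) by (simp add: facets_at_def)
  have pG: "polyhedral H (flat \<Phi> j) G" if "G \<in> facets_at \<Phi> j P" for G using jf(5) that by (auto simp: facets_at_def)
  have ne: "flat \<Phi> r \<noteq> {}" using dim_dirs[OF aff] by blast
  have tw: "tower \<nu> (flat \<Phi>) r m"
  proof -
    have "affine (flat \<Phi> j)" "flat \<Phi> j \<noteq> {}" using hplane_in_affine[OF hp(1)] hp(1) by (auto simp: hplane_in_def)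
    then show ?thesis using nm jr unfolding tower_def normals_def by (auto simp: j_def)
  qed
  have ae: "ae_on (flat \<Phi> j) (jump (\<nu> j) (indicat_real P)) (\<lambda>x. \<Sum>G\<in>facets_at \<Phi> j P. facet_sign \<Phi> j P G * indicat_real G x)"
  proof -
    let ?A = "facets_on P (flat \<Phi> j) (pos \<Phi> j)" and ?B = "facets_on P (flat \<Phi> j) (neg \<Phi> j)"
    have "(\<Sum>G\<in>facets_at \<Phi> j P. facet_sign \<Phi> j P G * indicat_real G x) = (\<Sum>F\<in>?A. indicat_real F x) - (\<Sum>F\<in>?B. indicat_real F x)" for x
    proof -
      have "(\<Sum>G\<in>facets_at \<Phi> j P. facet_sign \<Phi> j P G * indicat_real G x) =
         (\<Sum>G\<in>?A. facet_sign \<Phi> j P G * indicat_real G x) + (\<Sum>G\<in>?B. facet_sign \<Phi> j P G * indicat_real G x)"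
        unfolding facets_at_def by (rule sum.union_disjoint) (use jf(2,3,4) in auto)
      also have "(\<Sum>G\<in>?A. facet_sign \<Phi> j P G * indicat_real G x) = (\<Sum>F\<in>?A. indicat_real F x)"
        by (intro sum.cong) (auto simp: facet_sign_def)
      also have "(\<Sum>G\<in>?B. facet_sign \<Phi> j P G * indicat_real G x) = (\<Sum>F\<in>?B. - indicat_real F x)"
        by (intro sum.cong) (use jf(4) in \<open>auto simp: facet_sign_def\<close>)
      finally show ?thesis by (simp add: sum_negf)
    qed
    then show ?thesis using jf(1) by presburger
  qed
  have pI: "bpw_const (flat \<Phi> (r + m)) (indicat_real G)" if "G \<in> facets_at \<Phi> j P" for G
    using bpw_const_indicator[OF pG[OF that]] by (simp add: j_def)
  have "chain_sum \<Phi> r (Suc m) P = (\<Sum>G\<in>facets_at \<Phi> j P. facet_sign \<Phi> j P G * (vol_const TYPE('a) r * flat_int (flat \<Phi> r) (jumps \<nu> r m (indicat_real G))))"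
    unfolding chain_sum.simps j_def[symmetric] using Suc.IH Suc.prems pG by (intro sum.cong) (auto simp: j_def)
  also have "\<dots> = vol_const TYPE('a) r * (\<Sum>G\<in>facets_at \<Phi> j P. facet_sign \<Phi> j P G * flat_int (flat \<Phi> r) (jumps \<nu> r m (indicat_real G)))"
    by (simp add: sum_distrib_left mult_ac)
  also have "(\<Sum>G\<in>facets_at \<Phi> j P. facet_sign \<Phi> j P G * flat_int (flat \<Phi> r) (jumps \<nu> r m (indicat_real G)))
    = flat_int (flat \<Phi> r) (\<lambda>x. \<Sum>G\<in>facets_at \<Phi> j P. facet_sign \<Phi> j P G * jumps \<nu> r m (indicat_real G) x)"
    by (rule flat_int_sum[OF aff(1) ne fin, symmetric]) (rule bpw_const_jumps[OF tw pI])
  also have "\<dots> = flat_int (flat \<Phi> r) (jumps \<nu> r m (\<lambda>x. \<Sum>G\<in>facets_at \<Phi> j P. facet_sign \<Phi> j P G * indicat_real G x))"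
  proof (rule flat_int_cong[OF aff(1) ne])
    show "ae_on (flat \<Phi> r) (\<lambda>x. \<Sum>G\<in>facets_at \<Phi> j P. facet_sign \<Phi> j P G * jumps \<nu> r m (indicat_real G) x)
      (jumps \<nu> r m (\<lambda>x. \<Sum>G\<in>facets_at \<Phi> j P. facet_sign \<Phi> j P G * indicat_real G x))"
      by (rule ae_on_eq, rule jumps_sum[OF tw fin, symmetric]) (use pI bpw_const_lpw_const in auto)
  qed (auto intro!: bpw_const_sum fin bpw_const_jumps[OF tw] pI)
  also have "\<dots> = flat_int (flat \<Phi> r) (jumps \<nu> r m (jump (\<nu> j) (indicat_real P)))"
  proof (rule flat_int_cong[OF aff(1) ne])
    show "bpw_const (flat \<Phi> r) (jumps \<nu> r m (jump (\<nu> j) (indicat_real P)))"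
      using bpw_const_jump[OF hp(1) bpw_const_indicator[OF P]] by (intro bpw_const_jumps[OF tw]) (simp add: j_def)
    show "ae_on (flat \<Phi> r) (jumps \<nu> r m (\<lambda>x. \<Sum>G\<in>facets_at \<Phi> j P. facet_sign \<Phi> j P G * indicat_real G x)) (jumps \<nu> r m (jump (\<nu> j) (indicat_real P)))"
      using ae_on_jumps[OF tw] ae_on_sym[OF ae] by (simp add: j_def)
  qed (auto intro!: bpw_const_sum fin bpw_const_jumps[OF tw] pI)
  also have "jumps \<nu> r m (jump (\<nu> j) (indicat_real P)) = jumps \<nu> r (Suc m) (indicat_real P)"
    unfolding jumps_top j_def ..
  finally show ?case .
qed

lemma flag_weight_flat_int:
  fixes \<Phi> :: "'a::euclidean_space flag"
  assumes "normals r \<Phi> \<nu>" "affine (flat \<Phi> r)" "aff_dim (flat \<Phi> r) = int r" "polyhedral H UNIV P"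
  shows "flag_weight r \<Phi> P = vol_const TYPE('a) r * flat_int (flat \<Phi> r) (jumps \<nu> r (DIM('a) - r) (indicat_real P))"
  using flag_weight_chain_sum[OF assms(1,4)] chain_sum_flat_int[OF assms(1-3), of "DIM('a) - r" H P] assms(1,4)
  by (simp add: normals_def)

text \<open>A surviving jump at one level forces a surviving jump at the level above and a member of
  \<open>H\<close> that cuts the upper flat exactly along the lower one. Hence only finitely many
  flats can carry a nonzero iterated jump, whatever the normals.\<close>

lemma jumps_ae_zero_or_Inter:
  assumes "tower \<nu> V r m" "finite H" "pw_const (V (r + m)) H f" "V (r + m) = UNIV" "\<not> ae_on (V r) (jumps \<nu> r m f) (\<lambda>x. 0)"
  shows "\<exists>S\<subseteq>H. V r = \<Inter>(hplane ` S)"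
  using assms
proof (induction m arbitrary: r)
  case 0
  then show ?case by (intro exI[of _ "{}"]) auto
next
  case (Suc m)
  then have hp: "hplane_in (V (Suc r)) (V r) (\<nu> r)" and t: "tower \<nu> V (Suc r) m" by (auto simp: tower_Suc)
  have "ray_limit n (\<lambda>x. 0) x = 0" for n x :: 'a by (rule ray_limit_eqI) simp
  then have j0: "jump n (\<lambda>x. 0) x = 0" for n x :: 'a by (simp add: jump_def)
  have "\<not> ae_on (V (Suc r)) (jumps \<nu> (Suc r) m f) (\<lambda>x. 0)"
  proof
    assume "ae_on (V (Suc r)) (jumps \<nu> (Suc r) m f) (\<lambda>x. 0)"
    from ae_on_jump[OF hp this] show False using Suc.prems(5) j0 by (simp add: ae_on_def)
  qed
  then obtain S where S: "S \<subseteq> H" "V (Suc r) = \<Inter>(hplane ` S)" using Suc.IH[OF t] Suc.prems by auto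
  have p: "pw_const (V (Suc r)) H (jumps \<nu> (Suc r) m f)" using Suc.prems by (intro pw_const_jumps[OF t]) auto
  obtain h where h: "h \<in> H" "\<not> V (Suc r) \<subseteq> hplane h" "V r \<subseteq> hplane h"
    using jump_ae_zero[OF hp Suc.prems(2) p] Suc.prems(5) by auto
  then have "V r = V (Suc r) \<inter> hplane h" using hplane_in_eq_Int[OF hp] by blast
  then show ?case using S h by (intro exI[of _ "insert h S"]) auto
qed

section \<open>Functions without jumps\<close>

lemma generic_mono: "generic V H x \<Longrightarrow> H' \<subseteq> H \<Longrightarrow> generic V H' x"
  by (auto simp: generic_def)

lemma hplane_in_exists:
  assumes "affine V" "z \<in> V" "z \<in> hplane h" "\<not> V \<subseteq> hplane h"
  shows "\<exists>n. hplane_in V (V \<inter> hplane h) n"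
proof -
  have "halfspace_of V (V \<inter> hplane h) {x\<in>V. fst h \<bullet> x \<ge> snd h}"
    unfolding halfspace_of_def by (rule exI[of _ "fst h"], rule exI[of _ "snd h"]) (auto simp: hplane_def)
  then show ?thesis using halfspace_normal[OF assms(1)] assms by blast
qed

text \<open>Where the function depends only on the side of one hyperplane, a one-sided limit depends
  only on the side into which the ray points; so \<open>n\<close> may be exchanged for a slanted
  direction.\<close>

lemma ray_limit_eq_near:
  assumes "affine V" "z \<in> V" "a \<in> dirs V" "b \<in> dirs V" "e > 0"
    "\<And>y w. y \<in> V \<Longrightarrow> w \<in> V \<Longrightarrow> dist z y < e \<Longrightarrow> dist z w < e \<Longrightarrow> sgn (n \<bullet> (y - z)) = sgn (n \<bullet> (w - z)) \<Longrightarrow> f y = f w"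
    "sgn (n \<bullet> a) = sgn (n \<bullet> b)"
  shows "ray_limit a f z = ray_limit b f z"
proof -
  have "\<forall>\<^sub>F t in at_right 0. norm (0 + t *\<^sub>R v) < e" for v :: 'a
    by (rule eventually_at_right_scale[OF eventually_norm_less]) (use assms in simp)
  from this[of a] this[of b] eventually_at_right_less[of "0::real"]
  have "\<forall>\<^sub>F t in at_right 0. f (z + t *\<^sub>R a) = f (z + t *\<^sub>R b)"
  proof eventually_elim
    case (elim t)
    have "z + t *\<^sub>R a \<in> V" "z + t *\<^sub>R b \<in> V" using assms dirnD dirs_scale by blast+
    then show ?case by (rule assms(6)) (use elim assms(7) in \<open>auto simp: dist_norm sgn_mult\<close>)
  qed
  then have "(\<forall>\<^sub>F t in at_right 0. f (z + t *\<^sub>R a) = c) \<longleftrightarrow> (\<forall>\<^sub>F t in at_right 0. f (z + t *\<^sub>R b) = c)" for c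
    by (auto elim: eventually_elim2)
  then show ?thesis by (simp add: ray_limit_def)
qed

text \<open>By \<open>one\<close>, all members of \<open>H\<close> through \<open>z\<close> that cut
  \<open>V\<close> cut it in the same hyperplane \<open>W\<close>, so near \<open>z\<close> the
  function sees only the two sides of \<open>W\<close>. By \<open>tr\<close> the direction
  \<open>u\<close> is transversal to \<open>W\<close>, and the limits along \<open>u\<close> are
  those along the normal.\<close>

lemma no_jump_crossing:
  assumes V: "affine V" and H: "finite H" "pw_const (V \<inter> ball 0 R) H f"
    and nj: "\<And>W n. hplane_in V W n \<Longrightarrow> ae_on W (jump n f) (\<lambda>_. 0)"
    and z: "z \<in> V" "norm z < R" and u: "u \<in> dirs V"
    and one: "\<And>h h'. h \<in> H \<Longrightarrow> h' \<in> H \<Longrightarrow> z \<in> hplane h \<Longrightarrow> z \<in> hplane h' \<Longrightarrow> \<not> V \<subseteq> hplane h \<Longrightarrow> V \<inter> hplane h \<subseteq> hplane h'"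
    and tr: "\<And>h. h \<in> H \<Longrightarrow> z \<in> hplane h \<Longrightarrow> \<not> V \<subseteq> hplane h \<Longrightarrow> z + s *\<^sub>R u \<notin> hplane h"
  shows "ray_limit u f z = ray_limit (- u) f z"
proof (cases "generic V H z")
  case True
  have "- u \<in> dirs V" using dirs_neg[OF V _ u] z(1) by blast
  then show ?thesis using ray_limit_generic_ball[OF H V z _ True] u by simp
next
  case False
  then obtain h where h: "h \<in> H" "z \<in> hplane h" "\<not> V \<subseteq> hplane h" by (auto simp: generic_def)
  define W where "W = V \<inter> hplane h"
  obtain n where hp: "hplane_in V W n" using hplane_in_exists[OF V z(1) h(2,3)] by (auto simp: W_def)
  have zW: "z \<in> W" using z h by (auto simp: W_def)
  have gen: "generic W H z" unfolding generic_def W_def using one[OF h(1) _ h(2) _ h(3)] by blast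
  obtain e where e: "e > 0" "\<forall>y\<in>V \<inter> ball z e. \<forall>w\<in>V \<inter> ball z e. sgn (n \<bullet> (y - z)) = sgn (n \<bullet> (w - z)) \<longrightarrow> same_cell H y w"
    using generic_local_hplane_in[OF hp H(1) gen zW] by blast
  obtain e' where e': "e' > 0" "\<And>y. y \<in> ball z e' \<Longrightarrow> norm y < R" using nhds_0_ball[OF eventually_norm_less[OF z(2)]] by blast
  have near: "f y = f w" if "y \<in> V" "w \<in> V" "dist z y < min e e'" "dist z w < min e e'" "sgn (n \<bullet> (y - z)) = sgn (n \<bullet> (w - z))" for y w
  proof (rule pcD[OF H(2)])
    show "y \<in> V \<inter> ball 0 R" "w \<in> V \<inter> ball 0 R" using that e'(2) by auto
    show "same_cell H y w" using e(2) that by auto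
  qed
  have nd: "n \<in> dirs V" "- n \<in> dirs V" "- u \<in> dirs V" using hp dirs_neg[OF V _ u] hplane_in_neg[OF hp] z(1) by (auto simp: hplane_in_def)
  have e0: "min e e' > 0" using e(1) e'(1) by simp
  note dl = ray_limit_eq_near[OF V z(1) _ _ e0 near]
  have nu: "n \<bullet> u \<noteq> 0"
  proof
    assume 0: "n \<bullet> u = 0"
    obtain \<beta> where W: "W = {x\<in>V. n \<bullet> x = \<beta>}" using hp by (auto simp: hplane_in_def)
    have "z + s *\<^sub>R u \<in> V" using z(1) u V dirnD dirs_scale by blast
    then have "z + s *\<^sub>R u \<in> W" using W zW 0 by (auto simp: inner_add_right)
    then show False using tr[OF h] by (auto simp: W_def)
  qed
  have nn: "n \<bullet> n > 0" using hp by (simp add: hplane_in_def)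
  \<comment> \<open>The jump is known to vanish only off some hyperplanes of \<open>W\<close>,
    possibly not at \<open>z\<close>. A nearby point \<open>w\<close> of the same cell avoids them,
    and the jump is constant on cells.\<close>
  have j0: "jump n f z = 0"
  proof -
    obtain G where G: "finite G" "\<forall>h\<in>G. \<not> W \<subseteq> hplane h" "\<forall>x\<in>W. norm x < R \<longrightarrow> (\<forall>h\<in>G. x \<notin> hplane h) \<longrightarrow> jump n f x = 0"
      using nj[OF hp] unfolding ae_on_def by metis
    obtain d where d: "d > 0" "\<forall>y\<in>W \<inter> ball z d. same_cell H z y" using generic_local[OF H(1) gen zW] by blast
    obtain w where w: "w \<in> W" "dist z w < min d e'" "generic W G w"
      using generic_dense[OF G(1) hplane_in_affine[OF hp] zW, of "min d e'"] d(1) e'(1) by auto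
    have "norm w < R" using e'(2) w by auto
    then have "jump n f w = 0" using G w unfolding generic_def by blast
    moreover have "pw_const (V \<inter> ball 0 R) H (jump n f)" unfolding jump_def[abs_def]
      using nd by (intro pw_const_diff pw_const_ray_limit_ball H V)
    then have "jump n f z = jump n f w"
      by (rule pcD) (use z w \<open>norm w < R\<close> hplane_in_subset[OF hp] d(2) in auto)
    ultimately show ?thesis by simp
  qed
  then have jj: "ray_limit n f z = ray_limit (- n) f z" by (simp add: jump_def)
  show ?thesis
  proof (cases "n \<bullet> u > 0")
    case True
    then have "ray_limit u f z = ray_limit n f z" "ray_limit (- u) f z = ray_limit (- n) f z"
      using sgn_pos[OF nn] sgn_pos[OF True] nd u by (auto intro!: dl simp: sgn_minus)
    then show ?thesis using jj by simp
  next
    case False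
    then have "sgn (n \<bullet> u) = - 1" using nu by simp
    then have "ray_limit u f z = ray_limit (- n) f z" "ray_limit (- u) f z = ray_limit n f z"
      using sgn_pos[OF nn] nd u by (auto intro!: dl simp: sgn_minus)
    then show ?thesis using jj by simp
  qed
qed

text \<open>Move \<open>y\<close> inside its cell so that the segment from \<open>x\<close> to \<open>y\<close> crosses the hyperplanes one at a time. The
  hyperplanes \<open>join h h'\<close> to be avoided are spanned by \<open>x\<close> and the intersection of \<open>h\<close> and \<open>h'\<close>.\<close>

lemma no_jump_generic_eq:
  fixes f :: "'a::euclidean_space \<Rightarrow> real"
  assumes V: "affine V" and H: "finite H" "pw_const (V \<inter> ball 0 R) H f"
    and nj: "\<And>W n. hplane_in V W n \<Longrightarrow> ae_on W (jump n f) (\<lambda>_. 0)"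
    and x: "x \<in> V" "norm x < R" "generic V H x" and y: "y \<in> V" "norm y < R" "generic V H y"
  shows "f x = f y"
proof -
  define join where "join h h' = ((snd h' - fst h' \<bullet> x) *\<^sub>R fst h - (snd h - fst h \<bullet> x) *\<^sub>R fst h',
     ((snd h' - fst h' \<bullet> x) *\<^sub>R fst h - (snd h - fst h \<bullet> x) *\<^sub>R fst h') \<bullet> x)" for h h' :: "'a \<times> real"
  define H2 where "H2 = (\<lambda>(h, h'). join h h') ` (H \<times> H)"
  obtain e where e: "e > 0" "\<forall>w\<in>V \<inter> ball y e. same_cell H y w" using generic_local[OF H(1) y(3) y(1)] by blast
  obtain e' where e': "e' > 0" "\<And>w. w \<in> ball y e' \<Longrightarrow> norm w < R" using nhds_0_ball[OF eventually_norm_less[OF y(2)]] by blast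
  obtain y' where y': "y' \<in> V" "dist y y' < min e e'" "generic V (H \<union> H2) y'"
    using generic_dense[of "H \<union> H2" V y "min e e'"] H(1) V y(1) e(1) e'(1) by (auto simp: H2_def)
  have ny': "norm y' < R" using y' e'(2) by auto
  have fy: "f y = f y'" by (rule pcD[OF H(2)]) (use y y' ny' e(2) in auto)
  have gy': "generic V H y'" "generic V H2 y'" using y'(3) generic_mono by blast+
  define u where "u = y' - x"
  have u: "u \<in> dirs V" using dirs_diff[OF V y'(1) x(1)] by (simp add: u_def)
  define Z where "Z s = x + s *\<^sub>R u" for s :: real
  have Zc: "Z s = (1 - s) *\<^sub>R x + s *\<^sub>R y'" for s by (simp add: Z_def u_def algebra_simps)
  have ZV: "Z s \<in> V" for s unfolding Z_def using x(1) u V dirnD dirs_scale by blast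
  have ZR: "norm (Z s) < R" if "s \<in> {0..1}" for s
  proof -
    have "Z s \<in> ball 0 R" unfolding Zc by (rule convexD[OF convex_ball]) (use that x ny' in auto)
    then show ?thesis by simp
  qed
  \<comment> \<open>Going back by \<open>s\<close> along \<open>u\<close> leads to \<open>x\<close>,
    which lies on no member of \<open>H\<close> that cuts \<open>V\<close>; this gives
    transversality.\<close>
  have cross: "ray_limit u f (Z s) = ray_limit (- u) f (Z s)" if s: "s \<in> {0..1}" for s
  proof (rule no_jump_crossing[OF V H nj ZV ZR[OF s] u, where s = "- s"])
    fix h assume "h \<in> H" "Z s \<in> hplane h" "\<not> V \<subseteq> hplane h"
    then show "Z s + (- s) *\<^sub>R u \<notin> hplane h" using x(3) by (auto simp: Z_def generic_def)
  next
    fix h h' assume hh: "h \<in> H" "h' \<in> H" "Z s \<in> hplane h" "Z s \<in> hplane h'" "\<not> V \<subseteq> hplane h"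
    show "V \<inter> hplane h \<subseteq> hplane h'"
    proof (cases "V \<subseteq> hplane h'")
      case False
      \<comment> \<open>The segment meets \<open>h\<close> and \<open>h'\<close> at the same
        parameter \<open>s\<close>. Eliminating \<open>s\<close> from the two equations puts
        \<open>y'\<close> on \<open>join h h'\<close>; as \<open>y'\<close> is generic, this holds
        for all of \<open>V\<close>, and then \<open>h'\<close> contains the points of
        \<open>V\<close> on \<open>h\<close>.\<close>
      define \<alpha> \<alpha>' where "\<alpha> = snd h - fst h \<bullet> x" and "\<alpha>' = snd h' - fst h' \<bullet> x"
      have nz: "\<alpha> \<noteq> 0" "\<alpha>' \<noteq> 0" using x(3) hh False by (auto simp: generic_def \<alpha>_def \<alpha>'_def hplane_def)
      have su: "s * (fst h \<bullet> u) = \<alpha>" "s * (fst h' \<bullet> u) = \<alpha>'" using hh by (auto simp: hplane_def Z_def \<alpha>_def \<alpha>'_def inner_add_right)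
      then have "s \<noteq> 0" using nz by auto
      have "s * ((\<alpha>' *\<^sub>R fst h - \<alpha> *\<^sub>R fst h') \<bullet> u) = \<alpha>' * (s * (fst h \<bullet> u)) - \<alpha> * (s * (fst h' \<bullet> u))"
        by (simp add: inner_diff_left algebra_simps)
      then have "(\<alpha>' *\<^sub>R fst h - \<alpha> *\<^sub>R fst h') \<bullet> u = 0" using su \<open>s \<noteq> 0\<close> by simp
      then have "y' \<in> hplane (join h h')" by (simp add: hplane_def join_def u_def inner_diff_right \<alpha>_def \<alpha>'_def)
      moreover have "join h h' \<in> H2" using hh by (auto simp: H2_def)
      ultimately have VH: "V \<subseteq> hplane (join h h')" using gy'(2) by (auto simp: generic_def)
      show ?thesis
      proof
        fix v assume v: "v \<in> V \<inter> hplane h"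
        then have "(\<alpha>' *\<^sub>R fst h - \<alpha> *\<^sub>R fst h') \<bullet> v = (\<alpha>' *\<^sub>R fst h - \<alpha> *\<^sub>R fst h') \<bullet> x"
          using VH by (auto simp: hplane_def join_def \<alpha>_def \<alpha>'_def)
        then have "\<alpha>' * (fst h \<bullet> v - fst h \<bullet> x) = \<alpha> * (fst h' \<bullet> v - fst h' \<bullet> x)"
          by (simp add: inner_diff_left algebra_simps)
        moreover have "fst h \<bullet> v - fst h \<bullet> x = \<alpha>" using v by (simp add: hplane_def \<alpha>_def)
        ultimately have "fst h' \<bullet> v - fst h' \<bullet> x = \<alpha>'" using nz by simp
        then show "v \<in> hplane h'" by (simp add: hplane_def \<alpha>'_def)
      qed
    qed auto
  qed
  \<comment> \<open>Values of \<open>f\<close> at crossings are arbitrary, so constancy is shown for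
    a one-sided limit; it agrees with \<open>f\<close> at the two ends because these are
    generic.\<close>
  define \<psi> where "\<psi> s = ray_limit u f (Z s)" for s
  have Zadd: "Z (s + t) = Z s + t *\<^sub>R u" "Z (s - t) = Z s + t *\<^sub>R (- u)" for s t by (auto simp: Z_def algebra_simps)
  have ex: "\<forall>\<^sub>F t in at_right 0. f (Z s + t *\<^sub>R v) = ray_limit v f (Z s)" if s: "s \<in> {0..1}" and v: "v \<in> dirs V" for s v
    by (rule ray_limit_ex_ball[OF H V ZV ZR[OF s] v])
  have "\<psi> constant_on {0..1}"
  proof (rule locally_constant_imp_constant)
    fix a :: real assume a: "a \<in> {0..1}"
    have nu: "- u \<in> dirs V" using dirs_neg[OF V _ u] x(1) by blast
    have "\<forall>\<^sub>F t in at_right 0. f (Z (a + t)) = \<psi> a \<and> f (Z (a - t)) = \<psi> a"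
      unfolding Zadd \<psi>_def using ex[OF a u] ex[OF a nu] cross[OF a] by (simp add: eventually_conj)
    then obtain d where d: "d > 0" "\<And>t. 0 < t \<Longrightarrow> t < d \<Longrightarrow> f (Z (a + t)) = \<psi> a \<and> f (Z (a - t)) = \<psi> a"
      unfolding eventually_at_right_field by auto
    have fz: "f (Z b) = \<psi> a" if "b \<noteq> a" "\<bar>b - a\<bar> < d" for b
      using d(2)[of "b - a"] d(2)[of "a - b"] that by (cases "b > a") auto
    have "\<psi> s = \<psi> a" if s: "s \<in> {a - d<..<a + d}" for s
    proof (cases "s = a")
      case False
      show ?thesis unfolding \<psi>_def[of s]
      proof (rule ray_limit_eqI)
        \<comment> \<open>Short enough for the ray from \<open>s\<close> to stay within distance
          \<open>d\<close> of \<open>a\<close> without reaching \<open>a\<close> itself, where the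
          value of \<open>f\<close> is unknown.\<close>
        define q where "q = (if s < a then a - s else a + d - s)"
        have "q > 0" using s False by (auto simp: q_def)
        moreover have "f (Z s + t *\<^sub>R u) = \<psi> a" if "0 < t" "t < q" for t
          unfolding Zadd(1)[symmetric] by (rule fz) (use that s False in \<open>auto simp: q_def split: if_splits\<close>)
        ultimately show "\<forall>\<^sub>F t in at_right 0. f (Z s + t *\<^sub>R u) = \<psi> a" unfolding eventually_at_right_field by blast
      qed
    qed simp
    then have "\<forall>s\<in>{0..1} \<inter> {a - d<..<a + d}. \<psi> s = \<psi> a" by blast
    moreover have "openin (top_of_set {0..1}) ({0..1} \<inter> {a - d<..<a + d})" by (simp add: openin_open_Int)
    moreover have "a \<in> {0..1} \<inter> {a - d<..<a + d}" using a d(1) by simp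
    ultimately show "\<exists>T. openin (top_of_set {0..1}) T \<and> a \<in> T \<and> (\<forall>s\<in>T. \<psi> s = \<psi> a)" by blast
  qed auto
  then have "\<psi> 0 = \<psi> 1" by (force simp: constant_on_def)
  moreover have "\<psi> s = f (Z s)" if s: "s \<in> {0..1}" "generic V H (Z s)" for s
    unfolding \<psi>_def by (rule ray_limit_generic_ball[OF H V ZV ZR[OF s(1)] u s(2)])
  from this[of 0] this[of 1] have "\<psi> 0 = f x" "\<psi> 1 = f y'" using x(3) gy'(1) by (auto simp: Z_def u_def)
  ultimately show ?thesis using fy by simp
qed

text \<open>Each radius has its own arrangement of hyperplanes, whereas the constant must not depend
  on the radius: it is fixed as the value at one generic point \<open>x0\<close> of the smallest
  ball.\<close>

lemma no_jump_const:
  fixes f :: "'a::euclidean_space \<Rightarrow> real"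
  assumes V: "affine V" "V \<noteq> {}" and f: "lpw_const V f"
    and nj: "\<And>W n. hplane_in V W n \<Longrightarrow> ae_on W (jump n f) (\<lambda>_. 0)"
  shows "\<exists>c. ae_on V f (\<lambda>_. c)"
proof -
  obtain H where H: "\<And>R. finite (H R)" "\<And>R. pw_const (V \<inter> ball 0 R) (H R) f" using f unfolding lpw_const_def by metis
  obtain p where p: "p \<in> V" using V by blast
  define R0 where "R0 = norm p + 1"
  have nr: "\<exists>e>0. \<forall>y\<in>ball p e. norm y < R0" by (rule nhds_0_ball[OF eventually_norm_less]) (simp add: R0_def)
  then obtain e where e: "e > 0" "\<And>y. y \<in> ball p e \<Longrightarrow> norm y < R0" by blast
  obtain x0 where x0: "x0 \<in> V" "dist p x0 < e" "generic V (H R0) x0" using generic_dense[OF H(1) V(1) p e(1)] by blast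
  have "f x = f x0" if x: "x \<in> V" "norm x < R" "generic V (H R) x" and R: "R \<ge> R0" for x R
  proof -
    \<comment> \<open>A mediator near \<open>p\<close>, generic for the arrangements of both
      radii.\<close>
    obtain y where y: "y \<in> V" "dist p y < e" "generic V (H R0 \<union> H R) y"
      using generic_dense[OF _ V(1) p e(1), of "H R0 \<union> H R"] H(1) by auto
    have ny: "norm y < R0" "norm y < R" using e(2)[of y] y R by auto
    have "f x = f y" by (rule no_jump_generic_eq[OF V(1) H(1,2) nj x y(1) ny(2) generic_mono[OF y(3)]]) auto
    moreover have "f x0 = f y"
      by (rule no_jump_generic_eq[OF V(1) H(1,2) nj x0(1) _ x0(3) y(1) ny(1) generic_mono[OF y(3)]]) (use e(2) x0 in auto)
    ultimately show ?thesis by simp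
  qed
  note eq = this
  have "ae_on V f (\<lambda>_. f x0)" unfolding ae_on_def
  proof
    fix R
    define R' where "R' = max R R0"
    show "\<exists>H. finite H \<and> (\<forall>h\<in>H. \<not> V \<subseteq> hplane h) \<and> (\<forall>x\<in>V. norm x < R \<longrightarrow> (\<forall>h\<in>H. x \<notin> hplane h) \<longrightarrow> f x = f x0)"
    proof (intro exI[of _ "{h\<in>H R'. \<not> V \<subseteq> hplane h}"] conjI ballI impI)
      fix x assume x: "x \<in> V" "norm x < R" "\<forall>h\<in>{h \<in> H R'. \<not> V \<subseteq> hplane h}. x \<notin> hplane h"
      show "f x = f x0" by (rule eq[of x R']) (use x in \<open>auto simp: R'_def generic_def\<close>)
    qed (use H(1) in auto)
  qed
  then show ?thesis by blast
qed

section \<open>Periodization\<close>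

text \<open>For functions supported in the ball of radius \<open>\<rho>\<close> this is the sum over all of \<open>L\<close>; the cut-off keeps the
  sum finite.\<close>

definition periodize :: "'a::euclidean_space set \<Rightarrow> real \<Rightarrow> ('a \<Rightarrow> real) \<Rightarrow> 'a \<Rightarrow> real" where
  "periodize L \<rho> f x = (\<Sum>l\<in>{l\<in>L. norm (x + l) \<le> \<rho>}. f (x + l))"

lemma bpw_const_mono: "bpw_const V f \<Longrightarrow> W \<subseteq> V \<Longrightarrow> bpw_const W f"
  unfolding bpw_const_def by (meson order_refl pw_const_mono subsetD)

lemma bpw_const_shift:
  assumes "bpw_const UNIV f" shows "bpw_const V (\<lambda>x. f (x + l))"
proof -
  have "bpw_const V (\<lambda>x. f (l + x))" by (rule bpw_const_translate[OF bpw_const_mono[OF assms]]) auto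
  then show ?thesis by (simp add: add.commute)
qed

lemma ae_on_witness:
  assumes "ae_on V f g" "affine V" "x \<in> V" "e > 0"
  shows "\<exists>y\<in>V. dist x y < e \<and> f y = g y"
proof -
  obtain H where H: "finite H" "\<forall>h\<in>H. \<not> V \<subseteq> hplane h" "\<forall>y\<in>V. norm y < norm x + e \<longrightarrow> (\<forall>h\<in>H. y \<notin> hplane h) \<longrightarrow> f y = g y"
    using assms(1) unfolding ae_on_def by metis
  obtain y where y: "y \<in> V" "dist x y < e" "generic V H y" using generic_dense[OF H(1) assms(2-4)] by blast
  have "norm y \<le> norm x + dist x y" by (metis dist_norm norm_minus_commute norm_triangle_sub)
  then have "norm y < norm x + e" using y by linarith
  then show ?thesis using y H by (auto simp: generic_def)
qed

lemma ae_on_translate: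
  assumes "ae_on ((+) l ` V) f g"
  shows "ae_on V (\<lambda>x. f (x + l)) (\<lambda>x. g (x + l))"
  unfolding ae_on_def
proof
  fix R
  obtain H where H: "finite H" "\<forall>h\<in>H. \<not> (+) l ` V \<subseteq> hplane h" "\<forall>y\<in>(+) l ` V. norm y < R + norm l \<longrightarrow> (\<forall>h\<in>H. y \<notin> hplane h) \<longrightarrow> f y = g y"
    using assms(1) unfolding ae_on_def by metis
  let ?k = "\<lambda>h::'a \<times> real. (fst h, snd h - fst h \<bullet> l)"
  have k: "x \<in> hplane (?k h) \<longleftrightarrow> l + x \<in> hplane h" for x h by (auto simp: hplane_def inner_add_right)
  show "\<exists>H. finite H \<and> (\<forall>h\<in>H. \<not> V \<subseteq> hplane h) \<and> (\<forall>x\<in>V. norm x < R \<longrightarrow> (\<forall>h\<in>H. x \<notin> hplane h) \<longrightarrow> f (x + l) = g (x + l))"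
  proof (intro exI[of _ "?k ` H"] conjI ballI impI)
    fix h assume "h \<in> ?k ` H"
    then show "\<not> V \<subseteq> hplane h" using H(2) k by blast
  next
    fix x assume x: "x \<in> V" "norm x < R" "\<forall>h\<in>?k ` H. x \<notin> hplane h"
    have "norm (l + x) < R + norm l" using norm_triangle_ineq[of l x] x(2) by linarith
    then have "f (l + x) = g (l + x)" using H(3) x(1,3) k by blast
    then show "f (x + l) = g (x + l)" by (simp add: add.commute)
  qed (use H in auto)
qed

lemma translate_eq_iff:
  assumes "affine V" "V \<noteq> {}"
  shows "(+) l ` V = (+) l' ` V \<longleftrightarrow> l - l' \<in> dirs V"
proof
  assume eq: "(+) l ` V = (+) l' ` V"
  obtain p where p: "p \<in> V" using assms by blast
  then have "l + p \<in> (+) l' ` V" using eq by blast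
  then obtain v where "v \<in> V" "l + p = l' + v" by blast
  then have "l - l' = v - p" "v - p \<in> dirs V" using dirs_diff[OF assms(1) _ p] by (auto simp: algebra_simps)
  then show "l - l' \<in> dirs V" by simp
next
  assume d: "l - l' \<in> dirs V"
  have sub: "(+) a ` V \<subseteq> (+) b ` V" if "a - b \<in> dirs V" for a b
  proof
    fix x assume "x \<in> (+) a ` V"
    then obtain v where "v \<in> V" "x = a + v" by blast
    then have "v + (a - b) \<in> V" "x = b + (v + (a - b))" using dirnD[OF that] by auto
    then show "x \<in> (+) b ` V" by blast
  qed
  moreover have "l' - l \<in> dirs V" using dirs_neg[OF assms d] by simp
  ultimately show "(+) l ` V = (+) l' ` V" using d by blast
qed

lemma flat_int_zero: "flat_int V (\<lambda>x. 0) = 0"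
  by (simp add: flat_int_def)

text \<open>A cube rather than a ball, so that the cut-off function is piecewise constant.\<close>

lemma box_polyhedral:
  "\<exists>H. polyhedral H UNIV {x::'a::euclidean_space. \<forall>b\<in>Basis. \<bar>x \<bullet> b\<bar> \<le> r}"
proof -
  let ?K = "{x::'a. \<forall>b\<in>Basis. \<bar>x \<bullet> b\<bar> \<le> r}"
  have K: "?K = cbox (\<Sum>b\<in>Basis. (- r) *\<^sub>R b) (\<Sum>b\<in>Basis. r *\<^sub>R b)"
    by (auto simp: mem_box inner_sum_left_Basis abs_le_iff minus_le_iff simp del: scaleR_minus_left)
  let ?H = "(\<lambda>b::'a. (b, r)) ` Basis \<union> (\<lambda>b. (b, - r)) ` Basis"
  have K2: "x \<in> ?K \<longleftrightarrow> (\<forall>b\<in>Basis. side (b, r) x \<noteq> 1 \<and> side (b, -r) x \<noteq> -1)" for x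
    by (auto simp: side_def sgn_if inner_commute abs_le_iff split: if_splits)
  have "pw_const UNIV ?H (\<lambda>x. x \<in> ?K)"
    unfolding pw_const_def K2 same_cell_def by auto
  moreover have "closed ?K" "bounded ?K" unfolding K by (auto simp: closed_cbox bounded_cbox)
  moreover have "finite ?H" by simp
  ultimately show ?thesis unfolding polyhedral_def by blast
qed

locale discrete_group =
  fixes L :: "'a::euclidean_space set"
  assumes zero: "0 \<in> L" and add: "\<And>x y. x \<in> L \<Longrightarrow> y \<in> L \<Longrightarrow> x + y \<in> L" and uminus: "\<And>x. x \<in> L \<Longrightarrow> - x \<in> L"
    and fin: "\<And>R. finite {l\<in>L. norm l \<le> R}"
begin

lemma diff: "x \<in> L \<Longrightarrow> y \<in> L \<Longrightarrow> x - y \<in> L"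
  using add[of x "- y"] uminus[of y] by simp

lemma int_scale: "x \<in> L \<Longrightarrow> of_int k *\<^sub>R x \<in> L"
proof (induction k rule: int_induct[where k = 0])
  case base
  then show ?case using zero by simp
next
  case (step1 i)
  then show ?case using add[of "of_int i *\<^sub>R x" x] by (simp add: algebra_simps)
next
  case (step2 i)
  then show ?case using diff[of "of_int i *\<^sub>R x" x] by (simp add: algebra_simps)
qed

lemma translate_ball_subset:
  assumes "norm x \<le> R" shows "{l\<in>L. norm (x + l) \<le> \<rho>} \<subseteq> {l\<in>L. norm l \<le> R + \<rho>}"
proof clarify
  fix l assume "norm (x + l) \<le> \<rho>"
  moreover have "norm l \<le> norm (x + l) + norm x" by (metis add_diff_cancel_left' norm_triangle_ineq4)
  ultimately show "norm l \<le> R + \<rho>" using assms by linarith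
qed

lemma fin_translate: "finite {l\<in>L. norm (x + l) \<le> \<rho>}"
  using translate_ball_subset[OF order_refl] fin finite_subset by blast

text \<open>The index set on the right depends on the radius only: on a ball the periodization is
  one fixed finite sum of shifts, and properties of finite sums apply.\<close>

lemma periodize_eq:
  assumes "\<And>y. norm y > \<rho> \<Longrightarrow> f y = 0" "norm x \<le> R"
  shows "periodize L \<rho> f x = (\<Sum>l\<in>{l\<in>L. norm l \<le> R + \<rho>}. f (x + l))"
  unfolding periodize_def
proof (rule sum.mono_neutral_left[OF fin])
  show "{l\<in>L. norm (x + l) \<le> \<rho>} \<subseteq> {l\<in>L. norm l \<le> R + \<rho>}" by (rule translate_ball_subset[OF assms(2)])
  show "\<forall>l\<in>{l\<in>L. norm l \<le> R + \<rho>} - {l\<in>L. norm (x + l) \<le> \<rho>}. f (x + l) = 0"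
  proof
    fix l assume "l \<in> {l\<in>L. norm l \<le> R + \<rho>} - {l\<in>L. norm (x + l) \<le> \<rho>}"
    then have "norm (x + l) > \<rho>" by auto
    then show "f (x + l) = 0" by (rule assms(1))
  qed
qed

lemma periodize_lpw_const:
  assumes "\<And>y. norm y > \<rho> \<Longrightarrow> f y = 0" "finite H" "pw_const UNIV H f"
  shows "lpw_const UNIV (periodize L \<rho> f)"
  unfolding lpw_const_def
proof
  fix R
  let ?\<Lambda> = "{l\<in>L. norm l \<le> R + \<rho>}"
  have "bpw_const UNIV f" using assms unfolding bpw_const_def by blast
  then have "bpw_const UNIV (\<lambda>x. \<Sum>l\<in>?\<Lambda>. 1 * f (x + l))" by (intro bpw_const_sum fin bpw_const_shift)
  then obtain G where G: "finite G" "pw_const UNIV G (\<lambda>x. \<Sum>l\<in>?\<Lambda>. f (x + l))" by (auto simp: bpw_const_def)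
  have "pw_const (UNIV \<inter> ball 0 R) G (periodize L \<rho> f)"
    unfolding pw_const_def
  proof (intro ballI impI)
    fix x y assume xy: "x \<in> UNIV \<inter> ball 0 R" "y \<in> UNIV \<inter> ball 0 R" "same_cell G x y"
    then have "periodize L \<rho> f x = (\<Sum>l\<in>?\<Lambda>. f (x + l))" "periodize L \<rho> f y = (\<Sum>l\<in>?\<Lambda>. f (y + l))"
      by (intro periodize_eq assms(1); simp)+
    then show "periodize L \<rho> f x = periodize L \<rho> f y" using pcD[OF G(2) _ _ xy(3)] by simp
  qed
  then show "\<exists>H. finite H \<and> pw_const (UNIV \<inter> ball 0 R) H (periodize L \<rho> f)" using G(1) by blast
qed

lemma periodize_ray_limit:
  assumes van: "\<And>y. norm y > \<rho> \<Longrightarrow> f y = 0" and "finite H" "pw_const UNIV H f"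
  shows "ray_limit n (periodize L \<rho> f) x = periodize L \<rho> (ray_limit n f) x"
proof (rule ray_limit_eqI)
  define R where "R = norm x + 1"
  let ?\<Lambda> = "{l\<in>L. norm l \<le> R + \<rho>}"
  have l: "lpw_const UNIV f" using assms pw_const_imp_lpw_const by blast
  have "\<forall>\<^sub>F t in at_right 0. norm (x + t *\<^sub>R n) < R"
    by (rule eventually_at_right_scale[OF eventually_norm_less]) (simp add: R_def)
  moreover have "\<forall>\<^sub>F t in at_right 0. \<forall>l\<in>?\<Lambda>. f (x + l + t *\<^sub>R n) = ray_limit n f (x + l)"
    using fin ray_limit_ex[OF l affine_UNIV] by (intro eventually_ball_finite) auto
  ultimately show "\<forall>\<^sub>F t in at_right 0. periodize L \<rho> f (x + t *\<^sub>R n) = periodize L \<rho> (ray_limit n f) x"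
  proof eventually_elim
    case (elim t)
    have "periodize L \<rho> f (x + t *\<^sub>R n) = (\<Sum>l\<in>?\<Lambda>. f (x + t *\<^sub>R n + l))" by (rule periodize_eq[OF van]) (use elim in auto)
    also have "\<dots> = (\<Sum>l\<in>?\<Lambda>. ray_limit n f (x + l))" using elim(2) by (intro sum.cong) (auto simp: algebra_simps)
    also have "\<dots> = periodize L \<rho> (ray_limit n f) x"
      by (rule periodize_eq[symmetric]) (use ray_limit_vanish[of UNIV \<rho> f] van in \<open>auto simp: R_def\<close>)
    finally show ?case .
  qed
qed

lemma periodize_jump:
  assumes van: "\<And>y. norm y > \<rho> \<Longrightarrow> f y = 0" and "finite H" "pw_const UNIV H f"
  shows "jump n (periodize L \<rho> f) x = periodize L \<rho> (jump n f) x"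
proof -
  have "ray_limit m (periodize L \<rho> f) x = periodize L \<rho> (ray_limit m f) x" for m by (rule periodize_ray_limit[OF assms])
  then show ?thesis unfolding jump_def by (simp add: periodize_def sum_subtractf)
qed

text \<open>Subtract the integer parts of the coordinates in a basis taken from the stabilizer; what
  remains is bounded by \<open>p\<close> and the basis vectors.\<close>

lemma cocompact:
  assumes "affine V" "V \<noteq> {}" "span (L \<inter> dirs V) = dirs V"
  shows "\<exists>r. \<forall>x\<in>V. \<exists>\<mu>\<in>L \<inter> dirs V. norm (x + \<mu>) \<le> r"
proof -
  obtain p where p: "p \<in> V" using assms by blast
  obtain B where B: "B \<subseteq> L \<inter> dirs V" "independent B" "L \<inter> dirs V \<subseteq> span B" using maximal_independent_subset by metis
  have "finite B" using B(2) independent_imp_finite by blast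
  have sB: "dirs V \<subseteq> span B" using assms(3) B(3) by (metis span_minimal subspace_span)
  have sd: "subspace (dirs V)" using assms subspace_dirs by blast
  show ?thesis
  proof (intro exI[of _ "norm p + (\<Sum>b\<in>B. norm b)"] ballI)
    fix x assume "x \<in> V"
    then have "x - p \<in> span B" using dirs_diff[OF assms(1) _ p] sB by blast
    then obtain t where t: "x - p = (\<Sum>b\<in>B. t b *\<^sub>R b)" using span_finite[OF \<open>finite B\<close>] by auto
    define \<mu> where "\<mu> = (\<Sum>b\<in>B. of_int (- \<lfloor>t b\<rfloor>) *\<^sub>R b)"
    have "\<mu> \<in> dirs V" unfolding \<mu>_def using B(1) by (intro subspace_sum[OF sd] subspace_scale[OF sd]) auto
    moreover have "\<mu> \<in> L" unfolding \<mu>_def using \<open>finite B\<close> B(1)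
    proof (induction B)
      case (insert b B)
      then show ?case using add[of "of_int (- \<lfloor>t b\<rfloor>) *\<^sub>R b"] int_scale[of b "- \<lfloor>t b\<rfloor>"] by simp
    qed (simp add: zero)
    moreover have "norm (x + \<mu>) \<le> norm p + (\<Sum>b\<in>B. norm b)"
    proof -
      have "x + \<mu> = p + (\<Sum>b\<in>B. (t b - of_int \<lfloor>t b\<rfloor>) *\<^sub>R b)"
      proof -
        have "x = p + (\<Sum>b\<in>B. t b *\<^sub>R b)" using t by (metis add.commute diff_add_cancel)
        then show ?thesis by (simp add: \<mu>_def scaleR_diff_left sum_subtractf sum_negf)
      qed
      moreover have "norm (\<Sum>b\<in>B. (t b - of_int \<lfloor>t b\<rfloor>) *\<^sub>R b) \<le> (\<Sum>b\<in>B. norm b)"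
      proof (rule sum_norm_le)
        fix b
        have "0 \<le> t b - of_int \<lfloor>t b\<rfloor>" "t b - of_int \<lfloor>t b\<rfloor> \<le> 1" by linarith+
        then show "norm ((t b - of_int \<lfloor>t b\<rfloor>) *\<^sub>R b) \<le> norm b" by (simp add: mult_left_le_one_le)
      qed
      moreover have "norm (p + (\<Sum>b\<in>B. (t b - of_int \<lfloor>t b\<rfloor>) *\<^sub>R b)) \<le> norm p + norm (\<Sum>b\<in>B. (t b - of_int \<lfloor>t b\<rfloor>) *\<^sub>R b)"
        by (rule norm_triangle_ineq)
      ultimately show ?thesis by simp
    qed
    ultimately show "\<exists>\<mu>\<in>L \<inter> dirs V. norm (x + \<mu>) \<le> norm p + (\<Sum>b\<in>B. norm b)" by blast
  qed
qed

text \<open>A set of flats rather than a family over \<open>L\<close>, so that a flat reached by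
  several lattice vectors counts once, as in the Hadwiger functional.\<close>

definition translates :: "'a set \<Rightarrow> 'a set set" where
  "translates V = (\<lambda>l. (+) l ` V) ` L"

text \<open>If the stabilizer \<open>L \<inter> dirs V\<close> does not span \<open>dirs V\<close>, the periodization vanishes far away in a direction
  orthogonal to it, because only finitely many translates of \<open>V\<close> carry \<open>f\<close>.\<close>

lemma const_zero_thin:
  assumes V: "affine V" "V \<noteq> {}" and "span (L \<inter> dirs V) \<noteq> dirs V"
    and van: "\<And>y. norm y > \<rho> \<Longrightarrow> f y = 0"
    and c: "ae_on V (periodize L \<rho> f) (\<lambda>_. c)"
    and fin0: "finite {U\<in>translates V. \<not> ae_on U f (\<lambda>_. 0)}"
  shows "c = 0"
proof -
  define E where "E = {U\<in>translates V. \<not> ae_on U f (\<lambda>_. 0)}"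
  have sd: "subspace (dirs V)" using V subspace_dirs by blast
  have "span (L \<inter> dirs V) \<subset> span (dirs V)" using assms(3) sd by (metis inf_le2 psubsetI span_eq_iff span_mono)
  then obtain u where u: "u \<noteq> 0" "u \<in> span (dirs V)" "\<And>y. y \<in> span (L \<inter> dirs V) \<Longrightarrow> orthogonal u y"
    using orthogonal_to_subspace_exists_gen by metis
  have ud: "u \<in> dirs V" using u(2) sd by (metis span_eq_iff)
  obtain rep where rep: "\<And>U. U \<in> translates V \<Longrightarrow> rep U \<in> L \<and> U = (+) (rep U) ` V"
  proof -
    have "\<exists>l. l \<in> L \<and> U = (+) l ` V" if "U \<in> translates V" for U using that by (auto simp: translates_def)
    then show thesis using that by metis
  qed
  \<comment> \<open>Bounds \<open>u \<bullet> l\<close> for every \<open>l\<close> whose translate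
    of \<open>V\<close> carries \<open>f\<close>: such an \<open>l\<close> differs from the chosen
    representative by a stabilizer vector, which is orthogonal to \<open>u\<close>.\<close>
  define M where "M = (\<Sum>U\<in>E. \<bar>u \<bullet> rep U\<bar>)"
  have M: "\<bar>u \<bullet> rep U\<bar> \<le> M" if "U \<in> E" for U
    unfolding M_def using fin0 that by (intro member_le_sum) (auto simp: E_def)
  obtain p where p: "p \<in> V" using V by blast
  \<comment> \<open>Gives \<open>u \<bullet> x = M + norm u * \<rho> + norm u + 1\<close>. The term
    \<open>M\<close> pays for the shift by \<open>l\<close>, the last \<open>norm u\<close> for
    moving from \<open>x\<close> to a point at distance less than 1, and the rest pushes
    \<open>y + l\<close> beyond radius \<open>\<rho>\<close>.\<close>
  define t where "t = (M + norm u * \<rho> + norm u + 1 - u \<bullet> p) / (u \<bullet> u)"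
  define x where "x = p + t *\<^sub>R u"
  have x: "x \<in> V" unfolding x_def using p ud V dirnD dirs_scale by blast
  have ux: "u \<bullet> x = M + norm u * \<rho> + norm u + 1" using u(1) by (simp add: x_def t_def inner_add_right)
  define R where "R = norm x + 1"
  let ?\<Lambda> = "{l\<in>L. norm l \<le> R + \<rho>}"
  \<comment> \<open>The indices whose translate of \<open>V\<close> does not carry \<open>f\<close>;
    their terms vanish off hyperplanes and are subtracted before a good point \<open>y\<close> near
    \<open>x\<close> is picked.\<close>
  let ?Z = "{l\<in>?\<Lambda>. (+) l ` V \<notin> E}"
  have "ae_on V (\<lambda>x. \<Sum>l\<in>?Z. f (x + l)) (\<lambda>x. \<Sum>l\<in>?Z. 0)"
  proof (rule ae_on_sum)
    show "finite ?Z" by (rule finite_subset[OF _ fin[of "R + \<rho>"]]) auto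
    fix l assume "l \<in> ?Z"
    then have "ae_on ((+) l ` V) f (\<lambda>_. 0)" by (auto simp: E_def translates_def)
    then show "ae_on V (\<lambda>x. f (x + l)) (\<lambda>x. 0)" by (rule ae_on_translate)
  qed
  then have "ae_on V (\<lambda>x. periodize L \<rho> f x - (\<Sum>l\<in>?Z. f (x + l))) (\<lambda>x. c)"
    by (rule ae_on_combine[OF c]) simp
  from ae_on_witness[OF this V(1) x zero_less_one] obtain y where y: "y \<in> V" "dist x y < 1" "periodize L \<rho> f y - (\<Sum>l\<in>?Z. f (y + l)) = c" by blast
  have "norm y \<le> R" using y(2) norm_triangle_ineq2[of y x] by (simp add: R_def dist_norm norm_minus_commute)
  from periodize_eq[OF van this] have "periodize L \<rho> f y = (\<Sum>l\<in>?\<Lambda>. f (y + l))" by simp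
  also have "\<dots> = (\<Sum>l\<in>?Z. f (y + l))"
  proof (rule sum.mono_neutral_right[OF fin])
    show "\<forall>l\<in>?\<Lambda> - ?Z. f (y + l) = 0"
    proof
      fix l assume l: "l \<in> ?\<Lambda> - ?Z"
      then have lE: "(+) l ` V \<in> E" and lL: "l \<in> L" by auto
      define U where "U = (+) l ` V"
      have "U \<in> translates V" using lE by (simp add: E_def U_def)
      from rep[OF this] have r: "rep U \<in> L" "(+) l ` V = (+) (rep U) ` V" by (auto simp: U_def)
      then have "l - rep U \<in> dirs V" using translate_eq_iff[OF V] by blast
      then have "l - rep U \<in> span (L \<inter> dirs V)" using diff[OF lL r(1)] by (simp add: span_base)
      then have "u \<bullet> (l - rep U) = 0" using u(3) by (simp add: orthogonal_def)
      then have ul: "u \<bullet> l \<ge> - M" using M[OF lE] by (simp add: inner_diff_right U_def)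
      have "\<bar>u \<bullet> (y - x)\<bar> \<le> norm u * norm (y - x)" by (rule Cauchy_Schwarz_ineq2)
      also have "\<dots> \<le> norm u * 1" using y(2) by (intro mult_left_mono) (auto simp: dist_norm norm_minus_commute)
      finally have "u \<bullet> y \<ge> M + norm u * \<rho> + 1" using ux by (simp add: inner_diff_right)
      then have "u \<bullet> (y + l) > norm u * \<rho>" using ul by (simp add: inner_add_right)
      then have "norm u * norm (y + l) > norm u * \<rho>" using norm_cauchy_schwarz[of u "y + l"] by linarith
      then have "norm (y + l) > \<rho>" using u(1) by simp
      then show "f (y + l) = 0" by (rule van)
    qed
  qed auto
  finally show "c = 0" using y(3) by simp
qed

text \<open>Otherwise integrate the periodization against a weight \<open>w\<close> of bounded support whose translates by the
  stabilizer sum to \<open>1\<close>: the result is \<open>c \<integral> w\<close> on the one hand and the sum of the integrals of \<open>f\<close> over the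
  translates of \<open>V\<close> on the other.\<close>

lemma const_zero_full:
  assumes V: "affine V" "V \<noteq> {}" and full: "span (L \<inter> dirs V) = dirs V"
    and van: "\<And>y. norm y > \<rho> \<Longrightarrow> f y = 0" and H: "finite H" "pw_const UNIV H f"
    and c: "ae_on V (periodize L \<rho> f) (\<lambda>_. c)"
    and fin0: "finite {U\<in>translates V. \<not> ae_on U f (\<lambda>_. 0)}"
    and sum0: "(\<Sum>U\<in>{U\<in>translates V. \<not> ae_on U f (\<lambda>_. 0)}. flat_int U f) = 0"
  shows "c = 0"
proof -
  define E where "E = {U\<in>translates V. \<not> ae_on U f (\<lambda>_. 0)}"
  define T where "T l = (+) l ` V" for l
  have pf: "bpw_const UNIV f" using van H unfolding bpw_const_def by blast
  obtain p where p: "p \<in> V" using V by blast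
  obtain r0 where r0: "\<forall>x\<in>V. \<exists>\<mu>\<in>L \<inter> dirs V. norm (x + \<mu>) \<le> r0" using cocompact[OF V full] by blast
  \<comment> \<open>The radius \<open>r0\<close> makes the stabilizer translates of \<open>K\<close>
    cover \<open>V\<close>; \<open>norm p + 1\<close> puts the projection of the unit ball around
    \<open>p\<close> into \<open>K\<close>, which makes the integral of \<open>w\<close>
    positive.\<close>
  define r where "r = max r0 (norm p + 1)"
  define K where "K = {x::'a. \<forall>b\<in>Basis. \<bar>x \<bullet> b\<bar> \<le> r}"
  obtain HK where HK: "polyhedral HK UNIV K" using box_polyhedral[of r] unfolding K_def by blast
  have KI: "x \<in> K" if "norm x \<le> r" for x unfolding K_def using that Basis_le_norm order_trans by blast
  obtain q where q: "\<And>x. x \<in> K \<Longrightarrow> norm x \<le> q" using HK by (auto simp: polyhedral_def bounded_iff)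
  have pK: "bpw_const UNIV (indicat_real K)" using HK bpw_const_indicator by blast
  \<comment> \<open>Two points of \<open>K\<close> differ by at most \<open>2 * q\<close>.\<close>
  define \<Lambda>' where "\<Lambda>' = {\<mu>\<in>L \<inter> dirs V. norm \<mu> \<le> 2 * q}"
  have f\<Lambda>': "finite \<Lambda>'" unfolding \<Lambda>'_def by (rule finite_subset[OF _ fin[of "2 * q"]]) auto
  define N where "N x = (\<Sum>\<mu>\<in>\<Lambda>'. 1 * indicat_real K (x + \<mu>))" for x
  \<comment> \<open>Each point of \<open>K\<close> divides its weight 1 evenly among the points of
    \<open>K\<close> equivalent to it under the stabilizer. On \<open>K\<close> the denominator is
    at least 1; elsewhere the numerator is 0.\<close>
  define w where "w x = indicat_real K x / N x" for x
  have pN: "bpw_const UNIV N" unfolding N_def[abs_def] by (intro bpw_const_sum f\<Lambda>' bpw_const_shift pK)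
  have pw: "bpw_const UNIV w" unfolding w_def[abs_def] by (rule bpw_const_binop[OF pK pN]) simp
  have affT: "affine (T l)" "T l \<noteq> {}" for l unfolding T_def using V affine_translation[of V l] by auto
  \<comment> \<open>Contains every \<open>l\<close> with \<open>y - l\<close> in \<open>K\<close>
    for some \<open>y\<close> of norm at most \<open>\<rho>\<close>; the same set computes the
    periodization on \<open>K\<close>.\<close>
  define \<Lambda> where "\<Lambda> = {l\<in>L. norm l \<le> q + \<rho>}"
  have f\<Lambda>: "finite \<Lambda>" unfolding \<Lambda>_def by (rule fin)
  have part: "(\<Sum>l\<in>{l\<in>\<Lambda>. T l = T l0}. w (y - l)) = 1" "\<exists>l\<in>\<Lambda>. T l = T l0" if y: "y \<in> T l0" "norm y \<le> \<rho>" and l0: "l0 \<in> L" for y l0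
  proof -
    define S where "S = {l\<in>L. T l = T l0 \<and> y - l \<in> K}"
    have S\<Lambda>: "S \<subseteq> {l\<in>\<Lambda>. T l = T l0}"
    proof
      fix l assume l: "l \<in> S"
      have "norm l \<le> norm (y - l) + norm y" by (metis norm_minus_commute norm_triangle_sub add.commute)
      moreover have "norm (y - l) \<le> q" using l q by (auto simp: S_def)
      ultimately show "l \<in> {l\<in>\<Lambda>. T l = T l0}" using l y(2) by (auto simp: S_def \<Lambda>_def)
    qed
    have fS: "finite S" using finite_subset[OF S\<Lambda>] f\<Lambda> by simp
    have "S \<noteq> {}"
    proof -
      have "y - l0 \<in> V" using y(1) by (auto simp: T_def)
      then obtain \<mu> where \<mu>: "\<mu> \<in> L" "\<mu> \<in> dirs V" "norm (y - l0 + \<mu>) \<le> r0" using r0 by blast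
      have "l0 - \<mu> - l0 \<in> dirs V" using dirs_neg[OF V \<mu>(2)] by simp
      then have "T (l0 - \<mu>) = T l0" unfolding T_def using translate_eq_iff[OF V] by blast
      moreover have "y - (l0 - \<mu>) \<in> K" using \<mu>(3) by (intro KI) (auto simp: r_def algebra_simps)
      ultimately have "l0 - \<mu> \<in> S" using diff[OF l0 \<mu>(1)] by (simp add: S_def)
      then show ?thesis by blast
    qed
    then show "\<exists>l\<in>\<Lambda>. T l = T l0" using S\<Lambda> by blast
    \<comment> \<open>Sending \<open>l'\<close> to \<open>l - l'\<close> identifies \<open>S\<close>
      with the vectors counted by \<open>N\<close> at \<open>y - l\<close>. So all members of
      \<open>S\<close> get equal weight and the weights sum to 1.\<close>
    have wS: "w (y - l) = 1 / card S" if l: "l \<in> S" for l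
    proof -
      have "{\<mu>\<in>\<Lambda>'. y - l + \<mu> \<in> K} = (\<lambda>l'. l - l') ` S"
      proof (intro equalityI subsetI)
        fix \<mu> assume \<mu>: "\<mu> \<in> {\<mu>\<in>\<Lambda>'. y - l + \<mu> \<in> K}"
        have "l - \<mu> - l \<in> dirs V" using dirs_neg[OF V, of \<mu>] \<mu> by (simp add: \<Lambda>'_def)
        then have "T (l - \<mu>) = T l" unfolding T_def using translate_eq_iff[OF V] by blast
        moreover have "y - (l - \<mu>) \<in> K" using \<mu> by (simp add: algebra_simps)
        ultimately have "l - \<mu> \<in> S" using l \<mu> diff by (auto simp: S_def \<Lambda>'_def)
        then show "\<mu> \<in> (\<lambda>l'. l - l') ` S" by (intro image_eqI[of _ _ "l - \<mu>"]) auto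
      next
        fix \<mu> assume "\<mu> \<in> (\<lambda>l'. l - l') ` S"
        then obtain l' where l': "l' \<in> S" "\<mu> = l - l'" by blast
        have "T l = T l'" using l l' by (simp add: S_def)
        then have "\<mu> \<in> dirs V" unfolding T_def using translate_eq_iff[OF V] l' by blast
        moreover have "\<mu> \<in> L" using l l' diff by (auto simp: S_def)
        moreover have "norm \<mu> \<le> 2 * q"
        proof -
          have "norm \<mu> = norm ((y - l') - (y - l))" using l' by simp
          also have "\<dots> \<le> norm (y - l') + norm (y - l)" by (rule norm_triangle_ineq4)
          also have "\<dots> \<le> 2 * q" using q[of "y - l'"] q[of "y - l"] l l' by (auto simp: S_def)
          finally show ?thesis .
        qed
        moreover have "y - l + \<mu> \<in> K" using l' by (auto simp: S_def)
        ultimately show "\<mu> \<in> {\<mu>\<in>\<Lambda>'. y - l + \<mu> \<in> K}" by (simp add: \<Lambda>'_def)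
      qed
      moreover have "card ((\<lambda>l'. l - l') ` S) = card S" by (intro card_image) (auto simp: inj_on_def)
      moreover have "N (y - l) = card {\<mu>\<in>\<Lambda>'. y - l + \<mu> \<in> K}"
        unfolding N_def by (simp add: indicator_def of_bool_def sum.If_cases f\<Lambda>' Int_def)
      ultimately show ?thesis using l by (simp add: w_def S_def)
    qed
    have "(\<Sum>l\<in>{l\<in>\<Lambda>. T l = T l0}. w (y - l)) = (\<Sum>l\<in>S. w (y - l))"
    proof (rule sum.mono_neutral_right[OF _ S\<Lambda>])
      show "\<forall>l\<in>{l\<in>\<Lambda>. T l = T l0} - S. w (y - l) = 0" by (auto simp: w_def S_def \<Lambda>_def)
    qed (use f\<Lambda> in simp)
    also have "\<dots> = (\<Sum>l\<in>S. 1 / card S)" by (intro sum.cong wS) auto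
    also have "\<dots> = 1" using fS \<open>S \<noteq> {}\<close> by simp
    finally show "(\<Sum>l\<in>{l\<in>\<Lambda>. T l = T l0}. w (y - l)) = 1" .
  qed
  have pwf: "bpw_const V (\<lambda>x. w x * f (x + l))" for l
    by (rule bpw_const_binop[OF bpw_const_mono[OF pw] bpw_const_shift[OF pf]]) auto
  have pwf': "bpw_const U (\<lambda>y. w (y - l) * f y)" for l U
    using bpw_const_binop[OF bpw_const_shift[OF pw, of U "- l"] bpw_const_mono[OF pf], of "(*)"] by simp
  have "c * flat_int V w = flat_int V (\<lambda>x. c * w x)" unfolding flat_int_def by (simp add: mult.assoc)
  also have "\<dots> = flat_int V (\<lambda>x. \<Sum>l\<in>\<Lambda>. 1 * (w x * f (x + l)))"
  proof (rule flat_int_cong[OF V])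
    show "bpw_const V (\<lambda>x. c * w x)" by (rule bpw_const_binop[OF bpw_const_mono[OF pw] bpw_const_zero, where k = "\<lambda>u v. c * u"]) auto
    show "bpw_const V (\<lambda>x. \<Sum>l\<in>\<Lambda>. 1 * (w x * f (x + l)))" by (intro bpw_const_sum f\<Lambda> pwf)
    show "ae_on V (\<lambda>x. c * w x) (\<lambda>x. \<Sum>l\<in>\<Lambda>. 1 * (w x * f (x + l)))"
    proof (rule ae_on_combine[OF c c])
      fix x assume "x \<in> V" and cx: "periodize L \<rho> f x = c"
      show "c * w x = (\<Sum>l\<in>\<Lambda>. 1 * (w x * f (x + l)))"
      proof (cases "x \<in> K")
        case True
        have "periodize L \<rho> f x = (\<Sum>l\<in>\<Lambda>. f (x + l))" unfolding \<Lambda>_def by (rule periodize_eq[OF van q[OF True]])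
        then show ?thesis using cx by (simp add: sum_distrib_left mult.commute)
      qed (simp add: w_def)
    qed
  qed
  also have "\<dots> = (\<Sum>l\<in>\<Lambda>. 1 * flat_int V (\<lambda>x. w x * f (x + l)))" by (rule flat_int_sum[OF V f\<Lambda> pwf])
  also have "\<dots> = (\<Sum>l\<in>\<Lambda>. flat_int (T l) (\<lambda>y. w (y - l) * f y))"
  proof (intro sum.cong refl)
    fix l
    have "flat_int (T l) (\<lambda>y. w (y - l) * f y) = flat_int V (\<lambda>x. w (l + x - l) * f (l + x))"
      unfolding T_def by (rule flat_int_translate[OF V]) (rule pwf')
    then show "1 * flat_int V (\<lambda>x. w x * f (x + l)) = flat_int (T l) (\<lambda>y. w (y - l) * f y)" by (simp add: add.commute)
  qed
  \<comment> \<open>Vectors with the same translate of \<open>V\<close> are grouped; within a group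
    the weights sum to 1 wherever \<open>f\<close> can be nonzero.\<close>
  also have "\<dots> = (\<Sum>U\<in>T ` \<Lambda>. \<Sum>l\<in>{l\<in>\<Lambda>. T l = U}. flat_int (T l) (\<lambda>y. w (y - l) * f y))"
    by (rule sum.image_gen[OF f\<Lambda>])
  also have "\<dots> = (\<Sum>U\<in>T ` \<Lambda>. flat_int U f)"
  proof (intro sum.cong refl)
    fix U assume "U \<in> T ` \<Lambda>"
    then obtain l0 where l0: "l0 \<in> L" "U = T l0" by (auto simp: \<Lambda>_def)
    have "(\<Sum>l\<in>{l\<in>\<Lambda>. T l = U}. flat_int (T l) (\<lambda>y. w (y - l) * f y)) = (\<Sum>l\<in>{l\<in>\<Lambda>. T l = U}. 1 * flat_int U (\<lambda>y. w (y - l) * f y))"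
      by (intro sum.cong) auto
    also have "\<dots> = flat_int U (\<lambda>y. \<Sum>l\<in>{l\<in>\<Lambda>. T l = U}. 1 * (w (y - l) * f y))"
      unfolding l0(2) by (rule flat_int_sum[symmetric, OF affT]) (use f\<Lambda> pwf' in auto)
    also have "\<dots> = flat_int U f"
    proof (rule flat_int_cong)
      show "affine U" "U \<noteq> {}" unfolding l0(2) by (rule affT)+
      show "bpw_const U (\<lambda>y. \<Sum>l\<in>{l\<in>\<Lambda>. T l = U}. 1 * (w (y - l) * f y))" by (intro bpw_const_sum pwf') (use f\<Lambda> in simp)
      show "bpw_const U f" by (rule bpw_const_mono[OF pf]) auto
      show "ae_on U (\<lambda>y. \<Sum>l\<in>{l\<in>\<Lambda>. T l = U}. 1 * (w (y - l) * f y)) f"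
      proof (rule ae_on_eq)
        fix y assume y: "y \<in> U"
        show "(\<Sum>l\<in>{l\<in>\<Lambda>. T l = U}. 1 * (w (y - l) * f y)) = f y"
        proof (cases "norm y \<le> \<rho>")
          case True
          have "(\<Sum>l\<in>{l\<in>\<Lambda>. T l = U}. 1 * (w (y - l) * f y)) = (\<Sum>l\<in>{l\<in>\<Lambda>. T l = T l0}. w (y - l)) * f y"
            by (simp add: sum_distrib_right l0(2))
          then show ?thesis using part(1)[of y l0] y True l0 by simp
        next
          case False
          then show ?thesis using van by simp
        qed
      qed
    qed
    finally show "(\<Sum>l\<in>{l\<in>\<Lambda>. T l = U}. flat_int (T l) (\<lambda>y. w (y - l) * f y)) = flat_int U f" .
  qed
  \<comment> \<open>A flat in \<open>E\<close> meets the support of \<open>f\<close>, hence is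
    reached from \<open>\<Lambda>\<close>; a flat outside \<open>E\<close> has integral 0.\<close>
  also have "\<dots> = (\<Sum>U\<in>E. flat_int U f)"
  proof (rule sum.mono_neutral_right)
    show "finite (T ` \<Lambda>)" using f\<Lambda> by simp
    show "E \<subseteq> T ` \<Lambda>"
    proof
      fix U assume U: "U \<in> E"
      then obtain l0 where l0: "l0 \<in> L" "U = T l0" by (auto simp: E_def translates_def T_def)
      have "\<exists>y\<in>U. f y \<noteq> 0" using U ae_on_eq[of U f "\<lambda>_. 0"] by (auto simp: E_def)
      then obtain y where y: "y \<in> U" "f y \<noteq> 0" by blast
      then have "norm y \<le> \<rho>" using van by force
      then have "\<exists>l\<in>\<Lambda>. T l = T l0" using part(2)[of y l0] y l0 by simp
      then show "U \<in> T ` \<Lambda>" using l0(2) by blast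
    qed
    show "\<forall>U\<in>T ` \<Lambda> - E. flat_int U f = 0"
    proof
      fix U assume U: "U \<in> T ` \<Lambda> - E"
      then have "U \<in> translates V" by (auto simp: translates_def T_def \<Lambda>_def)
      then have ae: "ae_on U f (\<lambda>_. 0)" using U by (simp add: E_def)
      have "affine U" "U \<noteq> {}" using U affT by auto
      from flat_int_cong[OF this bpw_const_mono[OF pf] bpw_const_zero ae] show "flat_int U f = 0" by (simp add: flat_int_zero)
    qed
  qed
  also have "\<dots> = 0" using sum0 by (simp add: E_def)
  finally have cw: "c * flat_int V w = 0" .
  \<comment> \<open>The unit ball around \<open>p\<close> lies in the tube and projects into
    \<open>K\<close>, where \<open>w\<close> is at least \<open>1 / card \<Lambda>'\<close>.\<close>
  have "flat_int V w > 0"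
  proof -
    have N1: "N x \<ge> 1" "N x \<le> card \<Lambda>'" if "x \<in> K" for x
    proof -
      have "q \<ge> 0" using q[OF that] norm_ge_zero order_trans by blast
      then have "0 \<in> \<Lambda>'" using zero V subspace_dirs subspace_0 by (auto simp: \<Lambda>'_def)
      then have "(\<Sum>\<mu>\<in>\<Lambda>'. 1 * indicat_real K (x + \<mu>)) \<ge> 1 * indicat_real K (x + 0)"
        by (intro member_le_sum f\<Lambda>') auto
      then show "N x \<ge> 1" using that by (simp add: N_def)
      have "N x \<le> (\<Sum>\<mu>\<in>\<Lambda>'. 1)" unfolding N_def by (intro sum_mono) (auto simp: indicator_def)
      then show "N x \<le> card \<Lambda>'" by simp
    qed
    have pr: "p \<in> K" by (rule KI) (simp add: r_def)
    then have c1: "real (card \<Lambda>') \<ge> 1" using N1[OF pr] by linarith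
    have wge: "w x \<ge> 1 / card \<Lambda>'" if "x \<in> K" for x
      using N1[OF that] that c1 by (simp add: w_def frac_le)
    have w0: "w x \<ge> 0" for x
    proof -
      have "N x \<ge> 0" unfolding N_def by (intro sum_nonneg) auto
      then show ?thesis by (simp add: w_def)
    qed
    have "1 / card \<Lambda>' * indicat_real (ball p 1) x \<le> w (prj V x) * indicat_real (tube V) x" for x
    proof (cases "x \<in> ball p 1")
      case True
      have "prj V x - p \<in> dirs V" using dirs_diff[OF V(1) prj(1)[OF V] p] .
      from prj(2)[OF V this, of x] have o: "orthogonal (prj V x - p) (x - prj V x)" by (simp add: orthogonal_def)
      have "(norm (x - p))\<^sup>2 = (norm (prj V x - p))\<^sup>2 + (norm (x - prj V x))\<^sup>2"
        using norm_add_Pythagorean[OF o] by (simp add: algebra_simps)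
      then have "(norm (prj V x - p))\<^sup>2 \<le> (norm (x - p))\<^sup>2" "(norm (x - prj V x))\<^sup>2 \<le> (norm (x - p))\<^sup>2" by simp_all
      then have le: "norm (prj V x - p) \<le> norm (x - p)" "norm (x - prj V x) \<le> norm (x - p)" by (simp_all add: power2_le_iff_abs_le)
      have x1: "norm (x - p) < 1" using True by (simp add: dist_norm norm_minus_commute)
      have "norm (prj V x) \<le> norm p + norm (prj V x - p)" by (rule norm_triangle_sub)
      then have "prj V x \<in> K" using le x1 by (intro KI) (simp add: r_def)
      moreover have "x \<in> tube V" using le x1 by (simp add: tube_def)
      ultimately show ?thesis using wge True by simp
    qed (use w0 in simp)
    then have "(LINT x|lborel. 1 / card \<Lambda>' * indicat_real (ball p 1) x) \<le> flat_int V w"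
      unfolding flat_int_def
      by (intro integral_mono bpw_const_integrable[OF V bpw_const_mono[OF pw]]) (auto intro!: integrable_mult_right integrable_real_indicator simp: emeasure_bounded_finite[OF bounded_ball, simplified])
    moreover have "(LINT x|lborel. 1 / card \<Lambda>' * indicat_real (ball p 1) x) > 0"
      using c1 content_ball_pos[of 1 p] by simp
    ultimately show ?thesis by linarith
  qed
  then show "c = 0" using cw by simp
qed

end

section \<open>Hadwiger functionals and periodization\<close>

lemma pw_const_jumps_UNIV: "finite H \<Longrightarrow> pw_const UNIV H g \<Longrightarrow> pw_const UNIV H (jumps \<nu> r m g)"
  by (induction m arbitrary: r) (auto intro!: pw_const_jump)

lemma vanish_jumps:
  assumes "\<And>y. norm y > \<rho> \<Longrightarrow> g y = 0"
  shows "norm y > \<rho> \<Longrightarrow> jumps \<nu> r m g y = 0"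
proof (induction m arbitrary: r y)
  case (Suc m)
  then show ?case using ray_limit_vanish[of UNIV \<rho> "jumps \<nu> (Suc r) m g" y] by (simp add: jump_def)
qed (use assms in simp)

lemma jumps_cong: "(\<And>j. j \<in> {r..<r+m} \<Longrightarrow> \<nu> j = \<nu>' j) \<Longrightarrow> jumps \<nu> r m f = jumps \<nu>' r m f"
proof (induction m arbitrary: r)
  case (Suc m)
  have "jumps \<nu> (Suc r) m f = jumps \<nu>' (Suc r) m f" by (rule Suc.IH) (use Suc.prems in auto)
  then show ?case using Suc.prems[of r] by simp
qed simp

lemma jumps_translate: "jumps \<nu> r m (\<lambda>x. f (x + l)) = (\<lambda>x. jumps \<nu> r m f (x + l))"
proof (induction m arbitrary: r)
  case (Suc m)
  have "ray_limit n (\<lambda>x. h (x + l)) x = ray_limit n h (x + l)" for n h x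
    unfolding ray_limit_def by (simp add: algebra_simps)
  then have "jump n (\<lambda>x. h (x + l)) = (\<lambda>x. jump n h (x + l))" for n h
    by (simp add: jump_def fun_eq_iff)
  then show ?case by (simp add: Suc)
qed simp

lemma hplane_in_aff_dim:
  assumes "hplane_in V W n" shows "aff_dim W = aff_dim V - 1"
proof -
  obtain \<beta> where W: "W = {x\<in>V. n \<bullet> x = \<beta>}" using assms by (auto simp: hplane_in_def)
  then have W': "W = V \<inter> {x. n \<bullet> x = \<beta>}" by auto
  obtain p where p: "p \<in> W" using assms by (auto simp: hplane_in_def)
  have "p + n \<in> V" using p W assms dirnD by (auto simp: hplane_in_def)
  moreover have "n \<bullet> (p + n) \<noteq> \<beta>" using p W assms by (auto simp: hplane_in_def inner_add_right)
  ultimately have "\<not> V \<subseteq> {x. n \<bullet> x = \<beta>}" by blast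
  then show ?thesis unfolding W' using assms W' aff_dim_affine_Int_hyperplane[of V n \<beta>] by (auto simp: hplane_in_def)
qed

text \<open>The link of the induction: a jump across any hyperplane \<open>W\<close> of the lowest
  flat is an iterated jump along a flag with one more flat. The half-space into which
  \<open>n\<close> points is taken as positive.\<close>

lemma extend_flag:
  fixes \<Phi> :: "'a::euclidean_space flag"
  assumes fl: "is_flag (Suc k) \<Phi>" and k: "Suc k \<le> DIM('a)" and nm: "normals (Suc k) \<Phi> \<nu>" and hp: "hplane_in (flat \<Phi> (Suc k)) W n"
  shows "\<exists>\<Phi>'. is_flag k \<Phi>' \<and> flat \<Phi>' k = W \<and> normals k \<Phi>' (\<nu>(k := n))"
proof -
  obtain \<beta> where W: "W = {x\<in>flat \<Phi> (Suc k). n \<bullet> x = \<beta>}" using hp by (auto simp: hplane_in_def)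
  define Q where "Q = {x\<in>flat \<Phi> (Suc k). n \<bullet> x \<ge> \<beta>}"
  define \<Phi>' where "\<Phi>' = Flag ((flat \<Phi>)(k := W)) ((pos \<Phi>)(k := Q))"
  have fl': "flat \<Phi>' k = W" "pos \<Phi>' k = Q" "\<And>j. j \<noteq> k \<Longrightarrow> flat \<Phi>' j = flat \<Phi> j" "\<And>j. j \<noteq> k \<Longrightarrow> pos \<Phi>' j = pos \<Phi> j"
    by (auto simp: \<Phi>'_def)
  have ad: "aff_dim W = int k"
  proof -
    have "aff_dim (flat \<Phi> (Suc k)) = int (Suc k)" using fl k by (simp add: is_flag_def)
    then show ?thesis using hplane_in_aff_dim[OF hp] by simp
  qed
  have "is_flag k \<Phi>'"
    unfolding is_flag_def
  proof (intro conjI ballI)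
    show "flat \<Phi>' \<in> extensional {k..DIM('a)}" "pos \<Phi>' \<in> extensional {k..<DIM('a)}" using fl k
      by (auto simp: is_flag_def extensional_def \<Phi>'_def)
    show "flat \<Phi>' DIM('a) = UNIV" using fl k fl'(3) by (simp add: is_flag_def)
    fix j assume j: "j \<in> {k..DIM('a)}"
    show "affine (flat \<Phi>' j)" "aff_dim (flat \<Phi>' j) = int j"
      using fl j fl' hplane_in_affine[OF hp] ad by (cases "j = k"; simp add: is_flag_def)+
  next
    fix j assume j: "j \<in> {k..<DIM('a)}"
    show "flat \<Phi>' j \<subseteq> flat \<Phi>' (Suc j)"
      using fl j fl' hplane_in_subset[OF hp] by (cases "j = k"; simp add: is_flag_def)
    show "halfspace_of (flat \<Phi>' (Suc j)) (flat \<Phi>' j) (pos \<Phi>' j)"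
    proof (cases "j = k")
      case True
      then show ?thesis using W fl' unfolding Q_def halfspace_of_def by auto
    next
      case False
      then show ?thesis using fl j fl' by (simp add: is_flag_def)
    qed
  qed
  moreover have "normals k \<Phi>' (\<nu>(k := n))"
    unfolding normals_def
  proof (intro conjI ballI)
    show "k \<le> DIM('a)" using k by simp
    show "flat \<Phi>' DIM('a) = UNIV" using fl k fl'(3) by (simp add: is_flag_def)
    fix j assume j: "j \<in> {k..<DIM('a)}"
    show "hplane_in (flat \<Phi>' (Suc j)) (flat \<Phi>' j) ((\<nu>(k := n)) j)"
      using nm hp j fl' by (cases "j = k"; simp add: normals_def)
    show "\<exists>\<beta>. flat \<Phi>' j = {x\<in>flat \<Phi>' (Suc j). (\<nu>(k := n)) j \<bullet> x = \<beta>} \<and> pos \<Phi>' j = {x\<in>flat \<Phi>' (Suc j). (\<nu>(k := n)) j \<bullet> x \<ge> \<beta>}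
          \<and> neg \<Phi>' j = {x\<in>flat \<Phi>' (Suc j). (\<nu>(k := n)) j \<bullet> x \<le> \<beta>}"
    proof (cases "j = k")
      case True
      have "neg \<Phi>' k = {x\<in>flat \<Phi> (Suc k). n \<bullet> x \<le> \<beta>}" unfolding neg_def fl' Q_def using fl'(3)[of "Suc k"] W by auto
      then show ?thesis using True W fl' by (intro exI[of _ \<beta>]) (auto simp: Q_def)
    next
      case False
      then have "neg \<Phi>' j = neg \<Phi> j" using j fl' by (simp add: neg_def)
      then show ?thesis using nm j False fl' by (simp add: normals_def)
    qed
  qed
  ultimately show ?thesis using fl'(1) by blast
qed

lemma normals_dirs:
  fixes \<Phi> :: "'a::euclidean_space flag"
  assumes "normals r \<Phi> \<nu>" "v \<in> dirs (flat \<Phi> r)" "r \<le> j" "j \<le> DIM('a)"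
  shows "v \<in> dirs (flat \<Phi> j)"
  using assms(3,4)
proof (induction j rule: dec_induct)
  case base
  then show ?case using assms by simp
next
  case (step i)
  have hp: "hplane_in (flat \<Phi> (Suc i)) (flat \<Phi> i) (\<nu> i)" using assms(1) step by (simp add: normals_def)
  obtain p where p: "p \<in> flat \<Phi> i" using hp by (auto simp: hplane_in_def)
  have "v \<in> dirs (flat \<Phi> i)" using step by simp
  then have "p + v \<in> flat \<Phi> i" using p dirnD by blast
  then have "p + v - p \<in> dirs (flat \<Phi> (Suc i))" using p hplane_in_subset[OF hp] hp
    by (intro dirs_diff) (auto simp: hplane_in_def)
  then show ?case by simp
qed

lemma translate_eq_if:
  assumes "\<And>x. x \<in> P \<Longrightarrow> x + (l - l') \<in> P" "\<And>x. x \<in> P \<Longrightarrow> x - (l - l') \<in> P"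
  shows "(+) l ` P = (+) l' ` (P :: 'a::ab_group_add set)"
proof (intro equalityI subsetI)
  fix x assume "x \<in> (+) l ` P"
  then obtain v where "v \<in> P" "x = l + v" by blast
  then show "x \<in> (+) l' ` P" using assms(1)[of v] by (intro image_eqI[of _ _ "v + (l - l')"]) auto
next
  fix x assume "x \<in> (+) l' ` P"
  then obtain v where "v \<in> P" "x = l' + v" by blast
  then show "x \<in> (+) l ` P" using assms(2)[of v] by (intro image_eqI[of _ _ "v - (l - l')"]) auto
qed

text \<open>If \<open>l - l'\<close> is tangent to the lowest flat, it is tangent to all flats and
  orthogonal to all normals, so it preserves the half-spaces too. Distinct translates of the flag
  thus correspond to distinct translates of its lowest flat.\<close>

lemma translate_flag_eqI:
  fixes \<Phi> :: "'a::euclidean_space flag"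
  assumes nm: "normals r \<Phi> \<nu>" and eq: "(+) l ` flat \<Phi> r = (+) l' ` flat \<Phi> r"
  shows "translate_flag r l \<Phi> = translate_flag r l' \<Phi>"
proof -
  define v where "v = l - l'"
  have r: "affine (flat \<Phi> r)" "flat \<Phi> r \<noteq> {}" using tower_affine[OF normals_tower[OF nm]] by auto
  have v: "v \<in> dirs (flat \<Phi> r)" "- v \<in> dirs (flat \<Phi> r)" using eq translate_eq_iff[OF r] dirs_neg[OF r] unfolding v_def by blast+
  have vj: "v \<in> dirs (flat \<Phi> j)" "- v \<in> dirs (flat \<Phi> j)" if "j \<in> {r..DIM('a)}" for j
    using normals_dirs[OF nm v(1)] normals_dirs[OF nm v(2)] that by auto
  have f1: "(+) l ` flat \<Phi> j = (+) l' ` flat \<Phi> j" if "j \<in> {r..DIM('a)}" for j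
  proof (rule translate_eq_if)
    fix x assume x: "x \<in> flat \<Phi> j"
    show "x + (l - l') \<in> flat \<Phi> j" using dirnD[OF vj(1)[OF that] x] by (simp add: v_def)
    show "x - (l - l') \<in> flat \<Phi> j" using dirnD[OF vj(2)[OF that] x] by (simp add: v_def algebra_simps)
  qed
  have f2: "(+) l ` pos \<Phi> j = (+) l' ` pos \<Phi> j" if j: "j \<in> {r..<DIM('a)}" for j
  proof -
    obtain \<beta> where b: "flat \<Phi> j = {x\<in>flat \<Phi> (Suc j). \<nu> j \<bullet> x = \<beta>}" "pos \<Phi> j = {x\<in>flat \<Phi> (Suc j). \<nu> j \<bullet> x \<ge> \<beta>}"
      and hp: "hplane_in (flat \<Phi> (Suc j)) (flat \<Phi> j) (\<nu> j)" using nm j unfolding normals_def by blast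
    obtain p where p: "p \<in> flat \<Phi> j" using hp by (auto simp: hplane_in_def)
    have "v \<in> dirs (flat \<Phi> j)" using vj(1)[of j] j by simp
    then have pv: "p + v \<in> flat \<Phi> j" using p dirnD by blast
    have "\<nu> j \<bullet> p = \<beta>" using p by (subst (asm) b(1)) auto
    moreover have "\<nu> j \<bullet> (p + v) = \<beta>" using pv by (subst (asm) b(1)) auto
    ultimately have nv: "\<nu> j \<bullet> v = 0" by (simp add: inner_add_right)
    have vs: "v \<in> dirs (flat \<Phi> (Suc j))" "- v \<in> dirs (flat \<Phi> (Suc j))" using vj[of "Suc j"] j by auto
    show ?thesis
    proof (rule translate_eq_if)
      fix x assume "x \<in> pos \<Phi> j"
      then have x: "x \<in> flat \<Phi> (Suc j)" "\<nu> j \<bullet> x \<ge> \<beta>" by (auto simp: b(2))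
      then show "x + (l - l') \<in> pos \<Phi> j" "x - (l - l') \<in> pos \<Phi> j"
        using dirnD[OF vs(1) x(1)] dirnD[OF vs(2) x(1)] nv unfolding b(2) v_def[symmetric] by (auto simp: inner_add_right inner_diff_right)
    qed
  qed
  have "restrict (\<lambda>j. (+) l ` flat \<Phi> j) {r..DIM('a)} = restrict (\<lambda>j. (+) l' ` flat \<Phi> j) {r..DIM('a)}"
    by (rule restrict_ext) (rule f1)
  moreover have "restrict (\<lambda>j. (+) l ` pos \<Phi> j) {r..<DIM('a)} = restrict (\<lambda>j. (+) l' ` pos \<Phi> j) {r..<DIM('a)}"
    by (rule restrict_ext) (rule f2)
  ultimately show ?thesis unfolding translate_flag_def by simp
qed

section \<open>The induction over flags\<close>

context discrete_group
begin

text \<open>All translates of the flag share their normals, so the iterated jump is one function on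
  the whole space and its carriers are intersections of members of \<open>H\<close>.\<close>

lemma finite_support:
  fixes \<Phi> :: "'a flag"
  assumes nm: "normals r \<Phi> \<nu>" and H: "finite H" "pw_const UNIV H g"
  shows "finite {U\<in>translates (flat \<Phi> r). \<not> ae_on U (jumps \<nu> r (DIM('a) - r) g) (\<lambda>_. 0)}"
proof (rule finite_subset)
  show "finite ((\<lambda>S. \<Inter>(hplane ` S)) ` Pow H)" using H(1) by simp
  show "{U\<in>translates (flat \<Phi> r). \<not> ae_on U (jumps \<nu> r (DIM('a) - r) g) (\<lambda>_. 0)} \<subseteq> (\<lambda>S. \<Inter>(hplane ` S)) ` Pow H"
  proof clarify
    fix U assume U: "U \<in> translates (flat \<Phi> r)" "\<not> ae_on U (jumps \<nu> r (DIM('a) - r) g) (\<lambda>_. 0)"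
    obtain l where l: "l \<in> L" "U = (+) l ` flat \<Phi> r" using U(1) by (auto simp: translates_def)
    define \<Psi> where "\<Psi> = translate_flag r l \<Phi>"
    have n: "normals r \<Psi> \<nu>" unfolding \<Psi>_def by (rule normals_translate[OF nm])
    have rd: "r \<le> DIM('a)" "flat \<Psi> DIM('a) = UNIV" using n by (auto simp: normals_def)
    have Ur: "U = flat \<Psi> r" using flat_translate[of r r l \<Phi>] rd by (simp add: \<Psi>_def l)
    have "\<exists>S\<subseteq>H. flat \<Psi> r = \<Inter>(hplane ` S)"
      by (rule jumps_ae_zero_or_Inter[OF normals_tower[OF n] H(1)]) (use H rd U(2) Ur in auto)
    then show "U \<in> (\<lambda>S. \<Inter>(hplane ` S)) ` Pow H" using Ur by blast
  qed
qed

lemma hadwiger_sum: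
  fixes \<Phi> :: "'a flag"
  assumes fl: "is_flag r \<Phi>" and nm: "normals r \<Phi> \<nu>" and A: "polyhedral H UNIV A"
    and S: "finite S" "S \<subseteq> translates (flat \<Phi> r)"
      "{U\<in>translates (flat \<Phi> r). \<not> ae_on U (jumps \<nu> r (DIM('a) - r) (indicat_real A)) (\<lambda>_. 0)} \<subseteq> S"
  shows "hadwiger r \<Phi> A L = vol_const TYPE('a) r * (\<Sum>U\<in>S. flat_int U (jumps \<nu> r (DIM('a) - r) (indicat_real A)))"
proof -
  let ?f = "jumps \<nu> r (DIM('a) - r) (indicat_real A)" and ?V = "flat \<Phi> r"
  have rd: "r \<le> DIM('a)" using nm by (simp add: normals_def)
  have V: "affine ?V" "?V \<noteq> {}" using tower_affine[OF normals_tower[OF nm]] by auto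
  have ad: "aff_dim ?V = int r" using fl rd by (simp add: is_flag_def)
  have H: "finite H" "pw_const UNIV H (indicat_real A)" using A polyhedral_pw_const_indicator[OF A] by (auto simp: polyhedral_def)
  have fr: "flat (translate_flag r l \<Phi>) r = (+) l ` ?V" for l using flat_translate[of r r l \<Phi>] rd by simp
  have inj: "inj_on (\<lambda>\<Psi>. flat \<Psi> r) ((\<lambda>l. translate_flag r l \<Phi>) ` L)"
    by (rule inj_onI) (auto simp: fr intro: translate_flag_eqI[OF nm])
  have im: "(\<lambda>\<Psi>. flat \<Psi> r) ` (\<lambda>l. translate_flag r l \<Phi>) ` L = translates ?V"
    by (auto simp: translates_def fr image_image)
  have fw: "flag_weight r (translate_flag r l \<Phi>) A = vol_const TYPE('a) r * flat_int ((+) l ` ?V) ?f" for l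
  proof -
    have "affine (flat (translate_flag r l \<Phi>) r)" "aff_dim (flat (translate_flag r l \<Phi>) r) = int r"
      using V(1) ad affine_translation[of ?V l] aff_dim_translation_eq[of l ?V] by (auto simp: fr)
    from flag_weight_flat_int[OF normals_translate[OF nm] this A] show ?thesis by (simp add: fr)
  qed
  have pw_const: "bpw_const U ?f" for U
  proof -
    obtain R where "\<And>x. norm x > R \<Longrightarrow> indicat_real A x = 0" using bpw_const_indicator[OF A] by (auto simp: bpw_const_def)
    then have "norm x > R \<Longrightarrow> ?f x = 0" for x by (rule vanish_jumps)
    moreover have "pw_const U H ?f" using pw_const_jumps_UNIV[OF H] pw_const_mono by blast
    ultimately show ?thesis using H(1) unfolding bpw_const_def by blast
  qed
  have "hadwiger r \<Phi> A L = (\<Sum>\<^sub>\<infinity>\<Psi>\<in>(\<lambda>l. translate_flag r l \<Phi>) ` L. (\<lambda>U. vol_const TYPE('a) r * flat_int U ?f) (flat \<Psi> r))"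
    unfolding hadwiger_def by (intro infsum_cong) (auto simp: fw fr)
  also have "\<dots> = (\<Sum>\<^sub>\<infinity>U\<in>translates ?V. vol_const TYPE('a) r * flat_int U ?f)"
    using infsum_reindex[OF inj, of "\<lambda>U. vol_const TYPE('a) r * flat_int U ?f"] im by (simp add: comp_def)
  also have "\<dots> = (\<Sum>\<^sub>\<infinity>U\<in>S. vol_const TYPE('a) r * flat_int U ?f)"
  proof (rule infsum_cong_neutral)
    fix U assume U: "U \<in> translates ?V - S"
    then have ae: "ae_on U ?f (\<lambda>_. 0)" using S(3) by blast
    have "affine U" "U \<noteq> {}" using U V affine_translation by (auto simp: translates_def)
    from flat_int_cong[OF this pw_const bpw_const_zero ae] show "vol_const TYPE('a) r * flat_int U ?f = 0" by (simp add: flat_int_zero)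
  qed (use S(2) in auto)
  also have "\<dots> = vol_const TYPE('a) r * (\<Sum>U\<in>S. flat_int U ?f)" using S(1) by (simp add: sum_distrib_left)
  finally show ?thesis .
qed

text \<open>Here \<open>nj\<close> is the induction hypothesis and \<open>sum0\<close> the Hadwiger
  condition: the first makes the periodization constant on \<open>V\<close>, the second makes the
  constant zero.\<close>

lemma periodize_jumps_zero_step:
  fixes \<Phi> :: "'a flag"
  assumes nm: "normals k \<Phi> \<nu>" and H: "finite H" "pw_const UNIV H g" and van: "\<And>y. norm y > \<rho> \<Longrightarrow> g y = 0"
    and V: "V = flat \<Phi> k" and f: "f = jumps \<nu> k (DIM('a) - k) g"
    and sum0: "(\<Sum>U\<in>{U\<in>translates V. \<not> ae_on U f (\<lambda>_. 0)}. flat_int U f) = 0"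
    and nj: "\<And>W n. hplane_in V W n \<Longrightarrow> ae_on W (periodize L \<rho> (jump n f)) (\<lambda>_. 0)"
  shows "ae_on V (periodize L \<rho> f) (\<lambda>_. 0)"
proof -
  have aff: "affine V" "V \<noteq> {}" using tower_affine[OF normals_tower[OF nm]] by (auto simp: V)
  have vf: "\<And>y. norm y > \<rho> \<Longrightarrow> f y = 0" unfolding f by (rule vanish_jumps) (rule van)
  have pf: "pw_const UNIV H f" unfolding f by (rule pw_const_jumps_UNIV[OF H])
  have lp: "lpw_const V (periodize L \<rho> f)" by (rule lpw_const_mono[OF periodize_lpw_const[OF vf H(1) pf]]) auto
  have "jump n (periodize L \<rho> f) = periodize L \<rho> (jump n f)" for n using periodize_jump[OF vf H(1) pf] by blast
  then obtain c where c: "ae_on V (periodize L \<rho> f) (\<lambda>_. c)"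
    using no_jump_const[OF aff lp] nj by metis
  have fs: "finite {U\<in>translates V. \<not> ae_on U f (\<lambda>_. 0)}" unfolding V f by (rule finite_support[OF nm H])
  have "c = 0"
  proof (cases "span (L \<inter> dirs V) = dirs V")
    case True
    show ?thesis by (rule const_zero_full[OF aff True vf H(1) pf c fs sum0])
  next
    case False
    show ?thesis by (rule const_zero_thin[OF aff False vf c fs])
  qed
  then show ?thesis using c by simp
qed

lemma periodize_jumps_zero:
  fixes g :: "'a \<Rightarrow> real"
  assumes H: "finite H" "pw_const UNIV H g" and van: "\<And>y. norm y > \<rho> \<Longrightarrow> g y = 0"
    and hs: "\<And>k (\<Phi>::'a flag) \<nu>. k \<le> DIM('a) \<Longrightarrow> is_flag k \<Phi> \<Longrightarrow> normals k \<Phi> \<nu> \<Longrightarrow>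
       (\<Sum>U\<in>{U\<in>translates (flat \<Phi> k). \<not> ae_on U (jumps \<nu> k (DIM('a) - k) g) (\<lambda>_. 0)}. flat_int U (jumps \<nu> k (DIM('a) - k) g)) = 0"
  shows "k \<le> DIM('a) \<Longrightarrow> is_flag k \<Phi> \<Longrightarrow> normals k \<Phi> \<nu> \<Longrightarrow> ae_on (flat \<Phi> k) (periodize L \<rho> (jumps \<nu> k (DIM('a) - k) g)) (\<lambda>_. 0)"
proof (induction k arbitrary: \<Phi> \<nu>)
  case (0 \<Phi> \<nu>)
  show ?case
  proof (rule periodize_jumps_zero_step[OF 0(3) H van refl refl hs[OF 0]])
    \<comment> \<open>A point has no nonzero direction, hence no hyperplanes: the induction starts
      with a vacuous condition.\<close>
    fix W n assume "hplane_in (flat \<Phi> 0) W n"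
    moreover have "affine (flat \<Phi> 0)" "aff_dim (flat \<Phi> 0) = int 0" using 0(2) by (auto simp: is_flag_def)
    then have "dirs (flat \<Phi> 0) \<subseteq> {0}" using dim_dirs by (metis dim_eq_0)
    ultimately show "ae_on W (periodize L \<rho> (jump n (jumps \<nu> 0 (DIM('a) - 0) g))) (\<lambda>_. 0)" by (auto simp: hplane_in_def)
  qed
next
  case (Suc k \<Phi> \<nu>)
  show ?case
  proof (rule periodize_jumps_zero_step[OF Suc.prems(3) H van refl refl hs[OF Suc.prems]])
    fix W n assume hp: "hplane_in (flat \<Phi> (Suc k)) W n"
    obtain \<Phi>' where \<Phi>': "is_flag k \<Phi>'" "flat \<Phi>' k = W" "normals k \<Phi>' (\<nu>(k := n))"
      using extend_flag[OF Suc.prems(2,1,3) hp] by blast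
    have "DIM('a) - k = Suc (DIM('a) - Suc k)" using Suc.prems(1) by simp
    moreover have "jumps (\<nu>(k := n)) (Suc k) (DIM('a) - Suc k) g = jumps \<nu> (Suc k) (DIM('a) - Suc k) g" by (rule jumps_cong) auto
    ultimately have e: "jumps (\<nu>(k := n)) k (DIM('a) - k) g = jump n (jumps \<nu> (Suc k) (DIM('a) - Suc k) g)" by simp
    show "ae_on W (periodize L \<rho> (jump n (jumps \<nu> (Suc k) (DIM('a) - Suc k) g))) (\<lambda>_. 0)"
      using Suc.IH[OF Suc_leD[OF Suc.prems(1)] \<Phi>'(1,3)] unfolding e \<Phi>'(2) .
  qed
qed

end

section \<open>Polytopes as regular closed unions of cells\<close>

text \<open>A set that is the closure of its interior is determined by its generic points, so set
  identities need checking at those only.\<close>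

definition regular_polyhedral :: "('a::euclidean_space \<times> real) set \<Rightarrow> 'a set \<Rightarrow> bool" where
  "regular_polyhedral H A \<longleftrightarrow> polyhedral H UNIV A \<and> A \<subseteq> closure (interior A)"

lemma regular_mono: "regular_polyhedral H A \<Longrightarrow> finite H' \<Longrightarrow> H \<subseteq> H' \<Longrightarrow> regular_polyhedral H' A"
  unfolding regular_polyhedral_def polyhedral_def by (meson order_refl pw_const_mono)

lemma polyhedron_pw_const:
  assumes "polyhedron S"
  shows "\<exists>H. finite H \<and> pw_const UNIV H (\<lambda>x. x \<in> S)"
proof -
  obtain F where F: "finite F" "S = \<Inter>F" "\<forall>h\<in>F. \<exists>a b. a \<noteq> 0 \<and> h = {x. a \<bullet> x \<le> b}" using assms by (auto simp: polyhedron_def)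
  then have "\<forall>h\<in>F. \<exists>q. h = {x. fst q \<bullet> x \<le> snd q}" by (metis fst_conv snd_conv)
  then obtain k where k: "\<And>h. h \<in> F \<Longrightarrow> h = {x. fst (k h) \<bullet> x \<le> snd (k h)}" by metis
  have S: "x \<in> S \<longleftrightarrow> (\<forall>h\<in>k ` F. side h x \<noteq> 1)" for x
  proof -
    have "x \<in> h \<longleftrightarrow> side (k h) x \<noteq> 1" if "h \<in> F" for h
    proof -
      have "side (k h) x \<noteq> 1 \<longleftrightarrow> fst (k h) \<bullet> x \<le> snd (k h)" by (auto simp: side_def sgn_if)
      then show ?thesis using k[OF that] by blast
    qed
    then show ?thesis unfolding F(2) by auto
  qed
  have "pw_const UNIV (k ` F) (\<lambda>x. x \<in> S)" unfolding pw_const_def S by (simp add: same_cell_def)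
  then show ?thesis using F(1) by blast
qed

lemma simplex_regular:
  fixes S :: "'a::euclidean_space set"
  assumes "int DIM('a) simplex S"
  shows "closed S" "bounded S" "S \<subseteq> closure (interior S)" "\<exists>H. finite H \<and> pw_const UNIV H (\<lambda>x. x \<in> S)"
proof -
  show "closed S" "bounded S" using compact_simplex[OF assms] compact_imp_closed compact_imp_bounded by auto
  have c: "convex S" using convex_simplex[OF assms] .
  have "aff_dim S = int DIM('a)" using aff_dim_simplex[OF assms] .
  then have a: "affine hull S = UNIV" by (simp add: aff_dim_eq_full)
  then have "S \<noteq> {}" by auto
  then have "interior S \<noteq> {}" using rel_interior_interior[OF a] rel_interior_eq_empty[OF c] by auto
  then show "S \<subseteq> closure (interior S)" using convex_closure_interior[OF c] closure_subset by blast
  show "\<exists>H. finite H \<and> pw_const UNIV H (\<lambda>x. x \<in> S)" using polyhedron_pw_const simplex_imp_polyhedron[OF assms] by blast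
qed

lemma region_regular:
  assumes "polytope_region A" shows "\<exists>H. regular_polyhedral H A"
proof -
  obtain \<S> where S: "finite \<S>" "\<And>S. S \<in> \<S> \<Longrightarrow> int DIM('a) simplex S" "A = \<Union>\<S>" using assms by (auto simp: polytope_region_def)
  obtain h where h: "\<And>S. S \<in> \<S> \<Longrightarrow> finite (h S) \<and> pw_const UNIV (h S) (\<lambda>x. x \<in> S)" using simplex_regular(4)[OF S(2)] by metis
  define H where "H = \<Union>(h ` \<S>)"
  have fH: "finite H" using S(1) h by (auto simp: H_def)
  have pS: "pw_const UNIV H (\<lambda>x. x \<in> S)" if "S \<in> \<S>" for S by (rule pw_const_mono[OF conjunct2[OF h[OF that]]]) (use that in \<open>auto simp: H_def\<close>)
  have "pw_const UNIV H (\<lambda>x. x \<in> A)" unfolding pw_const_def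
  proof (intro ballI impI)
    fix x y assume "same_cell H x y"
    then have "x \<in> S \<longleftrightarrow> y \<in> S" if "S \<in> \<S>" for S using pcD[OF pS[OF that]] by blast
    then show "x \<in> A \<longleftrightarrow> y \<in> A" unfolding S(3) by blast
  qed
  moreover have "closed A" "bounded A" unfolding S(3) using S(1) simplex_regular(1,2)[OF S(2)] by (auto intro: closed_Union)
  moreover have "A \<subseteq> closure (interior A)"
  proof
    fix x assume "x \<in> A"
    then obtain T where T: "T \<in> \<S>" "x \<in> T" using S(3) by blast
    then have "x \<in> closure (interior T)" using simplex_regular(3)[OF S(2)] by blast
    moreover have "interior T \<subseteq> interior A" using T S(3) by (intro interior_mono) auto
    ultimately show "x \<in> closure (interior A)" using closure_mono by blast
  qed
  ultimately show ?thesis using fH unfolding regular_polyhedral_def polyhedral_def by blast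
qed

text \<open>Of a triangulation only the full-dimensional simplices are kept. The others are
  negligible, so the closed union of those kept contains the interior of \<open>P\<close> and
  therefore \<open>P\<close>.\<close>

lemma polytope_simplices:
  fixes P :: "'a::euclidean_space set"
  assumes "polytope P" "interior P \<noteq> {}"
  obtains \<S> where "finite \<S>" "\<And>S. S \<in> \<S> \<Longrightarrow> int DIM('a) simplex S"
    "pairwise (\<lambda>S T. interior S \<inter> interior T = {}) \<S>" "\<Union>\<S> = P"
proof -
  have P: "convex P" "closed P" using assms(1) polytope_imp_convex polytope_imp_closed by auto
  obtain \<T> where T: "simplicial_complex \<T>" "\<Union>\<T> = \<Union>{P}"
  proof (rule simplicial_subdivision_of_cell_complex[of "{P}"])
    show "polytope C" if "C \<in> {P}" for C using that assms(1) by simp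
    show "C1 \<inter> C2 face_of C1" if "C1 \<in> {P}" "C2 \<in> {P}" for C1 C2 using that face_of_refl[OF P(1)] by simp
  qed auto
  have fT: "finite \<T>" and sT: "\<And>S. S \<in> \<T> \<Longrightarrow> \<exists>n. n simplex S" and iT: "\<And>S S'. S \<in> \<T> \<Longrightarrow> S' \<in> \<T> \<Longrightarrow> (S \<inter> S') face_of S"
    using T(1) unfolding simplicial_complex_def by blast+
  define \<S> where "\<S> = {S\<in>\<T>. aff_dim S = int DIM('a)}"
  have simp: "int DIM('a) simplex S" if "S \<in> \<S>" for S
  proof -
    obtain n where n: "n simplex S" using sT[of S] \<open>S \<in> \<S>\<close> by (auto simp: \<S>_def)
    then have "n = int DIM('a)" using aff_dim_simplex[OF n] that by (simp add: \<S>_def)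
    then show ?thesis using n by simp
  qed
  have fS: "finite \<S>" using fT by (simp add: \<S>_def)
  have cS: "closed (\<Union>\<S>)" using fS simp simplex_regular(1) by (intro closed_Union) auto
  have "interior P \<subseteq> \<Union>\<S>"
  proof (rule ccontr)
    assume "\<not> interior P \<subseteq> \<Union>\<S>"
    then have ne: "interior P - \<Union>\<S> \<noteq> {}" by blast
    have "negligible S" if "S \<in> \<T> - \<S>" for S
    proof -
      have "aff_dim S < int DIM('a)" using that aff_dim_le_DIM[of S] by (auto simp: \<S>_def)
      then obtain a b where "a \<noteq> 0" "S \<subseteq> {x. a \<bullet> x = b}" using aff_lowdim_subset_hyperplane by blast
      then show ?thesis using negligible_hyperplane[of a b] negligible_subset by blast
    qed
    then have "negligible (\<Union>(\<T> - \<S>))" using fT by (intro negligible_Union) auto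
    moreover have "interior P - \<Union>\<S> \<subseteq> \<Union>(\<T> - \<S>)" using T(2) interior_subset[of P] by auto
    ultimately have "negligible (interior P - \<Union>\<S>)" using negligible_subset by blast
    moreover have "open (interior P - \<Union>\<S>)" using cS by (simp add: open_Diff)
    ultimately show False using ne open_not_negligible by blast
  qed
  then have "closure (interior P) \<subseteq> \<Union>\<S>" using cS closure_minimal by blast
  then have "P \<subseteq> \<Union>\<S>" using convex_closure_interior[OF P(1) assms(2)] P(2) by simp
  moreover have "\<Union>\<S> \<subseteq> P" using T(2) by (auto simp: \<S>_def)
  moreover have "pairwise (\<lambda>S T. interior S \<inter> interior T = {}) \<S>"
  proof (rule pairwiseI, rule ccontr)
    fix S S' assume SS: "S \<in> \<S>" "S' \<in> \<S>" "S \<noteq> S'" "interior S \<inter> interior S' \<noteq> {}"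
    \<comment> \<open>The intersection is a face of \<open>A\<close>, and a proper face misses the
      interior.\<close>
    have eq: "A \<inter> B = A" if "A \<in> \<S>" "B \<in> \<S>" "interior A \<inter> interior B \<noteq> {}" for A B
    proof (rule ccontr)
      assume "A \<inter> B \<noteq> A"
      moreover have "(A \<inter> B) face_of A" using iT that by (auto simp: \<S>_def)
      ultimately have "(A \<inter> B) \<inter> rel_interior A = {}" using face_of_disjoint_rel_interior by blast
      moreover have "interior A \<subseteq> rel_interior A" by (rule interior_subset_rel_interior)
      ultimately show False using that interior_subset by blast
    qed
    have "S = S'" using eq[of S S'] eq[of S' S] SS by blast
    then show False using SS by simp
  qed
  ultimately show thesis using that[of \<S>] fS simp by blast
qed

lemma generic_cell_open:
  assumes "finite H" "generic UNIV H x"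
  shows "open {y. same_cell H x y}"
proof (rule openI)
  fix y assume y: "y \<in> {y. same_cell H x y}"
  then have "generic UNIV H y" using assms(2) same_cell_hplane unfolding generic_def by blast
  then obtain e where "e > 0" "\<forall>z\<in>UNIV \<inter> ball y e. same_cell H y z" using generic_local[OF assms(1)] by blast
  then show "\<exists>e>0. ball y e \<subseteq> {y. same_cell H x y}" using y same_cell_trans by blast
qed

text \<open>Closing an open cell amounts to relaxing its strict inequalities: from a point
  satisfying the weak ones, the segment towards \<open>x\<close> enters the cell at once.\<close>

lemma generic_cell_polyhedron:
  assumes "finite H" "generic UNIV H x"
  shows "polyhedron (closure {y. same_cell H x y})"
proof -
  \<comment> \<open>Multiplying by \<open>side h x\<close> orients the half-space towards
    \<open>x\<close>; for a degenerate \<open>h\<close> with sign 0 it is the whole space.\<close>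
  define D where "D h = {y. (side h x *\<^sub>R fst h) \<bullet> y \<ge> side h x * snd h}" for h
  have pos: "side h x * (fst h \<bullet> x - snd h) > 0" if "side h x \<noteq> 0" for h
    using that by (auto simp: side_def sgn_if)
  have "closure {y. same_cell H x y} = \<Inter>(D ` H)"
  proof
    have cD: "closed (\<Inter>(D ` H))" unfolding D_def by (intro closed_INT ballI closed_halfspace_ge)
    have "{y. same_cell H x y} \<subseteq> \<Inter>(D ` H)"
    proof clarify
      fix y h assume "same_cell H x y" "h \<in> H"
      then have e: "side h x = side h y" by (simp add: same_cell_def)
      have "side h y * (fst h \<bullet> y - snd h) \<ge> 0" by (auto simp: side_def sgn_if)
      then show "y \<in> D h" unfolding D_def e by (simp add: algebra_simps)
    qed
    then show "closure {y. same_cell H x y} \<subseteq> \<Inter>(D ` H)" using cD closure_minimal by blast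
    show "\<Inter>(D ` H) \<subseteq> closure {y. same_cell H x y}"
    proof
      fix y assume y: "y \<in> \<Inter>(D ` H)"
      have z: "same_cell H x (y + t *\<^sub>R (x - y))" if t: "0 < t" "t \<le> 1" for t
        unfolding same_cell_def
      proof
        fix h assume h: "h \<in> H"
        show "side h x = side h (y + t *\<^sub>R (x - y))"
        proof (cases "side h x = 0")
          case True
          then have "UNIV \<subseteq> hplane h" using assms(2) h unfolding generic_def side_eq_0 by blast
          then have "side h z = 0" for z unfolding side_eq_0 by blast
          then show ?thesis by simp
        next
          case False
          have e: "fst h \<bullet> (y + t *\<^sub>R (x - y)) - snd h = (1 - t) * (fst h \<bullet> y - snd h) + t * (fst h \<bullet> x - snd h)"
            by (simp add: inner_add_right inner_diff_right algebra_simps)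
          have "side h x * (fst h \<bullet> y - snd h) \<ge> 0" using y h by (auto simp: D_def algebra_simps)
          then have "(1 - t) * (side h x * (fst h \<bullet> y - snd h)) + t * (side h x * (fst h \<bullet> x - snd h)) > 0"
            using mult_pos_pos[OF t(1) pos[OF False]] mult_nonneg_nonneg[of "1 - t" "side h x * (fst h \<bullet> y - snd h)"] t(2) by linarith
          then have "side h x * (fst h \<bullet> (y + t *\<^sub>R (x - y)) - snd h) > 0" unfolding e by (simp add: algebra_simps)
          then show ?thesis using False by (auto simp: side_def sgn_if zero_less_mult_iff split: if_splits)
        qed
      qed
      have "((\<lambda>t. y + t *\<^sub>R (x - y)) \<longlongrightarrow> y + 0 *\<^sub>R (x - y)) (at_right 0)" by (intro tendsto_intros)
      moreover have "\<forall>\<^sub>F t in at_right 0. y + t *\<^sub>R (x - y) \<in> closure {y. same_cell H x y}"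
        unfolding eventually_at_right_field
        by (rule exI[of _ 1]) (use z closure_subset in fastforce)
      ultimately show "y \<in> closure {y. same_cell H x y}"
        using Lim_in_closed_set[of "closure {y. same_cell H x y}" _ "at_right 0"] by force
    qed
  qed
  moreover have "polyhedron (D h)" for h unfolding D_def by (rule polyhedron_halfspace_ge)
  then have "polyhedron (\<Inter>(D ` H))" using assms(1) by (intro polyhedron_Inter) auto
  ultimately show ?thesis by simp
qed

text \<open>The hyperplanes of \<open>H\<close> cut \<open>A\<close> into open convex cells whose
  closures cover it by regularity. The closures are triangulated separately; simplices of
  neighbouring cells need not meet face to face.\<close>

lemma regular_region:
  fixes A :: "'a::euclidean_space set"
  assumes "regular_polyhedral H A" shows "polytope_region A"
proof -
  have H: "finite H" and cA: "closed A" "bounded A" and pA: "pw_const UNIV H (\<lambda>x. x \<in> A)" and rA: "A \<subseteq> closure (interior A)"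
    using assms by (auto simp: regular_polyhedral_def polyhedral_def)
  define c where "c x = {y. same_cell H x y}" for x
  define \<C> where "\<C> = c ` {x\<in>A. generic UNIV H x}"
  have cs: "c x \<subseteq> A" if "x \<in> A" for x using that pcD[OF pA] by (auto simp: c_def)
  have ceq: "C = D" if "C \<in> \<C>" "D \<in> \<C>" "C \<inter> D \<noteq> {}" for C D
  proof -
    from that obtain x y z where "C = c x" "D = c y" "same_cell H x z" "same_cell H y z" by (auto simp: \<C>_def c_def)
    moreover from this have "same_cell H x y" using same_cell_sym same_cell_trans by blast
    ultimately show ?thesis unfolding c_def using same_cell_sym same_cell_trans by blast
  qed
  have "finite \<C>"
  proof (rule finite_disjoint_pw_const[OF H, where W = UNIV])
    fix C assume "C \<in> \<C>"
    then obtain x where x: "C = c x" by (auto simp: \<C>_def)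
    have "pw_const UNIV H (\<lambda>y. y \<in> c x)" unfolding pw_const_def c_def using same_cell_sym same_cell_trans by blast
    moreover have "x \<in> c x" by (simp add: c_def)
    ultimately show "C \<noteq> {} \<and> C \<subseteq> UNIV \<and> pw_const UNIV H (\<lambda>x. x \<in> C)" using x by blast
  qed (rule ceq)
  have C: "open C" "convex C" "C \<noteq> {}" "polytope (closure C)" "closure C \<subseteq> A" if CC: "C \<in> \<C>" for C
  proof -
    obtain x where x: "x \<in> A" "generic UNIV H x" "C = c x" using CC by (auto simp: \<C>_def)
    show "open C" unfolding x(3) c_def by (rule generic_cell_open[OF H x(2)])
    show "convex C" unfolding x(3) c_def by (rule convex_same_cell_class)
    show "C \<noteq> {}" unfolding x(3) c_def using same_cell_refl by blast
    show sub: "closure C \<subseteq> A" using cs[OF x(1)] x(3) cA(1) closure_minimal by blast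
    have "polyhedron (closure C)" unfolding x(3) c_def by (rule generic_cell_polyhedron[OF H x(2)])
    then show "polytope (closure C)" using sub cA(2) bounded_subset polytope_eq_bounded_polyhedron by blast
  qed
  have int: "interior (closure C) = C" if "C \<in> \<C>" for C
    using C(1,2)[OF that] convex_interior_closure interior_open by metis
  have "\<exists>\<S>. finite \<S> \<and> (\<forall>S\<in>\<S>. int DIM('a) simplex S) \<and> pairwise (\<lambda>S T. interior S \<inter> interior T = {}) \<S> \<and> \<Union>\<S> = closure C" if "C \<in> \<C>" for C
    using polytope_simplices[OF C(4)[OF that]] int[OF that] C(3)[OF that] by metis
  then obtain s where s: "\<And>C. C \<in> \<C> \<Longrightarrow> finite (s C)" "\<And>C S. C \<in> \<C> \<Longrightarrow> S \<in> s C \<Longrightarrow> int DIM('a) simplex S"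
    "\<And>C. C \<in> \<C> \<Longrightarrow> pairwise (\<lambda>S T. interior S \<inter> interior T = {}) (s C)" "\<And>C. C \<in> \<C> \<Longrightarrow> \<Union>(s C) = closure C"
    by metis
  have "A \<subseteq> \<Union>(closure ` \<C>)"
  proof
    fix x assume x: "x \<in> A"
    have "x \<in> closure (\<Union>\<C>)" unfolding closure_approachable
    proof (intro allI impI)
      fix e :: real assume "e > 0"
      have "x \<in> closure (interior A)" using x rA by blast
      then obtain y where y: "y \<in> interior A" "dist y x < e" using \<open>e > 0\<close> unfolding closure_approachable by blast
      obtain d where d: "d > 0" "ball y d \<subseteq> interior A" using y(1) open_interior open_contains_ball by blast
      obtain z where z: "dist y z < min d (e - dist y x)" "generic UNIV H z"
        using generic_dense[OF H affine_UNIV, of y "min d (e - dist y x)"] d(1) y(2) by auto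
      have "z \<in> A" using d(2) z(1) interior_subset by fastforce
      then have "c z \<in> \<C>" using z(2) by (auto simp: \<C>_def)
      moreover have "z \<in> c z" by (simp add: c_def)
      moreover have "dist z x < e" using dist_triangle[of z x y] z(1) by (simp add: dist_commute)
      ultimately show "\<exists>z\<in>\<Union>\<C>. dist z x < e" by blast
    qed
    moreover have "closed (\<Union>(closure ` \<C>))" using \<open>finite \<C>\<close> by (intro closed_Union) auto
    moreover have "\<Union>\<C> \<subseteq> \<Union>(closure ` \<C>)" using closure_subset by blast
    ultimately show "x \<in> \<Union>(closure ` \<C>)" using closure_minimal by blast
  qed
  moreover have "\<Union>(\<Union>(s ` \<C>)) = \<Union>(closure ` \<C>)"
  proof -
    have "\<Union>(\<Union>(s ` \<C>)) = (\<Union>C\<in>\<C>. \<Union>(s C))" by blast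
    also have "\<dots> = \<Union>(closure ` \<C>)" using s(4) by simp
    finally show ?thesis .
  qed
  ultimately have A: "A = \<Union>(\<Union>(s ` \<C>))" using C(5) by blast
  moreover have "finite (\<Union>(s ` \<C>))" using \<open>finite \<C>\<close> s(1) by blast
  moreover have "pairwise (\<lambda>S T. interior S \<inter> interior T = {}) (\<Union>(s ` \<C>))"
  proof (rule pairwiseI)
    fix S T assume ST: "S \<in> \<Union>(s ` \<C>)" "T \<in> \<Union>(s ` \<C>)" "S \<noteq> T"
    then obtain C D where CD: "C \<in> \<C>" "D \<in> \<C>" "S \<in> s C" "T \<in> s D" by blast
    show "interior S \<inter> interior T = {}"
    proof (cases "C = D")
      case True
      then show ?thesis using s(3)[OF CD(1)] CD ST(3) by (simp add: pairwise_def)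
    next
      case False
      have "S \<subseteq> closure C" "T \<subseteq> closure D" using CD s(4) by blast+
      then have "interior S \<subseteq> C" "interior T \<subseteq> D" using int CD interior_mono by blast+
      then show ?thesis using ceq CD False by blast
    qed
  qed
  ultimately show ?thesis using s(2) unfolding polytope_region_def by blast
qed

text \<open>Intersections and differences of regular closed sets may acquire thin parts or lose
  boundary; closing the interior repairs this without touching generic points.\<close>

lemma reg_regular:
  fixes X :: "'a::euclidean_space set"
  assumes "finite H" "pw_const UNIV H (\<lambda>x. x \<in> X)" "bounded X"
  shows "regular_polyhedral H (closure (interior X))"
    and "generic UNIV H x \<Longrightarrow> x \<in> closure (interior X) \<longleftrightarrow> x \<in> X"
proof -
  have "pw_const UNIV H (\<lambda>x. x \<in> - X)" using assms(2) unfolding pw_const_def by blast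
  then have "pw_const UNIV H (\<lambda>x. x \<in> closure (- X))" using assms(1) by (intro pw_const_closure) auto
  then have pi: "pw_const UNIV H (\<lambda>x. x \<in> interior X)" unfolding interior_closure pw_const_def by blast
  then have "pw_const UNIV H (\<lambda>x. x \<in> closure (interior X))" using assms(1) by (intro pw_const_closure) auto
  moreover have "bounded (closure (interior X))" using assms(3) bounded_closure bounded_interior by blast
  moreover have "closure (interior X) \<subseteq> closure (interior (closure (interior X)))"
    by (intro closure_mono interior_maximal) (auto simp: closure_subset)
  ultimately show "regular_polyhedral H (closure (interior X))" using assms(1) unfolding regular_polyhedral_def polyhedral_def by simp
  assume g: "generic UNIV H x"
  have "x \<in> closure (interior X) \<longleftrightarrow> x \<in> interior X" by (rule generic_closure[OF assms(1) _ pi _ g]) auto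
  also have "\<dots> \<longleftrightarrow> x \<in> X"
  proof
    assume x: "x \<in> X"
    obtain e where "e > 0" "\<forall>y\<in>UNIV \<inter> ball x e. same_cell H x y" using generic_local[OF assms(1) g] by blast
    then have "ball x e \<subseteq> X" using x pcD[OF assms(2)] by blast
    then show "x \<in> interior X" using \<open>e > 0\<close> by (meson centre_in_ball interior_maximal open_ball subsetD)
  qed (use interior_subset in auto)
  finally show "x \<in> closure (interior X) \<longleftrightarrow> x \<in> X" .
qed

lemma regular_eq_closure_generic:
  assumes "regular_polyhedral H A" "finite G" "closed B" "\<And>x. x \<in> A \<Longrightarrow> generic UNIV G x \<Longrightarrow> x \<in> B"
  shows "A \<subseteq> B"
proof -
  have "interior A \<subseteq> closure B"
  proof
    fix x assume x: "x \<in> interior A"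
    obtain d where d: "d > 0" "ball x d \<subseteq> interior A" using x open_interior open_contains_ball by blast
    show "x \<in> closure B" unfolding closure_approachable
    proof (intro allI impI)
      fix e :: real assume "e > 0"
      obtain z where z: "dist x z < min d e" "generic UNIV G z" using generic_dense[OF assms(2) affine_UNIV, of x "min d e"] d(1) \<open>e > 0\<close> by auto
      then have "z \<in> A" using d(2) interior_subset by fastforce
      then show "\<exists>z\<in>B. dist z x < e" using assms(4) z by (auto simp: dist_commute)
    qed
  qed
  then have "closure (interior A) \<subseteq> B" using assms(3) closure_minimal by (metis closure_closed)
  then show ?thesis using assms(1) by (auto simp: regular_polyhedral_def)
qed

section \<open>Equidecomposability\<close>

lemma equidecomposable_empty: "equidecomposable L {} {}"
  unfolding equidecomposable_def by (rule exI[of _ 0]) auto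

lemma equidecomposable_insert:
  fixes A :: "'a::euclidean_space set"
  assumes "equidecomposable L A B" "polytope_region C" "polytope_region ((+) l ` C)" "l \<in> L"
    "interior A \<inter> interior C = {}" "interior B \<inter> interior ((+) l ` C) = {}"
  shows "equidecomposable L (A \<union> C) (B \<union> (+) l ` C)"
proof -
  obtain N :: nat and P Q m where e: "\<forall>j<N. polytope_region (P j) \<and> polytope_region (Q j)"
        "pairwise (\<lambda>i j. interior (P i) \<inter> interior (P j) = {}) {..<N}"
        "pairwise (\<lambda>i j. interior (Q i) \<inter> interior (Q j) = {}) {..<N}"
        "A = (\<Union>j<N. P j)" "B = (\<Union>j<N. Q j)"
        "\<forall>j<N. m j \<in> L \<and> Q j = (+) (m j) ` P j"
    using assms(1) unfolding equidecomposable_def by blast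
  let ?P = "P(N := C)" and ?Q = "Q(N := (+) l ` C)" and ?m = "m(N := l)"
  have "interior (P j) \<inter> interior C = {}" if "j < N" for j
  proof -
    have "interior (P j) \<subseteq> interior A" using that unfolding e(4) by (intro interior_mono) auto
    then show ?thesis using assms(5) by blast
  qed
  moreover have "interior (Q j) \<inter> interior ((+) l ` C) = {}" if "j < N" for j
  proof -
    have "interior (Q j) \<subseteq> interior B" using that unfolding e(5) by (intro interior_mono) auto
    then show ?thesis using assms(6) by blast
  qed
  moreover have "{..<Suc N} = insert N {..<N}" by auto
  ultimately have pw: "pairwise (\<lambda>i j. interior (?P i) \<inter> interior (?P j) = {}) {..<Suc N}"
        "pairwise (\<lambda>i j. interior (?Q i) \<inter> interior (?Q j) = {}) {..<Suc N}"
    using e(2,3) by (auto simp: pairwise_def)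
  show ?thesis unfolding equidecomposable_def
  proof (rule exI[of _ "Suc N"], rule exI[of _ ?P], rule exI[of _ ?Q], rule exI[of _ ?m], intro conjI pw)
    show "\<forall>j<Suc N. polytope_region (?P j) \<and> polytope_region (?Q j)" using e(1) assms(2,3) by (auto simp: less_Suc_eq)
    show "A \<union> C = (\<Union>j<Suc N. ?P j)" unfolding e(4) by (auto simp: less_Suc_eq)
    show "B \<union> (+) l ` C = (\<Union>j<Suc N. ?Q j)" unfolding e(5) by (auto simp: less_Suc_eq)
    show "\<forall>j<Suc N. ?m j \<in> L \<and> ?Q j = (+) (?m j) ` ?P j" using e(6) assms(4) by (auto simp: less_Suc_eq)
  qed
qed

lemma pw_const_translate_set:
  fixes A :: "'a::euclidean_space set"
  assumes "finite H" "pw_const UNIV H (\<lambda>x. x \<in> A)"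
  shows "\<exists>H'. finite H' \<and> pw_const UNIV H' (\<lambda>x. x \<in> (+) l ` A)"
proof -
  let ?k = "\<lambda>h::'a \<times> real. (fst h, snd h + fst h \<bullet> l)"
  have k: "side (?k h) x = side h (x - l)" for h x by (simp add: side_def inner_diff_right algebra_simps)
  have "same_cell H (x - l) (y - l)" if "same_cell (?k ` H) x y" for x y using that by (auto simp: same_cell_def k)
  moreover have "x \<in> (+) l ` A \<longleftrightarrow> x - l \<in> A" for x by (force simp: image_iff)
  ultimately have "pw_const UNIV (?k ` H) (\<lambda>x. x \<in> (+) l ` A)" using assms(2) unfolding pw_const_def by blast
  then show ?thesis using assms(1) by blast
qed

lemma generic_in_open:
  assumes "finite H" "open U" "U \<noteq> {}"
  shows "\<exists>x\<in>U. generic UNIV H x"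
proof -
  obtain x e where "e > 0" "ball x e \<subseteq> U" using assms(2,3) open_contains_ball by blast
  then show ?thesis using generic_dense[OF assms(1) affine_UNIV, of x e] by auto
qed

section \<open>The greedy exchange\<close>

context discrete_group
begin

lemma periodize_ae:
  assumes "\<And>y. norm y > \<rho> \<Longrightarrow> f y = 0" "\<And>y. norm y > \<rho> \<Longrightarrow> g y = 0" "ae_on UNIV f g"
  shows "ae_on UNIV (periodize L \<rho> f) (periodize L \<rho> g)"
  unfolding ae_on_def
proof
  fix R
  let ?\<Lambda> = "{l\<in>L. norm l \<le> R + \<rho>}"
  have "ae_on UNIV (\<lambda>x. \<Sum>l\<in>?\<Lambda>. f (x + l)) (\<lambda>x. \<Sum>l\<in>?\<Lambda>. g (x + l))"
  proof (rule ae_on_sum[OF fin])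
    fix l
    have "ae_on ((+) l ` UNIV) f g" using assms(3) by (simp add: surj_plus)
    then show "ae_on UNIV (\<lambda>x. f (x + l)) (\<lambda>x. g (x + l))" by (rule ae_on_translate)
  qed
  from this[unfolded ae_on_def, THEN spec, of R] obtain H where H: "finite H" "\<forall>h\<in>H. \<not> UNIV \<subseteq> hplane h"
    "\<forall>x\<in>UNIV. norm x < R \<longrightarrow> (\<forall>h\<in>H. x \<notin> hplane h) \<longrightarrow> (\<Sum>l\<in>?\<Lambda>. f (x + l)) = (\<Sum>l\<in>?\<Lambda>. g (x + l))"
    by blast
  have "periodize L \<rho> f x = periodize L \<rho> g x" if "norm x < R" "\<forall>h\<in>H. x \<notin> hplane h" for x
  proof -
    have "norm x \<le> R" using that by simp
    then have "periodize L \<rho> f x = (\<Sum>l\<in>?\<Lambda>. f (x + l))" "periodize L \<rho> g x = (\<Sum>l\<in>?\<Lambda>. g (x + l))"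
      using periodize_eq[of \<rho> f x R] periodize_eq[of \<rho> g x R] assms(1,2) by blast+
    then show ?thesis using H(3) that by simp
  qed
  then show "\<exists>H. finite H \<and> (\<forall>h\<in>H. \<not> UNIV \<subseteq> hplane h) \<and> (\<forall>x\<in>UNIV. norm x < R \<longrightarrow> (\<forall>h\<in>H. x \<notin> hplane h) \<longrightarrow> periodize L \<rho> f x = periodize L \<rho> g x)"
    using H(1,2) by blast
qed

lemma periodize_shift:
  assumes van: "\<And>y. norm y > \<rho> \<Longrightarrow> f y = 0" "\<And>y. norm y > \<rho> \<Longrightarrow> g y = 0" and "\<And>y. f y = g (y + l)" "l \<in> L"
  shows "periodize L \<rho> f x = periodize L \<rho> g x"
proof -
  \<comment> \<open>The cut-off ball is not preserved by the shift; the set of nonzero terms is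
    carried along, so the sums are first reduced to it.\<close>
  have nz: "periodize L \<rho> h x = (\<Sum>l\<in>{l\<in>L. h (x + l) \<noteq> 0}. h (x + l))" if "\<And>y. norm y > \<rho> \<Longrightarrow> h y = 0" for h
    unfolding periodize_def
  proof (rule sum.mono_neutral_right)
    show "finite {l \<in> L. norm (x + l) \<le> \<rho>}" by (rule fin_translate)
    show "{l \<in> L. h (x + l) \<noteq> 0} \<subseteq> {l \<in> L. norm (x + l) \<le> \<rho>}" using that by force
  qed auto
  have "(\<Sum>k\<in>{k\<in>L. f (x + k) \<noteq> 0}. f (x + k)) = (\<Sum>k\<in>{k\<in>L. g (x + k) \<noteq> 0}. g (x + k))"
    by (rule sum.reindex_bij_witness[of _ "\<lambda>k. k - l" "\<lambda>k. k + l"]) (use assms(3,4) add diff in \<open>auto simp: algebra_simps\<close>)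
  then show ?thesis using nz[OF van(1)] nz[OF van(2)] by simp
qed

text \<open>For one lattice vector \<open>l\<close> after the other, move the part of \<open>A\<close> that \<open>l\<close> takes into \<open>B\<close>, and remove it from
  both sets. What is left of \<open>A\<close> and \<open>B\<close> then has equal periodizations without a common translate, so it is empty.\<close>

lemma greedy:
  assumes "finite S" "S \<subseteq> L" "regular_polyhedral HA A" "regular_polyhedral HB B" "A \<subseteq> cball 0 \<rho>" "B \<subseteq> cball 0 \<rho>"
    and "ae_on UNIV (periodize L \<rho> (\<lambda>x. indicator A x - indicator B x)) (\<lambda>_. 0)"
    and "\<And>l. l \<in> L - S \<Longrightarrow> interior A \<inter> (+) (- l) ` interior B = {}"
  shows "equidecomposable L A B"
  using assms
proof (induction S arbitrary: A B HA HB rule: finite_induct)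
  case empty
  \<comment> \<open>At an interior point \<open>x\<close> of \<open>X\<close> with vanishing
    periodization the term of \<open>0\<close> contributes 1, so some \<open>x + l\<close> must lie
    in \<open>Y\<close>. By regularity \<open>l\<close> then takes an interior point of
    \<open>X\<close> to an interior point of \<open>Y\<close>.\<close>
  have key: False if X: "regular_polyhedral HX X" and Y: "regular_polyhedral HY Y" and ne: "X \<noteq> {}"
      and ae: "ae_on UNIV (periodize L \<rho> (\<lambda>x. indicat_real X x - indicator Y x)) (\<lambda>_. 0)" and "X \<subseteq> cball 0 \<rho>"
      and dis: "\<And>l. l \<in> L \<Longrightarrow> interior X \<inter> (+) (- l) ` interior Y = {}" for X Y HX HY
  proof -
    have "interior X \<noteq> {}" using ne X by (auto simp: regular_polyhedral_def)
    then obtain x0 e where xe: "e > 0" "ball x0 e \<subseteq> interior X" using open_interior open_contains_ball by (metis ex_in_conv)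
    obtain x where x: "dist x0 x < e" "periodize L \<rho> (\<lambda>x. indicat_real X x - indicator Y x) x = 0"
      using ae_on_witness[OF ae affine_UNIV UNIV_I xe(1)] by blast
    have xX: "x \<in> interior X" using x xe by auto
    let ?D = "{l\<in>L. norm (x + l) \<le> \<rho>}"
    have fD: "finite ?D" by (rule fin_translate)
    have "x \<in> X" using xX interior_subset by auto
    then have D0: "0 \<in> ?D" using zero \<open>X \<subseteq> cball 0 \<rho>\<close> by auto
    have "\<exists>l\<in>?D. x + l \<in> Y"
    proof (rule ccontr)
      assume "\<not> ?thesis"
      then have "periodize L \<rho> (\<lambda>x. indicat_real X x - indicator Y x) x = (\<Sum>l\<in>?D. indicat_real X (x + l))"
        unfolding periodize_def by (intro sum.cong) auto
      moreover have "(\<Sum>l\<in>?D. indicat_real X (x + l)) \<ge> indicat_real X (x + 0)" using fD D0 by (intro member_le_sum) auto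
      ultimately show False using x(2) \<open>x \<in> X\<close> by simp
    qed
    then obtain l where l: "l \<in> L" "x + l \<in> Y" by blast
    then have "x + l \<in> closure (interior Y)" using Y by (auto simp: regular_polyhedral_def)
    moreover obtain d where d: "d > 0" "ball x d \<subseteq> interior X" using xX open_interior open_contains_ball by blast
    ultimately obtain y where y: "y \<in> interior Y" "dist y (x + l) < d" unfolding closure_approachable by blast
    have "y - l \<in> ball x d" using y(2) by (simp add: dist_norm norm_minus_commute algebra_simps)
    moreover have "y - l \<in> (+) (- l) ` interior Y" using y(1) by (intro image_eqI[of _ _ y]) auto
    ultimately show False using d(2) dis[OF l(1)] by blast
  qed
  have "A = {}"
    by (rule ccontr, rule key[OF empty(2,3) _ empty(6,4)]) (use empty(7) in auto)
  \<comment> \<open>The same argument with the roles exchanged: the periodization changes sign and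
    \<open>l\<close> becomes \<open>- l\<close>.\<close>
  moreover have "B = {}"
  proof (rule ccontr)
    assume ne: "B \<noteq> {}"
    have ae: "ae_on UNIV (periodize L \<rho> (\<lambda>x. indicat_real B x - indicator A x)) (\<lambda>_. 0)"
    proof (rule ae_on_combine[OF empty(6) empty(6)])
      fix x assume "periodize L \<rho> (\<lambda>x. indicat_real A x - indicat_real B x) x = 0"
      moreover have "periodize L \<rho> (\<lambda>x. indicat_real B x - indicator A x) x = - periodize L \<rho> (\<lambda>x. indicat_real A x - indicat_real B x) x"
        unfolding periodize_def by (simp flip: sum_negf)
      ultimately show "periodize L \<rho> (\<lambda>x. indicat_real B x - indicator A x) x = 0" by simp
    qed
    show False
    proof (rule key[OF empty(3,2) ne ae empty(5)])
      fix l assume l: "l \<in> L"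
      show "interior B \<inter> (+) (- l) ` interior A = {}"
      proof (rule ccontr)
        assume "interior B \<inter> (+) (- l) ` interior A \<noteq> {}"
        then obtain y where y: "y \<in> interior A" "- l + y \<in> interior B" by blast
        then have "y \<in> (+) (- (- l)) ` interior B" by (intro image_eqI[of _ _ "- l + y"]) auto
        then show False using y(1) empty(7)[of "- l"] uminus[OF l] by blast
      qed
    qed
  qed
  ultimately show ?case using equidecomposable_empty by simp
next
  case (insert l S)
  have l: "l \<in> L" using insert.prems(1) by simp
  define A1 where "A1 = (+) l ` A"
  define B1 where "B1 = (+) (- l) ` B"
  have A1: "x \<in> A1 \<longleftrightarrow> x - l \<in> A" for x by (force simp: A1_def image_iff)
  have B1: "x \<in> B1 \<longleftrightarrow> x + l \<in> B" for x by (force simp: B1_def image_iff)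
  have fA: "finite HA" "pw_const UNIV HA (\<lambda>x. x \<in> A)" "bounded A" "closed A" and fB: "finite HB" "pw_const UNIV HB (\<lambda>x. x \<in> B)" "bounded B" "closed B"
    using insert.prems(2,3) by (auto simp: regular_polyhedral_def polyhedral_def)
  obtain H1 where H1: "finite H1" "pw_const UNIV H1 (\<lambda>x. x \<in> A1)" using pw_const_translate_set[OF fA(1,2)] unfolding A1_def by blast
  obtain H2 where H2: "finite H2" "pw_const UNIV H2 (\<lambda>x. x \<in> B1)" using pw_const_translate_set[OF fB(1,2)] unfolding B1_def by blast
  define H where "H = HA \<union> HB \<union> H1 \<union> H2"
  have fH: "finite H" using fA fB H1 H2 by (simp add: H_def)
  have pH: "pw_const UNIV H (\<lambda>x. x \<in> A)" "pw_const UNIV H (\<lambda>x. x \<in> B)" "pw_const UNIV H (\<lambda>x. x \<in> A1)" "pw_const UNIV H (\<lambda>x. x \<in> B1)"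
    using fA(2) fB(2) H1(2) H2(2) by (auto elim!: pw_const_mono simp: H_def)
  \<comment> \<open>\<open>C\<close> is the part of \<open>A\<close> that \<open>l\<close> takes
    into \<open>B\<close>, \<open>C'\<close> its image, and \<open>A'\<close>, \<open>B'\<close> are
    the remainders, all made regular closed.\<close>
  define C where "C = closure (interior (A \<inter> B1))"
  define A' where "A' = closure (interior (A - B1))"
  define C' where "C' = closure (interior (B \<inter> A1))"
  define B' where "B' = closure (interior (B - A1))"
  have p1: "pw_const UNIV H (\<lambda>x. x \<in> A \<inter> B1)" "pw_const UNIV H (\<lambda>x. x \<in> A - B1)" "pw_const UNIV H (\<lambda>x. x \<in> B \<inter> A1)" "pw_const UNIV H (\<lambda>x. x \<in> B - A1)"
    using pH unfolding pw_const_def by blast+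
  have b1: "bounded (A \<inter> B1)" "bounded (A - B1)" "bounded (B \<inter> A1)" "bounded (B - A1)" using fA(3) fB(3) by (auto intro: bounded_subset)
  note rC = reg_regular[OF fH p1(1) b1(1), folded C_def] and rA = reg_regular[OF fH p1(2) b1(2), folded A'_def]
    and rC' = reg_regular[OF fH p1(3) b1(3), folded C'_def] and rB = reg_regular[OF fH p1(4) b1(4), folded B'_def]
  have C'C: "C' = (+) l ` C"
  proof -
    have "(+) l ` (A \<inter> B1) = B \<inter> A1"
    proof -
      have "x \<in> (+) l ` (A \<inter> B1) \<longleftrightarrow> x - l \<in> A \<inter> B1" for x by (force simp: image_iff)
      then show ?thesis using A1 B1 by auto
    qed
    then show ?thesis unfolding C'_def C_def by (simp only: closure_translation interior_translation flip: \<open>(+) l ` (A \<inter> B1) = B \<inter> A1\<close>)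
  qed
  have sub: "A' \<subseteq> A" "C \<subseteq> A" "B' \<subseteq> B" "C' \<subseteq> B"
    unfolding A'_def C_def B'_def C'_def using fA(4) fB(4) interior_subset by (intro closure_minimal; blast)+
  have clo: "closed A'" "closed C" "closed B'" "closed C'" by (simp_all add: A'_def C_def B'_def C'_def)
  have regA: "regular_polyhedral H A" "regular_polyhedral H B" using insert.prems(2,3) regular_mono[OF _ fH] by (auto simp: H_def)
  have "A \<subseteq> A' \<union> C" by (rule regular_eq_closure_generic[OF regA(1) fH]) (use clo rA(2) rC(2) in auto)
  then have Aeq: "A = A' \<union> C" using sub by blast
  have "B \<subseteq> B' \<union> C'" by (rule regular_eq_closure_generic[OF regA(2) fH]) (use clo rB(2) rC'(2) in auto)
  then have Beq: "B = B' \<union> (+) l ` C" using sub C'C by blast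
  have dA: "interior A' \<inter> interior C = {}"
  proof (rule ccontr)
    assume "interior A' \<inter> interior C \<noteq> {}"
    from generic_in_open[OF fH open_Int[OF open_interior open_interior] this]
    obtain x where x: "x \<in> interior A'" "x \<in> interior C" "generic UNIV H x" by blast
    have "x \<in> A'" "x \<in> C" using x interior_subset by blast+
    then show False using rA(2)[OF x(3)] rC(2)[OF x(3)] by blast
  qed
  have dB: "interior B' \<inter> interior ((+) l ` C) = {}"
  proof (rule ccontr)
    assume "interior B' \<inter> interior ((+) l ` C) \<noteq> {}"
    from generic_in_open[OF fH open_Int[OF open_interior open_interior] this]
    obtain x where x: "x \<in> interior B'" "x \<in> interior C'" "generic UNIV H x" unfolding C'C by blast
    have "x \<in> B'" "x \<in> C'" using x interior_subset by blast+
    then show False using rB(2)[OF x(3)] rC'(2)[OF x(3)] by blast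
  qed
  have "equidecomposable L A' B'"
  proof (rule insert.IH)
    show "S \<subseteq> L" using insert.prems(1) by simp
    show "regular_polyhedral H A'" "regular_polyhedral H B'" using rA(1) rB(1) .
    show "A' \<subseteq> cball 0 \<rho>" "B' \<subseteq> cball 0 \<rho>" using sub insert.prems(4,5) by auto
    let ?f = "\<lambda>x. indicat_real A x - indicat_real B x" and ?f' = "\<lambda>x. indicat_real A' x - indicat_real B' x"
    let ?a = "\<lambda>x. indicat_real (A \<inter> B1) x" and ?b = "\<lambda>x. indicat_real (B \<inter> A1) x"
    have out: "x \<notin> A" "x \<notin> B" "x \<notin> A'" "x \<notin> B'" if "norm x > \<rho>" for x using that insert.prems(4,5) sub by auto
    have "ae_on UNIV (periodize L \<rho> ?f') (periodize L \<rho> (\<lambda>x. ?f x - (?a x - ?b x)))"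
    proof (rule periodize_ae)
      show "ae_on UNIV ?f' (\<lambda>x. ?f x - (?a x - ?b x))"
      proof (rule ae_on_generic[OF fH])
        fix x assume "generic UNIV H x"
        then show "?f' x = ?f x - (?a x - ?b x)" using rA(2)[of x] rB(2)[of x] by (auto simp: indicator_def)
      qed
    qed (use out in \<open>auto simp: indicator_def\<close>)
    moreover have "periodize L \<rho> (\<lambda>x. ?f x - (?a x - ?b x)) x = periodize L \<rho> ?f x" for x
    proof -
      \<comment> \<open>The two removed parts are translates of each other by \<open>l\<close>, so
        they cancel in the periodization.\<close>
      have "periodize L \<rho> ?a x = periodize L \<rho> ?b x"
        by (rule periodize_shift[OF _ _ _ l]) (use out A1 B1 in \<open>auto simp: indicator_def\<close>)
      then show ?thesis by (simp add: periodize_def sum_subtractf)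
    qed
    ultimately have "ae_on UNIV (periodize L \<rho> ?f') (periodize L \<rho> ?f)" by (rule ae_on_trans[OF _ ae_on_eq])
    then show "ae_on UNIV (periodize L \<rho> ?f') (\<lambda>_. 0)" using insert.prems(6) by (rule ae_on_trans)
    fix k assume k: "k \<in> L - S"
    show "interior A' \<inter> (+) (- k) ` interior B' = {}"
    \<comment> \<open>For \<open>l\<close> itself: a generic point of \<open>A'\<close> taken into
      \<open>B'\<close> would lie in \<open>B1\<close>, which was removed. Other vectors had no
      common part before, and the sets only shrank.\<close>
    proof (cases "k = l")
      case False
      have "interior A' \<subseteq> interior A" "interior B' \<subseteq> interior B" using sub by (simp_all add: interior_mono)
      then show ?thesis using insert.prems(7)[of k] k False by blast
    next
      case True
      show ?thesis
      proof (rule ccontr)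
        assume ne: "interior A' \<inter> (+) (- k) ` interior B' \<noteq> {}"
        have "open (interior A' \<inter> (+) (- k) ` interior B')" by (intro open_Int open_translation) auto
        then obtain x where x: "x \<in> interior A'" "x \<in> (+) (- k) ` interior B'" "generic UNIV H x"
          using generic_in_open[OF fH _ ne] by blast
        from x(2) obtain z where "z \<in> interior B'" "x = - l + z" using True by blast
        then have "x + l \<in> B'" using subsetD[OF interior_subset, of z B'] by simp
        then have "x \<in> B1" using B1 sub by blast
        moreover have "x \<in> A'" using x(1) interior_subset by blast
        ultimately show False using rA(2)[OF x(3)] by blast
      qed
    qed
  qed
  from equidecomposable_insert[OF this _ _ l dA dB] show ?case
    using regular_region[OF rC(1)] regular_region[OF rC'(1)] Aeq Beq C'C by simp
qed

end

text \<open>Integer coordinates in the generating basis are values of bounded linear functionals, so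
  a norm bound leaves finitely many coordinate vectors.\<close>

lemma lattice_discrete_group:
  fixes L :: "'a::euclidean_space set"
  assumes "is_lattice L" shows "discrete_group L"
proof -
  obtain B where B: "independent B" "L = group_closure B" using assms by (auto simp: is_lattice_def)
  have fB: "finite B" using B(1) independent_imp_finite by blast
  have rep: "\<exists>k::'a \<Rightarrow> int. x = (\<Sum>b\<in>B. of_int (k b) *\<^sub>R b)" if "x \<in> L" for x
    using that unfolding B(2)
  proof induction
    case (base s)
    show ?case
    proof (cases "s \<in> B")
      case True
      have "(\<Sum>b\<in>B. of_int (if b = s then 1 else 0) *\<^sub>R b) = (\<Sum>b\<in>B. if b = s then b else 0)" by (intro sum.cong) auto
      then have "s = (\<Sum>b\<in>B. of_int (if b = s then 1 else 0) *\<^sub>R b)" using True fB by (simp add: sum.delta)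
      then show ?thesis by (rule exI[of _ "\<lambda>b. if b = s then 1 else 0"])
    next
      \<comment> \<open>The base case of \<open>group_closure\<close> also admits 0.\<close>
      case False
      then show ?thesis using base by (intro exI[of _ "\<lambda>_. 0"]) auto
    qed
  next
    case (diff s t)
    then obtain j k :: "'a \<Rightarrow> int" where "s = (\<Sum>b\<in>B. of_int (j b) *\<^sub>R b)" "t = (\<Sum>b\<in>B. of_int (k b) *\<^sub>R b)" by blast
    then show ?case by (intro exI[of _ "\<lambda>b. j b - k b"]) (simp add: scaleR_diff_left sum_subtractf)
  qed
  have "\<exists>\<phi> :: 'a \<Rightarrow> real. linear \<phi> \<and> (\<forall>x\<in>B. \<phi> x = (if x = b then 1 else 0))" for b
    using linear_independent_extend[OF B(1), of "\<lambda>x. if x = b then 1 else 0"] by blast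
  then obtain \<phi> :: "'a \<Rightarrow> 'a \<Rightarrow> real" where \<phi>: "\<And>b. linear (\<phi> b)" "\<And>b x. x \<in> B \<Longrightarrow> \<phi> b x = (if x = b then 1 else 0)" by metis
  have "\<exists>K. \<forall>x. norm (\<phi> b x) \<le> K * norm x" for b using linear_bounded[OF \<phi>(1)] by blast
  then obtain K where K: "\<And>b x. \<bar>\<phi> b x\<bar> \<le> K b * norm x" by (metis real_norm_def)
  have K0: "K b \<ge> 0" if "b \<in> B" for b
  proof -
    have "b \<noteq> 0" using B(1) that dependent_zero by blast
    moreover have "0 \<le> K b * norm b" using K[of b b] by linarith
    ultimately show ?thesis by (simp add: zero_le_mult_iff)
  qed
  show ?thesis
  proof
    show "0 \<in> L" "\<And>x y. x \<in> L \<Longrightarrow> y \<in> L \<Longrightarrow> x + y \<in> L" "\<And>x. x \<in> L \<Longrightarrow> - x \<in> L"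
      unfolding B(2) by (auto intro: group_closure_add)
    fix R :: real
    show "finite {l \<in> L. norm l \<le> R}"
    proof (rule finite_subset)
      show "finite ((\<lambda>k. \<Sum>b\<in>B. of_int (k b) *\<^sub>R b) ` (PiE B (\<lambda>b. {- \<lceil>K b * R\<rceil>..\<lceil>K b * R\<rceil>})))"
        using fB by (intro finite_imageI finite_PiE) auto
      show "{l \<in> L. norm l \<le> R} \<subseteq> (\<lambda>k. \<Sum>b\<in>B. of_int (k b) *\<^sub>R b) ` (PiE B (\<lambda>b. {- \<lceil>K b * R\<rceil>..\<lceil>K b * R\<rceil>}))"
      proof clarify
        fix l assume l: "l \<in> L" "norm l \<le> R"
        obtain k :: "'a \<Rightarrow> int" where k: "l = (\<Sum>b\<in>B. of_int (k b) *\<^sub>R b)" using rep[OF l(1)] by blast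
        have "k b \<in> {- \<lceil>K b * R\<rceil>..\<lceil>K b * R\<rceil>}" if b: "b \<in> B" for b
        proof -
          have "\<phi> b l = (\<Sum>c\<in>B. of_int (k c) * \<phi> b c)" unfolding k using \<phi>(1)[of b] by (simp add: linear_sum linear_scale)
          also have "\<dots> = (\<Sum>c\<in>B. if c = b then of_int (k c) else 0)" by (intro sum.cong) (auto simp: \<phi>(2))
          also have "\<dots> = of_int (k b)" using fB b by (simp add: sum.delta)
          finally have "\<bar>of_int (k b)\<bar> \<le> K b * norm l" using K[of b l] by simp
          also have "\<dots> \<le> K b * R" using l(2) K0[OF b] by (intro mult_left_mono)
          finally have "\<bar>k b\<bar> \<le> \<lceil>K b * R\<rceil>" by linarith
          then show ?thesis by auto
        qed
        then have "restrict k B \<in> PiE B (\<lambda>b. {- \<lceil>K b * R\<rceil>..\<lceil>K b * R\<rceil>})" by auto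
        moreover have "l = (\<Sum>b\<in>B. of_int (restrict k B b) *\<^sub>R b)" unfolding k by (intro sum.cong) auto
        ultimately show "l \<in> (\<lambda>k. \<Sum>b\<in>B. of_int (k b) *\<^sub>R b) ` (PiE B (\<lambda>b. {- \<lceil>K b * R\<rceil>..\<lceil>K b * R\<rceil>}))" by blast
      qed
    qed
  qed
qed

text \<open>A generic point of a piece is interior to it, so it lies in only one piece.\<close>

lemma pieces_ae:
  fixes P :: "'i \<Rightarrow> 'a::euclidean_space set"
  assumes "finite I" "\<And>j. j \<in> I \<Longrightarrow> regular_polyhedral (H j) (P j)" "pairwise (\<lambda>i j. interior (P i) \<inter> interior (P j) = {}) I"
  shows "ae_on UNIV (indicat_real (\<Union>j\<in>I. P j)) (\<lambda>x. \<Sum>j\<in>I. 1 * indicat_real (P j) x)"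
proof (rule ae_on_generic)
  have H: "finite (H j)" "pw_const UNIV (H j) (\<lambda>x. x \<in> P j)" if "j \<in> I" for j using assms(2)[OF that] by (auto simp: regular_polyhedral_def polyhedral_def)
  show "finite (\<Union>(H ` I))" using assms(1) H by auto
  fix x assume g: "generic UNIV (\<Union>(H ` I)) x"
  have int: "x \<in> interior (P j)" if j: "j \<in> I" "x \<in> P j" for j
  proof -
    have "generic UNIV (H j) x" using g generic_mono j(1) by blast
    then obtain e where e: "e > 0" "\<forall>y\<in>UNIV \<inter> ball x e. same_cell (H j) x y" using generic_local[OF H(1)[OF j(1)]] by blast
    have "ball x e \<subseteq> P j" using e(2) pcD[OF H(2)[OF j(1)]] j(2) by blast
    then show ?thesis using e(1) by (meson centre_in_ball interior_maximal open_ball subsetD)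
  qed
  show "indicat_real (\<Union>j\<in>I. P j) x = (\<Sum>j\<in>I. 1 * indicat_real (P j) x)"
  proof (cases "\<exists>j\<in>I. x \<in> P j")
    case True
    then obtain j where j: "j \<in> I" "x \<in> P j" by blast
    have uniq: "i = j" if "i \<in> I" "x \<in> P i" for i
    proof (rule ccontr)
      assume "i \<noteq> j"
      then have "interior (P i) \<inter> interior (P j) = {}" using assms(3) that(1) j(1) by (simp add: pairwise_def)
      then show False using int[OF that] int[OF j] by blast
    qed
    have "(\<Sum>i\<in>I. 1 * indicat_real (P i) x) = (\<Sum>i\<in>I. if i = j then 1 else 0)"
    proof (rule sum.cong[OF refl])
      fix i assume "i \<in> I"
      then have "x \<in> P i \<longleftrightarrow> i = j" using uniq j by blast
      then show "1 * indicat_real (P i) x = (if i = j then 1 else 0)" using j by (auto simp: indicator_def)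
    qed
    also have "\<dots> = 1" using assms(1) j(1) by (simp add: sum.delta)
    finally show ?thesis using j by (auto simp: indicator_def)
  qed (auto simp: indicator_def)
qed

lemma flat_int_jumps_sum:
  assumes tw: "tower \<nu> V r m" and top: "V (r + m) = UNIV" and I: "finite I" and P: "\<And>i. i \<in> I \<Longrightarrow> polyhedral (H i) UNIV (P i)"
    and f: "bpw_const UNIV f" "ae_on UNIV f (\<lambda>x. \<Sum>i\<in>I. c i * indicat_real (P i) x)"
  shows "flat_int (V r) (jumps \<nu> r m f) = (\<Sum>i\<in>I. c i * flat_int (V r) (jumps \<nu> r m (indicat_real (P i))))"
proof -
  note V = tower_affine[OF tw]
  have pI: "bpw_const (V (r + m)) (indicat_real (P i))" if "i \<in> I" for i using bpw_const_indicator[OF P[OF that]] top by simp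
  have "flat_int (V r) (jumps \<nu> r m f) = flat_int (V r) (jumps \<nu> r m (\<lambda>x. \<Sum>i\<in>I. c i * indicat_real (P i) x))"
  proof (rule flat_int_cong[OF V])
    show "bpw_const (V r) (jumps \<nu> r m f)" using f(1) top by (intro bpw_const_jumps[OF tw]) simp
    show "bpw_const (V r) (jumps \<nu> r m (\<lambda>x. \<Sum>i\<in>I. c i * indicat_real (P i) x))" by (intro bpw_const_jumps[OF tw] bpw_const_sum I pI)
    show "ae_on (V r) (jumps \<nu> r m f) (jumps \<nu> r m (\<lambda>x. \<Sum>i\<in>I. c i * indicat_real (P i) x))"
      by (rule ae_on_jumps[OF tw]) (unfold top, rule f(2))
  qed
  also have "\<dots> = flat_int (V r) (\<lambda>x. \<Sum>i\<in>I. c i * jumps \<nu> r m (indicat_real (P i)) x)"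
  proof (rule flat_int_cong[OF V])
    show "ae_on (V r) (jumps \<nu> r m (\<lambda>x. \<Sum>i\<in>I. c i * indicat_real (P i) x)) (\<lambda>x. \<Sum>i\<in>I. c i * jumps \<nu> r m (indicat_real (P i)) x)"
      by (rule ae_on_eq, rule jumps_sum[OF tw I]) (use pI bpw_const_lpw_const in auto)
    show "bpw_const (V r) (jumps \<nu> r m (\<lambda>x. \<Sum>i\<in>I. c i * indicat_real (P i) x))" by (intro bpw_const_jumps[OF tw] bpw_const_sum I pI)
    show "bpw_const (V r) (\<lambda>x. \<Sum>i\<in>I. c i * jumps \<nu> r m (indicat_real (P i)) x)" by (intro bpw_const_sum I bpw_const_jumps[OF tw] pI)
  qed
  also have "\<dots> = (\<Sum>i\<in>I. c i * flat_int (V r) (jumps \<nu> r m (indicat_real (P i))))"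
    by (rule flat_int_sum[OF V I]) (rule bpw_const_jumps[OF tw pI])
  finally show ?thesis .
qed

lemma tube_UNIV [simp]: "tube UNIV = UNIV"
  by (simp add: tube_def)

lemma volume_flat_int:
  assumes "polyhedral H UNIV A"
  shows "measure lebesgue A = flat_int UNIV (indicat_real A)"
proof -
  have "A \<in> sets lborel" using assms by (auto simp: polyhedral_def)
  then show ?thesis by (simp add: flat_int_def measure_completion)
qed

lemma bpw_const_indicator_jumps:
  assumes "polyhedral H UNIV P" shows "bpw_const U (jumps \<nu> r m (indicat_real P))"
proof -
  obtain R where "\<And>x. norm x > R \<Longrightarrow> indicat_real P x = 0" using bpw_const_indicator[OF assms] by (auto simp: bpw_const_def)
  then have "norm x > R \<Longrightarrow> jumps \<nu> r m (indicat_real P) x = 0" for x by (rule vanish_jumps)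
  moreover have "pw_const U H (jumps \<nu> r m (indicat_real P))"
    using pw_const_jumps_UNIV[OF _ polyhedral_pw_const_indicator[OF assms]] assms pw_const_mono unfolding polyhedral_def by blast
  ultimately show ?thesis using assms unfolding bpw_const_def polyhedral_def by blast
qed

lemma indicator_translate: "indicat_real ((+) l ` P) x = indicat_real P (x + (- l))" for l :: "'a::euclidean_space"
  by (auto simp: indicator_def image_iff) (metis add.commute diff_add_cancel)

section \<open>Additivity and invariance of the functionals\<close>

context discrete_group
begin

lemma translates_tower:
  fixes \<Phi> :: "'a flag"
  assumes nm: "normals r \<Phi> \<nu>" and U: "U \<in> translates (flat \<Phi> r)"
  shows "\<exists>W. tower \<nu> W r (DIM('a) - r) \<and> W r = U \<and> W (r + (DIM('a) - r)) = UNIV"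
proof -
  obtain l where l: "U = (+) l ` flat \<Phi> r" using U by (auto simp: translates_def)
  have n: "normals r (translate_flag r l \<Phi>) \<nu>" by (rule normals_translate[OF nm])
  then have "r \<le> DIM('a)" by (simp add: normals_def)
  then show ?thesis using normals_tower[OF n] flat_translate[of r r l \<Phi>] n l unfolding normals_def
    by (intro exI[of _ "flat (translate_flag r l \<Phi>)"]) auto
qed

lemma flat_int_ae_zero:
  fixes \<Phi> :: "'a flag"
  assumes nm: "normals r \<Phi> \<nu>" and U: "U \<in> translates (flat \<Phi> r)" and f: "bpw_const U f" "ae_on U f (\<lambda>_. 0)"
  shows "flat_int U f = 0"
proof -
  obtain W where "tower \<nu> W r (DIM('a) - r)" "W r = U" using translates_tower[OF nm U] by blast
  then have "affine U" "U \<noteq> {}" using tower_affine by blast+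
  from flat_int_cong[OF this f(1) bpw_const_zero f(2)] show ?thesis by (simp add: flat_int_zero)
qed

text \<open>All functionals are written over one common set \<open>S\<close> of flats; on each flat
  the integral of the iterated jump is additive.\<close>

lemma hadwiger_additive:
  fixes \<Phi> :: "'a flag"
  assumes fl: "is_flag r \<Phi>" "r \<le> DIM('a)" and I: "finite I" and P: "\<And>i. i \<in> I \<Longrightarrow> polyhedral (H i) UNIV (P i)"
    and A: "polyhedral HA UNIV A" "ae_on UNIV (indicat_real A) (\<lambda>x. \<Sum>i\<in>I. 1 * indicat_real (P i) x)"
  shows "hadwiger r \<Phi> A L = (\<Sum>i\<in>I. hadwiger r \<Phi> (P i) L)"
proof -
  obtain \<nu> where nm: "normals r \<Phi> \<nu>" using flag_normals[OF fl] by blast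
  define E where "E X = {U\<in>translates (flat \<Phi> r). \<not> ae_on U (jumps \<nu> r (DIM('a) - r) (indicat_real X)) (\<lambda>_. 0)}" for X
  have fE: "finite (E X)" if "polyhedral G UNIV X" for X G
    unfolding E_def by (rule finite_support[OF nm _ polyhedral_pw_const_indicator[OF that]]) (use that in \<open>simp add: polyhedral_def\<close>)
  define S where "S = E A \<union> (\<Union>i\<in>I. E (P i))"
  have fS: "finite S" unfolding S_def using fE[OF A(1)] fE[OF P] I by auto
  have St: "S \<subseteq> translates (flat \<Phi> r)" by (auto simp: S_def E_def)
  have "hadwiger r \<Phi> A L = vol_const TYPE('a) r * (\<Sum>U\<in>S. flat_int U (jumps \<nu> r (DIM('a) - r) (indicat_real A)))"
    by (rule hadwiger_sum[OF fl(1) nm A(1) fS St]) (auto simp: S_def E_def)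
  also have "(\<Sum>U\<in>S. flat_int U (jumps \<nu> r (DIM('a) - r) (indicat_real A))) = (\<Sum>U\<in>S. \<Sum>i\<in>I. 1 * flat_int U (jumps \<nu> r (DIM('a) - r) (indicat_real (P i))))"
  proof (rule sum.cong[OF refl])
    fix U assume "U \<in> S"
    then obtain W where W: "tower \<nu> W r (DIM('a) - r)" "W r = U" "W (r + (DIM('a) - r)) = UNIV" using translates_tower[OF nm] St by blast
    show "flat_int U (jumps \<nu> r (DIM('a) - r) (indicat_real A)) = (\<Sum>i\<in>I. 1 * flat_int U (jumps \<nu> r (DIM('a) - r) (indicat_real (P i))))"
      using flat_int_jumps_sum[OF W(1,3) I P bpw_const_indicator[OF A(1)] A(2)] W(2) by simp
  qed
  also have "\<dots> = (\<Sum>i\<in>I. \<Sum>U\<in>S. flat_int U (jumps \<nu> r (DIM('a) - r) (indicat_real (P i))))" by (simp add: sum.swap[of _ I])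
  also have "vol_const TYPE('a) r * \<dots> = (\<Sum>i\<in>I. hadwiger r \<Phi> (P i) L)"
    unfolding sum_distrib_left
  proof (rule sum.cong[OF refl])
    fix i assume i: "i \<in> I"
    have "hadwiger r \<Phi> (P i) L = vol_const TYPE('a) r * (\<Sum>U\<in>S. flat_int U (jumps \<nu> r (DIM('a) - r) (indicat_real (P i))))"
      by (rule hadwiger_sum[OF fl(1) nm P[OF i] fS St]) (use i in \<open>auto simp: S_def E_def\<close>)
    then show "(\<Sum>U\<in>S. vol_const TYPE('a) r * flat_int U (jumps \<nu> r (DIM('a) - r) (indicat_real (P i)))) = hadwiger r \<Phi> (P i) L"
      by (simp add: sum_distrib_left)
  qed
  finally show ?thesis .
qed

text \<open>Shifting by a lattice vector permutes the translates of the flat, and the integral over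
  a flat moves along with function and flat.\<close>

lemma hadwiger_translate:
  fixes \<Phi> :: "'a flag"
  assumes fl: "is_flag r \<Phi>" "r \<le> DIM('a)" and P: "polyhedral H UNIV P" and Q: "polyhedral G UNIV ((+) l ` P)" and l: "l \<in> L"
  shows "hadwiger r \<Phi> ((+) l ` P) L = hadwiger r \<Phi> P L"
proof -
  obtain \<nu> where nm: "normals r \<Phi> \<nu>" using flag_normals[OF fl] by blast
  let ?f = "jumps \<nu> r (DIM('a) - r) (indicat_real P)" and ?g = "jumps \<nu> r (DIM('a) - r) (indicat_real ((+) l ` P))"
  have g: "?g = (\<lambda>x. ?f (x + (- l)))"
  proof -
    have "indicat_real ((+) l ` P) = (\<lambda>x. indicat_real P (x + (- l)))" using indicator_translate by blast
    then show ?thesis using jumps_translate[of \<nu> r "DIM('a) - r" "indicat_real P" "- l"] by simp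
  qed
  define E where "E = {U\<in>translates (flat \<Phi> r). \<not> ae_on U ?f (\<lambda>_. 0)}"
  have fE: "finite E" unfolding E_def by (rule finite_support[OF nm _ polyhedral_pw_const_indicator[OF P]]) (use P in \<open>simp add: polyhedral_def\<close>)
  have tr: "(+) k ` U \<in> translates V" if "U \<in> translates V" "k \<in> L" for U V k
    using that add by (auto simp: translates_def image_image add.assoc[symmetric])
  have sub: "{U\<in>translates (flat \<Phi> r). \<not> ae_on U ?g (\<lambda>_. 0)} \<subseteq> (\<lambda>U. (+) l ` U) ` E"
  proof clarify
    fix U assume U: "U \<in> translates (flat \<Phi> r)" "\<not> ae_on U ?g (\<lambda>_. 0)"
    have "\<not> ae_on ((+) (- l) ` U) ?f (\<lambda>_. 0)"
    proof
      assume "ae_on ((+) (- l) ` U) ?f (\<lambda>_. 0)"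
      from ae_on_translate[OF this] show False using U(2) unfolding g by simp
    qed
    then have "(+) (- l) ` U \<in> E" using tr[OF U(1) uminus[OF l]] by (simp add: E_def)
    moreover have "U = (+) l ` (+) (- l) ` U" by (simp add: image_image)
    ultimately show "U \<in> (\<lambda>U. (+) l ` U) ` E" by blast
  qed
  have "hadwiger r \<Phi> ((+) l ` P) L = vol_const TYPE('a) r * (\<Sum>U\<in>(\<lambda>U. (+) l ` U) ` E. flat_int U ?g)"
    by (rule hadwiger_sum[OF fl(1) nm Q _ _ sub]) (use fE tr l in \<open>auto simp: E_def\<close>)
  also have "(\<Sum>U\<in>(\<lambda>U. (+) l ` U) ` E. flat_int U ?g) = (\<Sum>U\<in>E. flat_int ((+) l ` U) ?g)"
    by (subst sum.reindex) (auto intro!: inj_onI simp: inj_image_eq_iff)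
  also have "\<dots> = (\<Sum>U\<in>E. flat_int U ?f)"
  proof (rule sum.cong[OF refl])
    fix U assume "U \<in> E"
    then obtain W where "tower \<nu> W r (DIM('a) - r)" "W r = U" using translates_tower[OF nm] by (auto simp: E_def)
    then have "affine U" "U \<noteq> {}" using tower_affine by blast+
    then have "flat_int ((+) l ` U) ?g = flat_int U (\<lambda>x. ?g (l + x))" by (rule flat_int_translate[OF _ _ bpw_const_indicator_jumps[OF Q]])
    moreover have "(\<lambda>x. ?g (l + x)) = ?f" unfolding g by simp
    ultimately show "flat_int ((+) l ` U) ?g = flat_int U ?f" by simp
  qed
  also have "vol_const TYPE('a) r * \<dots> = hadwiger r \<Phi> P L"
    by (rule hadwiger_sum[OF fl(1) nm P fE, symmetric]) (auto simp: E_def)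
  finally show ?thesis .
qed

lemma equidecomposable_imp_invariants:
  fixes A B :: "'a set"
  assumes reg: "polytope_region A" "polytope_region B" and eq: "equidecomposable L A B"
  shows "measure lebesgue A = measure lebesgue B"
    and "\<And>r \<Phi>. r \<le> DIM('a) \<Longrightarrow> is_flag r \<Phi> \<Longrightarrow> hadwiger r \<Phi> A L = hadwiger r \<Phi> B L"
proof -
  obtain N :: nat and P Q l where e: "\<And>j. j < N \<Longrightarrow> polytope_region (P j) \<and> polytope_region (Q j)"
        "pairwise (\<lambda>i j. interior (P i) \<inter> interior (P j) = {}) {..<N}"
        "pairwise (\<lambda>i j. interior (Q i) \<inter> interior (Q j) = {}) {..<N}"
        "A = (\<Union>j<N. P j)" "B = (\<Union>j<N. Q j)"
        "\<And>j. j < N \<Longrightarrow> l j \<in> L \<and> Q j = (+) (l j) ` P j"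
    using eq unfolding equidecomposable_def by blast
  obtain HA HB where HA: "polyhedral HA UNIV A" and HB: "polyhedral HB UNIV B" using region_regular reg unfolding regular_polyhedral_def by metis
  have "\<exists>h. regular_polyhedral h (P j)" "\<exists>h. regular_polyhedral h (Q j)" if "j < N" for j using region_regular e(1)[OF that] by blast+
  then obtain h h' where h: "\<And>j. j \<in> {..<N} \<Longrightarrow> regular_polyhedral (h j) (P j)" and h': "\<And>j. j \<in> {..<N} \<Longrightarrow> regular_polyhedral (h' j) (Q j)"
    by (metis lessThan_iff)
  have aeA: "ae_on UNIV (indicat_real A) (\<lambda>x. \<Sum>j\<in>{..<N}. 1 * indicat_real (P j) x)" unfolding e(4) by (rule pieces_ae[OF _ h e(2)]) auto
  have aeB: "ae_on UNIV (indicat_real B) (\<lambda>x. \<Sum>j\<in>{..<N}. 1 * indicat_real (Q j) x)" unfolding e(5) by (rule pieces_ae[OF _ h' e(3)]) auto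
  have hP: "polyhedral (h j) UNIV (P j)" and hQ: "polyhedral (h' j) UNIV (Q j)" if "j \<in> {..<N}" for j using h[OF that] h'[OF that] by (auto simp: regular_polyhedral_def)
  show "hadwiger r \<Phi> A L = hadwiger r \<Phi> B L" if fl: "r \<le> DIM('a)" "is_flag r \<Phi>" for r \<Phi>
  proof -
    have "hadwiger r \<Phi> A L = (\<Sum>j<N. hadwiger r \<Phi> (P j) L)" by (rule hadwiger_additive[OF fl(2,1) _ hP HA aeA]) auto
    also have "\<dots> = (\<Sum>j<N. hadwiger r \<Phi> (Q j) L)"
    proof (rule sum.cong[OF refl])
      fix j assume j: "j \<in> {..<N}"
      then have "l j \<in> L" "Q j = (+) (l j) ` P j" using e(6) by auto
      then show "hadwiger r \<Phi> (P j) L = hadwiger r \<Phi> (Q j) L" using hadwiger_translate[OF fl(2,1) hP[OF j], of "h' j" "l j"] hQ[OF j] by simp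
    qed
    also have "\<dots> = hadwiger r \<Phi> B L" by (rule hadwiger_additive[OF fl(2,1) _ hQ HB aeB, symmetric]) auto
    finally show ?thesis .
  qed
  have vol: "measure lebesgue X = (\<Sum>j<N. flat_int UNIV (indicat_real (R j)))"
    if X: "polyhedral HX UNIV X" and R: "\<And>j. j \<in> {..<N} \<Longrightarrow> polyhedral (k j) UNIV (R j)" and ae: "ae_on UNIV (indicat_real X) (\<lambda>x. \<Sum>j\<in>{..<N}. 1 * indicat_real (R j) x)" for X HX R k
  proof -
    have "flat_int UNIV (indicat_real X) = flat_int UNIV (\<lambda>x. \<Sum>j\<in>{..<N}. 1 * indicat_real (R j) x)"
      by (rule flat_int_cong[OF affine_UNIV UNIV_not_empty bpw_const_indicator[OF X] bpw_const_sum ae]) (use bpw_const_indicator[OF R] in auto)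
    also have "\<dots> = (\<Sum>j<N. 1 * flat_int UNIV (indicat_real (R j)))"
      by (rule flat_int_sum[OF affine_UNIV UNIV_not_empty]) (use bpw_const_indicator[OF R] in auto)
    finally show ?thesis using volume_flat_int[OF X] by simp
  qed
  have "measure lebesgue A = (\<Sum>j<N. flat_int UNIV (indicat_real (P j)))" by (rule vol[OF HA hP aeA])
  also have "\<dots> = (\<Sum>j<N. flat_int UNIV (indicat_real (Q j)))"
  proof (rule sum.cong[OF refl])
    fix j assume j: "j \<in> {..<N}"
    then have q: "Q j = (+) (l j) ` P j" using e(6) by auto
    have "flat_int ((+) (l j) ` UNIV) (indicat_real (Q j)) = flat_int UNIV (\<lambda>x. indicat_real (Q j) (l j + x))"
      by (rule flat_int_translate) (use bpw_const_mono[OF bpw_const_indicator[OF hQ[OF j]]] in auto)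
    moreover have "indicat_real (Q j) (l j + x) = indicat_real (P j) x" for x unfolding q indicator_translate by simp
    ultimately show "flat_int UNIV (indicat_real (P j)) = flat_int UNIV (indicat_real (Q j))" by (simp add: surj_plus)
  qed
  also have "\<dots> = measure lebesgue B" by (rule vol[OF HB hQ aeB, symmetric])
  finally show "measure lebesgue A = measure lebesgue B" .
qed

text \<open>The Hadwiger conditions for \<open>k < DIM('a)\<close> and the volume for
  \<open>k = DIM('a)\<close> both become the statement \<open>hs\<close>: the integrals of the
  iterated jump of \<open>g\<close> over all contributing flats sum to 0.\<close>

lemma invariants_imp_equidecomposable:
  fixes A B :: "'a set"
  assumes reg: "polytope_region A" "polytope_region B" and vol: "measure lebesgue A = measure lebesgue B"
    and had: "\<And>r \<Phi>. r < DIM('a) \<Longrightarrow> is_flag r \<Phi> \<Longrightarrow> hadwiger r \<Phi> A L = hadwiger r \<Phi> B L"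
  shows "equidecomposable L A B"
proof -
  obtain HA HB where rA: "regular_polyhedral HA A" and rB: "regular_polyhedral HB B" using region_regular reg by metis
  then have pA: "polyhedral HA UNIV A" and pB: "polyhedral HB UNIV B" by (auto simp: regular_polyhedral_def)
  have "bounded (A \<union> B)" using pA pB by (simp add: polyhedral_def)
  then obtain \<rho> where \<rho>: "\<And>x. x \<in> A \<union> B \<Longrightarrow> norm x \<le> \<rho>" by (auto simp: bounded_iff)
  define H where "H = HA \<union> HB"
  have fH: "finite H" using pA pB by (simp add: polyhedral_def H_def)
  define g where "g x = indicat_real A x - indicat_real B x" for x
  have pg: "pw_const UNIV H g" unfolding g_def[abs_def]
    using pw_const_mono[OF polyhedral_pw_const_indicator[OF pA], of H UNIV] pw_const_mono[OF polyhedral_pw_const_indicator[OF pB], of H UNIV] by (intro pw_const_diff) (auto simp: H_def)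
  have van: "\<And>y. norm y > \<rho> \<Longrightarrow> g y = 0" using \<rho> by (force simp: g_def indicator_def)
  have bg: "bpw_const UNIV g" using fH pg van unfolding bpw_const_def by blast
  \<comment> \<open>The difference is written as a sum over two indices with coefficients 1 and -1,
    to fit \<open>flat_int_jumps_sum\<close>.\<close>
  let ?X = "\<lambda>i. if i then A else B" and ?c = "\<lambda>i. if i then 1 else (-1::real)"
  have pX: "polyhedral (if i then HA else HB) UNIV (?X i)" for i using pA pB by simp
  have gs: "ae_on UNIV g (\<lambda>x. \<Sum>i\<in>(UNIV::bool set). ?c i * indicat_real (?X i) x)"
  proof (rule ae_on_eq)
    fix x
    have "(\<Sum>i\<in>(UNIV::bool set). F i) = F False + F True" for F :: "bool \<Rightarrow> real" by (simp add: UNIV_bool)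
    from this[of "\<lambda>i. ?c i * indicat_real (?X i) x"] show "g x = (\<Sum>i\<in>(UNIV::bool set). ?c i * indicat_real (?X i) x)"
      by (simp only:) (simp add: g_def)
  qed
  have hs: "(\<Sum>U\<in>{U\<in>translates (flat \<Phi> k). \<not> ae_on U (jumps \<nu> k (DIM('a) - k) g) (\<lambda>_. 0)}. flat_int U (jumps \<nu> k (DIM('a) - k) g)) = 0"
    if k: "k \<le> DIM('a)" and fl: "is_flag k \<Phi>" and nm: "normals k \<Phi> \<nu>" for k and \<Phi> :: "'a flag" and \<nu>
  proof -
    let ?J = "jumps \<nu> k (DIM('a) - k)"
    define E where "E f = {U\<in>translates (flat \<Phi> k). \<not> ae_on U (?J f) (\<lambda>_. 0)}" for f
    have fi: "flat_int U (?J g) = flat_int U (?J (indicat_real A)) - flat_int U (?J (indicat_real B))" if U: "U \<in> translates (flat \<Phi> k)" for U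
    proof -
      obtain W where W: "tower \<nu> W k (DIM('a) - k)" "W k = U" "W (k + (DIM('a) - k)) = UNIV" using translates_tower[OF nm U] by blast
      show ?thesis using flat_int_jumps_sum[OF W(1,3) finite pX bg gs] W(2) by (simp add: UNIV_bool)
    qed
    show ?thesis
    proof (cases "k < DIM('a)")
      case True
      define S where "S = E g \<union> E (indicat_real A) \<union> E (indicat_real B)"
      have fin: "finite (E g)" "finite (E (indicat_real A))" "finite (E (indicat_real B))"
        unfolding E_def using finite_support[OF nm fH pg] finite_support[OF nm _ polyhedral_pw_const_indicator[OF pA]] finite_support[OF nm _ polyhedral_pw_const_indicator[OF pB]] pA pB
        by (auto simp: polyhedral_def)
      have S: "finite S" "S \<subseteq> translates (flat \<Phi> k)" unfolding S_def using fin by (auto simp: E_def)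
      have pJ: "bpw_const U (?J g)" for U
      proof -
        have "norm x > \<rho> \<Longrightarrow> ?J g x = 0" for x by (rule vanish_jumps) (rule van)
        moreover have "pw_const U H (?J g)" using pw_const_jumps_UNIV[OF fH pg] pw_const_mono by blast
        ultimately show ?thesis using fH unfolding bpw_const_def by blast
      qed
      have "(\<Sum>U\<in>E g. flat_int U (?J g)) = (\<Sum>U\<in>S. flat_int U (?J g))"
      proof (rule sum.mono_neutral_left[OF S(1)])
        show "E g \<subseteq> S" by (auto simp: S_def)
        show "\<forall>U\<in>S - E g. flat_int U (?J g) = 0" using S(2) flat_int_ae_zero[OF nm _ pJ] by (auto simp: E_def)
      qed
      also have "\<dots> = (\<Sum>U\<in>S. flat_int U (?J (indicat_real A))) - (\<Sum>U\<in>S. flat_int U (?J (indicat_real B)))"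
        unfolding sum_subtractf[symmetric] using S(2) fi by (intro sum.cong) auto
      finally have "(\<Sum>U\<in>E g. flat_int U (?J g)) = (\<Sum>U\<in>S. flat_int U (?J (indicat_real A))) - (\<Sum>U\<in>S. flat_int U (?J (indicat_real B)))" .
      moreover have "hadwiger k \<Phi> A L = vol_const TYPE('a) k * (\<Sum>U\<in>S. flat_int U (?J (indicat_real A)))"
        by (rule hadwiger_sum[OF fl nm pA S]) (auto simp: S_def E_def)
      moreover have "hadwiger k \<Phi> B L = vol_const TYPE('a) k * (\<Sum>U\<in>S. flat_int U (?J (indicat_real B)))"
        by (rule hadwiger_sum[OF fl nm pB S]) (auto simp: S_def E_def)
      ultimately have "vol_const TYPE('a) k * (\<Sum>U\<in>E g. flat_int U (?J g)) = hadwiger k \<Phi> A L - hadwiger k \<Phi> B L"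
        by (simp add: right_diff_distrib)
      then show ?thesis using had[OF True fl] vol_const_pos[where r = k, where 'a = 'a] by (simp add: E_def)
    next
      case False
      then have kd: "k = DIM('a)" using k by simp
      have fk: "flat \<Phi> k = UNIV" using nm by (simp add: normals_def kd)
      have t: "translates (flat \<Phi> k) \<subseteq> {UNIV}" unfolding fk translates_def by (auto simp: surj_plus)
      have "flat_int U (?J g) = 0" if U: "U \<in> translates (flat \<Phi> k)" for U
      proof -
        have "U = UNIV" using t U by blast
        then show ?thesis using fi[OF U] vol volume_flat_int[OF pA] volume_flat_int[OF pB] by (simp add: kd)
      qed
      then show ?thesis by simp
    qed
  qed
  \<comment> \<open>The flag consisting of the whole space alone, without half-spaces; along it the
    iterated jump is \<open>g\<close> itself.\<close>
  define \<Phi> :: "'a flag" where "\<Phi> = Flag (restrict (\<lambda>_. UNIV) {DIM('a)..DIM('a)}) (\<lambda>_. undefined)"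
  have fl: "is_flag DIM('a) \<Phi>" by (auto simp: is_flag_def \<Phi>_def aff_dim_UNIV extensional_def)
  have nm: "normals DIM('a) \<Phi> (\<lambda>_. 0)" by (auto simp: normals_def \<Phi>_def)
  have "ae_on (flat \<Phi> DIM('a)) (periodize L \<rho> (jumps (\<lambda>_. 0) DIM('a) (DIM('a) - DIM('a)) g)) (\<lambda>_. 0)"
    by (rule periodize_jumps_zero[OF fH pg van hs order_refl fl nm])
  then have ae: "ae_on UNIV (periodize L \<rho> (\<lambda>x. indicat_real A x - indicator B x)) (\<lambda>_. 0)"
    by (simp add: \<Phi>_def g_def[abs_def])
  show ?thesis
  \<comment> \<open>A vector longer than \<open>2 * \<rho>\<close> takes no point of the ball of
    radius \<open>\<rho>\<close> back into it.\<close>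
  proof (rule greedy[OF fin[of "2 * \<rho>"] _ rA rB _ _ ae])
    fix l assume l: "l \<in> L - {l \<in> L. norm l \<le> 2 * \<rho>}"
    show "interior A \<inter> (+) (- l) ` interior B = {}"
    proof (rule ccontr)
      assume "interior A \<inter> (+) (- l) ` interior B \<noteq> {}"
      then obtain y where y: "y \<in> interior B" "- l + y \<in> interior A" by blast
      then have "norm y \<le> \<rho>" "norm (- l + y) \<le> \<rho>" using \<rho> interior_subset by blast+
      moreover have "norm l \<le> norm y + norm (- l + y)" using norm_triangle_ineq4[of y "- l + y"] by simp
      ultimately show False using l by auto
    qed
  qed (use \<rho> in auto)
qed

end

theorem theorem1p2:
  fixes A B L :: "'a::euclidean_space set"
  assumes "polytope_region A" and "polytope_region B" and "is_lattice L"
  shows "equidecomposable L A B \<longleftrightarrow>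
           measure lebesgue A = measure lebesgue B \<and>
           (\<forall>r<DIM('a). \<forall>\<Phi>. is_flag r \<Phi> \<longrightarrow> hadwiger r \<Phi> A L = hadwiger r \<Phi> B L)"
proof -
  interpret discrete_group L by (rule lattice_discrete_group[OF assms(3)])
  show ?thesis
    using equidecomposable_imp_invariants[OF assms(1,2)] invariants_imp_equidecomposable[OF assms(1,2)]
    by (meson less_imp_le)
qed

end
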